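(* Let $T_{3c}$ be the 3-caterpillar tree and $T_{sn}$ the snowflake tree, i.e. the two 3-valent trees with 6 leaves described in the context, each rooted at one of its leaves (with the remaining leaves labeled $1,\dots,5$). Let $I_{3c}=I_{T_{3c}}$ and $I_{sn}=I_{T_{sn}}$ be the ideals of the Kimura 3-parameter model with these trees, both contained in the polynomial ring $\mathbb{K}[q]=\mathbb{K}[q_{g_1,\ldots,g_5}\mid g_i\in\mathbb{Z}_2\times\mathbb{Z}_2]$. Then the Hilbert polynomials of $\mathbb{K}[q]/I_{3c}$ and $\mathbb{K}[q]/I_{sn}$ take different values at $3$. Hence these Hilbert polynomials are different. In particular, for the Kimura 3-parameter model of a 3-valent tree $T$, the Hilbert polynomial of $\mathbb{K}[q]/I_T$ is not determined by the number of leaves of $T$; it depends on the shape of $T$.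
   Context: $\mathbb{K}$ is a field. A 3-valent tree is a finite tree in which every non-leaf vertex has degree 3. Kimura 3-parameter model. Let $T$ be a 3-valent tree with $n+1$ leaves labeled $1,\ldots,n+1$, rooted at the leaf $n+1$, with edges directed away from the root, and with edge set $E(T)$. A leaf $l$ is a descendant of an edge $e$ if there is a directed path from $e$ to $l$ (a path starting with $e$ and ending at $l$; in particular the leaf at the head of $e$, if $e$ ends in a leaf, is a descendant of $e$). Write $\mathrm{de}(e)$ for the set of descendants of $e$. For a sequence $g_1,\ldots,g_n\in\mathbb{Z}_2\times\mathbb{Z}_2$ and an edge $e$, set $g_e=\sum_{i\in \mathrm{de}(e)}g_i$. Let $\mathbb{K}[q]=\mathbb{K}[q_{g_1,\ldots,g_n}\mid g_i\in\mathbb{Z}_2\times\mathbb{Z}_2]$ and $\mathbb{K}[a]=\mathbb{K}[a_h^{(e)}\mid e\in E(T),\,h\in\mathbb{Z}_2\times\mathbb{Z}_2]$ be polynomial rings, and let $\phi_T:\mathbb{K}[q]\to\mathbb{K}[a]$ be the $\mathbb{K}$-algebra homomorphism with $\phi_T(q_{g_1,\ldots,g_n})=\prod_{e\in E(T)}a^{(e)}_{g_e}$. The ideal of the Kimura 3-parameter model with tree $T$ is $I_T=\ker(\phi_T)$. It is homogeneous for the standard grading of $\mathbb{K}[q]$ (every variable $q_{g_1,\ldots,g_n}$ has degree 1), and the Hilbert polynomial of $\mathbb{K}[q]/I_T$ is taken with respect to this grading (it is also called the Hilbert polynomial of the ideal $I_T$, or of the model). The two trees. Both have 6 leaves, 4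 interior vertices (each of degree 3) and 9 edges, 3 of which are interior (join two interior vertices). - The 3-caterpillar tree $T_{3c}$: the interior vertices $v_1,v_2,v_3,v_4$ form a path $v_1-v_2-v_3-v_4$; two leaves are attached to each of $v_1$ and $v_4$, and one leaf is attached to each of $v_2$ and $v_3$. - The snowflake tree $T_{sn}$: there is a central interior vertex $c$ adjacent to three interior vertices $w_1,w_2,w_3$, and two leaves are attached to each of $w_1,w_2,w_3$. *)

theory Defs
  imports
    "HOL-Library.Poly_Mapping"
    "HOL-Library.Z2"
    "HOL-Library.Product_Plus"
    "HOL-Computational_Algebra.Polynomial"
    "HOL-Algebra.QuotRing"
    "HOL-Algebra.Embedded_Algebras"
begin

section \<open>Multivariate polynomials and Hilbert polynomials\<close>

type_synonym ('x, 'k) mpol = "('x \<Rightarrow>\<^sub>0 nat) \<Rightarrow>\<^sub>0 'k"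

definition mconst :: "'k::field \<Rightarrow> ('x, 'k) mpol" where
  "mconst c = Poly_Mapping.single 0 c"

definition mvar :: "'x \<Rightarrow> ('x, 'k::field) mpol" where
  "mvar x = Poly_Mapping.single (Poly_Mapping.single x 1) 1"

definition mpol_ring :: "'x set \<Rightarrow> ('x, 'k::field) mpol ring" where
  "mpol_ring X =
    \<lparr>carrier = {p. \<forall>m \<in> Poly_Mapping.keys p. Poly_Mapping.keys m \<subseteq> X},
     monoid.mult = (*), one = 1, ring.zero = 0, add = (+)\<rparr>"

text \<open>The \<open>'k\<close>-algebra homomorphism that sends each variable \<open>x\<close> to \<open>f x\<close>.\<close>

definition mpol_subst :: "('x \<Rightarrow> ('y, 'k) mpol) \<Rightarrow> ('x, 'k::field) mpol \<Rightarrow> ('y, 'k) mpol" where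
  "mpol_subst f p =
    (\<Sum>m \<in> Poly_Mapping.keys p. mconst (Poly_Mapping.lookup p m) *
       (\<Prod>x \<in> Poly_Mapping.keys m. f x ^ Poly_Mapping.lookup m x))"

definition mhomogeneous :: "nat \<Rightarrow> ('x, 'k::field) mpol \<Rightarrow> bool" where
  "mhomogeneous d p \<longleftrightarrow>
    (\<forall>m \<in> Poly_Mapping.keys p. (\<Sum>x \<in> Poly_Mapping.keys m. Poly_Mapping.lookup m x) = d)"

text \<open>In the next two definitions \<open>I\<close> is meant to be a homogeneous ideal of \<open>mpol_ring X\<close>. The ground
  field is embedded in the quotient ring as the set of cosets of constants.\<close>

definition hilbert_function :: "'x set \<Rightarrow> ('x, 'k::field) mpol set \<Rightarrow> nat \<Rightarrow> nat" where
  "hilbert_function X I d =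
    (let R = mpol_ring X in
     THE k. ring.dimension (R Quot I) k
       (range (\<lambda>c. I +>\<^bsub>R\<^esub> mconst c))
       ((\<lambda>p. I +>\<^bsub>R\<^esub> p) ` {p \<in> carrier R. mhomogeneous d p}))"

definition hilbert_polynomial :: "'x set \<Rightarrow> ('x, 'k::field) mpol set \<Rightarrow> rat poly" where
  "hilbert_polynomial X I =
    (THE P. \<forall>\<^sub>F d in sequentially. poly P (of_nat d) = of_nat (hilbert_function X I d))"

section \<open>Leaf-labelled 3-valent trees\<close>

text \<open>Vertex set, set of undirected edges, and the vertex carrying each leaf label.\<close>

record 'v ltree =
  verts :: "'v set"
  edges :: "'v set set"
  leaf :: "nat \<Rightarrow> 'v"

definition is_path :: "'v ltree \<Rightarrow> 'v list \<Rightarrow> bool" where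
  "is_path T p \<longleftrightarrow> p \<noteq> [] \<and> distinct p \<and> set p \<subseteq> verts T \<and>
     successively (\<lambda>x y. {x, y} \<in> edges T) p"

definition is_tree :: "'v ltree \<Rightarrow> bool" where
  "is_tree T \<longleftrightarrow> finite (verts T) \<and> verts T \<noteq> {} \<and>
     (\<forall>e \<in> edges T. e \<subseteq> verts T \<and> card e = 2) \<and>
     (\<forall>u \<in> verts T. \<forall>v \<in> verts T. \<exists>p. is_path T p \<and> hd p = u \<and> last p = v) \<and>
     \<not> (\<exists>p. is_path T p \<and> length p \<ge> 3 \<and> {last p, hd p} \<in> edges T)"

definition degree_of :: "'v ltree \<Rightarrow> 'v \<Rightarrow> nat" where
  "degree_of T v = card {e \<in> edges T. v \<in> e}"

definition leaves :: "'v ltree \<Rightarrow> 'v set" where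
  "leaves T = {v \<in> verts T. degree_of T v = 1}"

definition interior :: "'v ltree \<Rightarrow> 'v set" where
  "interior T = verts T - leaves T"

definition trivalent_tree :: "'v ltree \<Rightarrow> bool" where
  "trivalent_tree T \<longleftrightarrow> is_tree T \<and> (\<forall>v \<in> interior T. degree_of T v = 3) \<and>
     bij_betw (leaf T) {1..card (leaves T)} (leaves T)"

definition attached_leaves :: "'v ltree \<Rightarrow> 'v \<Rightarrow> 'v set" where
  "attached_leaves T v = {l \<in> leaves T. {v, l} \<in> edges T}"

definition caterpillar3 :: "'v ltree \<Rightarrow> bool" where
  "caterpillar3 T \<longleftrightarrow> trivalent_tree T \<and>
     (\<exists>v1 v2 v3 v4. distinct [v1, v2, v3, v4] \<and> interior T = {v1, v2, v3, v4} \<and>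
        {v1, v2} \<in> edges T \<and> {v2, v3} \<in> edges T \<and> {v3, v4} \<in> edges T \<and>
        card (attached_leaves T v1) = 2 \<and> card (attached_leaves T v2) = 1 \<and>
        card (attached_leaves T v3) = 1 \<and> card (attached_leaves T v4) = 2)"

definition snowflake :: "'v ltree \<Rightarrow> bool" where
  "snowflake T \<longleftrightarrow> trivalent_tree T \<and>
     (\<exists>c w1 w2 w3. distinct [c, w1, w2, w3] \<and> interior T = {c, w1, w2, w3} \<and>
        {c, w1} \<in> edges T \<and> {c, w2} \<in> edges T \<and> {c, w3} \<in> edges T \<and>
        card (attached_leaves T w1) = 2 \<and> card (attached_leaves T w2) = 2 \<and>
        card (attached_leaves T w3) = 2)"

section \<open>The Kimura 3-parameter model\<close>

type_synonym klein = "bit \<times> bit"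

text \<open>A tree with \<open>n + 1\<close> leaves is rooted at the leaf labelled \<open>n + 1\<close>.\<close>

definition nlab :: "'v ltree \<Rightarrow> nat" where
  "nlab T = card (leaves T) - 1"

definition root :: "'v ltree \<Rightarrow> 'v" where
  "root T = leaf T (nlab T + 1)"

text \<open>The edge between \<open>u\<close> and \<open>v\<close> points from \<open>u\<close> to \<open>v\<close> iff the path from the root to \<open>u\<close>
  avoids \<open>v\<close>; in a tree this selects exactly one direction for each edge.\<close>

definition dedges :: "'v ltree \<Rightarrow> ('v \<times> 'v) set" where
  "dedges T = {(u, v). {u, v} \<in> edges T \<and>
     (\<exists>p. is_path T p \<and> hd p = root T \<and> last p = u \<and> v \<notin> set p)}"

text \<open>The labels of the leaves that are descendants of \<open>e\<close>. The label \<open>n + 1\<close> of the root is not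
  needed, since no edge points to the root.\<close>

definition descendants :: "'v ltree \<Rightarrow> 'v \<times> 'v \<Rightarrow> nat set" where
  "descendants T e = {i \<in> {1..nlab T}. (snd e, leaf T i) \<in> (dedges T)\<^sup>*}"

text \<open>The sequence \<open>g\<^sub>1, \<dots>, g\<^sub>n\<close> is a list, so that \<open>g\<^sub>i\<close> is \<open>gs ! (i - 1)\<close>.\<close>

definition edge_sum :: "'v ltree \<Rightarrow> klein list \<Rightarrow> 'v \<times> 'v \<Rightarrow> klein" where
  "edge_sum T gs e = (\<Sum>i \<in> descendants T e. gs ! (i - 1))"

definition q_vars :: "nat \<Rightarrow> klein list set" where
  "q_vars n = {gs. length gs = n}"

definition a_vars :: "'v ltree \<Rightarrow> (('v \<times> 'v) \<times> klein) set" where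
  "a_vars T = dedges T \<times> UNIV"

definition kimura_hom ::
    "'v ltree \<Rightarrow> (klein list, 'k::field) mpol \<Rightarrow> (('v \<times> 'v) \<times> klein, 'k) mpol" where
  "kimura_hom T = mpol_subst (\<lambda>gs. \<Prod>e \<in> dedges T. mvar (e, edge_sum T gs e))"

definition kimura_ideal :: "'v ltree \<Rightarrow> (klein list, 'k::field) mpol set" where
  "kimura_ideal T = a_kernel (mpol_ring (q_vars (nlab T))) (mpol_ring (a_vars T)) (kimura_hom T)"

definition kimura_hilbert_polynomial :: "'k::field itself \<Rightarrow> 'v ltree \<Rightarrow> rat poly" where
  "kimura_hilbert_polynomial _ T =
     hilbert_polynomial (q_vars (nlab T)) (kimura_ideal T :: (klein list, 'k) mpol set)"

end

theory Submission
  imports Defs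
begin

text \<open>
  The coordinate ring of the model is spanned by monomials, so the Hilbert function at \<open>d\<close> counts the
  multisets of \<open>d\<close> consistent edge labellings, where two multisets are identified if they agree on every
  edge (have the same ``views''). The toric ideal of the tripod has a squarefree initial ideal, so each
  class contains exactly one multiset whose support lies in a certain family of sets. This property
  survives gluing two trees along an edge: the two normal forms are matched monotonically among the
  labellings that take the same value on the common edge. Hence for \<open>d \<ge> 1\<close> the Hilbert function of
  every tree built in this way is a sum of binomial coefficients \<open>(d - 1) choose (k - 1)\<close>, and the
  Hilbert polynomial can be evaluated at 3 by counting classes of multisets of size 3.

  If \<open>t y\<close> is the number of distinct elements of a multiset \<open>y\<close> of size 3 on the Klein group, then the
  tripod has \<open>20 * t y\<close> classes with prescribed view \<open>y\<close> of one edge, and the tree with four leaves has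
  \<open>20 * (48 * t y - 8)\<close> classes with prescribed view of a leaf edge. Summing the squares of the latter
  over \<open>y\<close> gives 69324800 for the caterpillar. Summing \<open>20^3 * t y1 * t y2 * t y3\<close> over the classes
  of the central tripod gives 69248000 for the snowflake.
\<close>

section \<open>Normal forms of multisets modulo views\<close>

text \<open>A labelling is consistent when the three labels at every interior vertex add up to zero.
  As \<open>x = - x\<close> in the Klein group, this condition does not see the direction of the
  edges, so the choice of the root only decides which leaf label is computed from the others. The
  obstacle is gluing: a multiset on the glued tree is not determined by its restrictions to the two
  parts, since members with equal label on the common edge can be recombined. The normal form has to
  fix one recombination and must still be recognisable from its support alone; a non-crossing
  condition on pairs does both. For the tripod, existence of normal forms comes from a weight that
  grows along moves, and uniqueness becomes a finite sign problem over the integers. The counts at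
  size 3 depend only on the number of distinct labels because translations and automorphisms of the
  Klein group together realise all 24 permutations of its elements. What separates the trees is that
  the labels of the three edges at the centre of the snowflake are correlated differently from those
  along the path of the caterpillar.\<close>

definition same_views :: "('a \<Rightarrow> 'g) set \<Rightarrow> 'a multiset \<Rightarrow> 'a multiset \<Rightarrow> bool" where
  "same_views V m m' \<longleftrightarrow> (\<forall>v\<in>V. image_mset v m = image_mset v m')"

definition normal_msets :: "'a set set \<Rightarrow> nat \<Rightarrow> 'a multiset set" where
  "normal_msets D d = {m. set_mset m \<in> D \<and> size m = d}"

text \<open>Whether \<open>m\<close> is a normal form depends only on its support. For a toric ideal this says that some
  initial ideal is generated by squarefree monomials, the non-members of \<open>D\<close> being the supports of its
  monomials.\<close>

definition nf_system :: "'a set \<Rightarrow> ('a \<Rightarrow> 'g) set \<Rightarrow> 'a set set \<Rightarrow> bool" where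
  "nf_system A V D \<longleftrightarrow> finite A \<and> V \<noteq> {} \<and> D \<subseteq> Pow A \<and>
     (\<forall>m. set_mset m \<subseteq> A \<longrightarrow> (\<exists>!m'. set_mset m' \<in> D \<and> same_views V m m'))"

lemma same_views_refl [simp]: "same_views V m m"
  by (simp add: same_views_def)

lemma same_views_sym: "same_views V m m' \<Longrightarrow> same_views V m' m"
  by (simp add: same_views_def)

lemma same_views_trans: "same_views V m m' \<Longrightarrow> same_views V m' m'' \<Longrightarrow> same_views V m m''"
  by (simp add: same_views_def)

lemma same_views_size:
  assumes "same_views V m m'" "V \<noteq> {}"
  shows "size m = size m'"
proof -
  obtain v where "v \<in> V" using assms(2) by blast
  then have "image_mset v m = image_mset v m'"
    using assms(1) unfolding same_views_def by blast
  then have "size (image_mset v m) = size (image_mset v m')"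
    by (rule arg_cong)
  then show ?thesis by simp
qed

lemma nf_system_ex:
  assumes "nf_system A V D" "set_mset m \<subseteq> A"
  obtains m' where "set_mset m' \<in> D" "same_views V m m'"
  using assms unfolding nf_system_def by blast

lemma nf_system_unique:
  assumes "nf_system A V D" "set_mset m \<in> D" "set_mset m' \<in> D" "same_views V m m'"
  shows "m = m'"
proof -
  have "set_mset m \<subseteq> A"
    using assms(1,2) unfolding nf_system_def by blast
  then have "\<exists>!x. set_mset x \<in> D \<and> same_views V m x"
    using assms(1) unfolding nf_system_def by blast
  then show ?thesis
    using assms(2-4) same_views_refl by blast
qed

section \<open>Counting multisets by their exact support\<close>

lemma finite_msets_of_size:
  assumes "finite A"
  shows "finite {m. set_mset m \<subseteq> A \<and> size m = d}"
proof (rule finite_subset)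
  show "{m. set_mset m \<subseteq> A \<and> size m = d} \<subseteq> mset ` {xs. set xs \<subseteq> A \<and> length xs = d}"
  proof
    fix m assume "m \<in> {m. set_mset m \<subseteq> A \<and> size m = d}"
    moreover obtain xs where "mset xs = m" using ex_mset by blast
    ultimately show "m \<in> mset ` {xs. set xs \<subseteq> A \<and> length xs = d}" by force
  qed
qed (simp add: finite_lists_length_eq assms)

text \<open>Removing one copy of \<open>x\<close> leaves a multiset in which \<open>x\<close> still
  occurs or has disappeared: Pascal's rule.\<close>

lemma card_msets_on_insert:
  assumes "finite F" "x \<notin> F"
  shows "card {m. set_mset m = insert x F \<and> size m = Suc d} =
    card {m. set_mset m = insert x F \<and> size m = d} + card {m. set_mset m = F \<and> size m = d}"
proof -
  let ?S = "\<lambda>F d. {m. set_mset m = F \<and> size m = d}"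
  have fin: "finite (?S F d)" if "finite F" for F :: "'a set" and d
    by (rule finite_subset[OF _ finite_msets_of_size[OF that, of d]]) auto
  have eq: "?S (insert x F) (Suc d) = add_mset x ` (?S (insert x F) d \<union> ?S F d)"
  proof
    show "?S (insert x F) (Suc d) \<subseteq> add_mset x ` (?S (insert x F) d \<union> ?S F d)"
    proof
      fix m assume m: "m \<in> ?S (insert x F) (Suc d)"
      then obtain k where k: "m = add_mset x k"
        by (metis (mono_tags, lifting) insertI1 mem_Collect_eq mset_add)
      have "insert x (set_mset k) = insert x F" "size k = d"
        using m k by auto
      then have "set_mset k = insert x F \<or> set_mset k = F"
        using assms(2) by (metis insert_absorb insert_ident)
      then show "m \<in> add_mset x ` (?S (insert x F) d \<union> ?S F d)"
        using k \<open>size k = d\<close> by blast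
    qed
    show "add_mset x ` (?S (insert x F) d \<union> ?S F d) \<subseteq> ?S (insert x F) (Suc d)"
      by (rule subsetI) force
  qed
  have "card (?S (insert x F) (Suc d)) = card (?S (insert x F) d \<union> ?S F d)"
    by (subst eq, rule card_image) (simp add: inj_on_def)
  also have "\<dots> = card (?S (insert x F) d) + card (?S F d)"
  proof (rule card_Un_disjoint)
    show "?S (insert x F) d \<inter> ?S F d = {}"
      using assms(2) by blast
    show "finite (?S (insert x F) d)" "finite (?S F d)"
      by (rule fin; use assms(1) in simp)+
  qed
  finally show ?thesis .
qed

text \<open>These are the compositions of \<open>d + 1\<close> into \<open>n + 1\<close> positive
  parts; the double induction follows Pascal's triangle.\<close>

lemma card_msets_on:
  assumes "finite F" "card F = Suc n"
  shows "card {m. set_mset m = F \<and> size m = Suc d} = d choose n"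
  using assms
proof (induction n arbitrary: F d)
  case 0
  then obtain x where F: "F = {x}"
    by (metis One_nat_def card_1_singletonE)
  have "card {m. set_mset m = {x} \<and> size m = Suc d} = 1" for d
  proof (induction d)
    case 0
    have "{m. m = {#} \<and> size m = 0} = {{#} :: 'a multiset}" by auto
    then show ?case
      using card_msets_on_insert[of "{}" x 0] by simp
  next
    case (Suc d)
    then show ?case
      using card_msets_on_insert[of "{}" x "Suc d"] by simp
  qed
  then show ?case by (simp add: F)
next
  case (Suc n)
  then obtain x G where F: "F = insert x G" "x \<notin> G" "card G = Suc n" "finite G"
    by (metis card_Suc_eq finite_insert)
  note IH = Suc.IH
  show ?case
    unfolding F(1)
  proof (induction d)
    case 0
    have "{m. set_mset m = G \<and> size m = 0} = {}"
      using F(3) by auto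
    then show ?case
      using card_msets_on_insert[OF F(4,2), of 0] by simp
  next
    case (Suc d)
    then show ?case
      using card_msets_on_insert[OF F(4,2), of "Suc d"] IH[OF F(4,3)] by simp
  qed
qed

lemma binomial_poly:
  "\<exists>P :: rat poly. \<forall>d. poly P (of_nat (Suc d)) = of_nat (d choose n)"
proof
  \<comment> \<open>The roots 1, ..., n turn the value at \<open>d + 1\<close> into the falling
    factorial of \<open>d\<close>.\<close>
  let ?P = "Polynomial.smult (1 / fact n) (\<Prod>i<n. [:- of_nat (Suc i), 1:]) :: rat poly"
  show "\<forall>d. poly ?P (of_nat (Suc d)) = of_nat (d choose n)"
  proof
    fix d
    have "poly ?P (of_nat (Suc d)) = (\<Prod>i<n. of_nat d - of_nat i) / fact n"
      by (simp add: poly_prod algebra_simps)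
    also have "\<dots> = of_nat (d choose n)"
      by (simp add: binomial_gbinomial gbinomial_prod_rev atLeast0LessThan)
    finally show "poly ?P (of_nat (Suc d)) = of_nat (d choose n)" .
  qed
qed

lemma card_msets_on_poly:
  assumes "finite F"
  shows "\<exists>P :: rat poly. \<forall>d. poly P (of_nat (Suc d)) =
    of_nat (card {m. set_mset m = F \<and> size m = Suc d})"
proof (cases "card F")
  case 0
  then have "{m. set_mset m = F \<and> size m = Suc d} = {}" for d
    using assms by auto
  then show ?thesis
    by (intro exI[of _ 0]) (simp only: card.empty poly_0 of_nat_0 simp_thms)
next
  case (Suc n)
  then show ?thesis
    using binomial_poly[of n] card_msets_on[OF assms] by simp
qed

text \<open>Splitting by exact support leaves a finite sum of binomial coefficients, as for the
  Hilbert polynomial of a Stanley-Reisner ring. Size 0 is excluded because the empty multiset would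
  be counted by the support \<open>{}\<close>, whose polynomial is 0.\<close>

lemma card_normal_msets_poly:
  assumes "finite A" "D \<subseteq> Pow A"
  shows "\<exists>P :: rat poly. \<forall>d. poly P (of_nat (Suc d)) = of_nat (card (normal_msets D (Suc d)))"
proof -
  have fin: "finite D" "\<And>F. F \<in> D \<Longrightarrow> finite F"
    using assms by (auto intro: finite_subset)
  have "\<exists>P. \<forall>F\<in>D. \<forall>d. poly (P F) (of_nat (Suc d) :: rat) =
      of_nat (card {m. set_mset m = F \<and> size m = Suc d})"
    using card_msets_on_poly fin(2) by (intro bchoice) blast
  then obtain P :: "'a set \<Rightarrow> rat poly" where
    P: "\<And>F d. F \<in> D \<Longrightarrow> poly (P F) (of_nat (Suc d)) =
      of_nat (card {m. set_mset m = F \<and> size m = Suc d})"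
    by blast
  have "poly (\<Sum>F\<in>D. P F) (of_nat (Suc d)) = of_nat (card (normal_msets D (Suc d)))" for d
  proof -
    have "normal_msets D (Suc d) = (\<Union>F\<in>D. {m. set_mset m = F \<and> size m = Suc d})"
      by (auto simp: normal_msets_def)
    moreover have "finite {m. set_mset m = F \<and> size m = Suc d}" if "F \<in> D" for F
      by (rule finite_subset[OF _ finite_msets_of_size[OF fin(2)[OF that], of "Suc d"]]) auto
    ultimately have "card (normal_msets D (Suc d)) =
        (\<Sum>F\<in>D. card {m. set_mset m = F \<and> size m = Suc d})"
      using fin(1) by (simp add: card_UN_disjoint disjoint_iff)
    then show ?thesis
      by (simp add: poly_sum P del: of_nat_Suc)
  qed
  then show ?thesis by blast
qed

section \<open>Gluing along a common view\<close>

text \<open>The fibre product over the label of the common edge; on the level of ideals this is a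
  toric fibre product.\<close>

definition glue :: "('a \<Rightarrow> 'g) \<Rightarrow> ('b \<Rightarrow> 'g) \<Rightarrow> 'a set \<Rightarrow> 'b set \<Rightarrow> ('a \<times> 'b) set" where
  "glue f g A B = {(a, b). a \<in> A \<and> b \<in> B \<and> f a = g b}"

text \<open>The common edge appears twice, once from each side. The two functions may differ in
  general but agree on \<open>glue\<close>.\<close>

definition glue_views :: "('a \<Rightarrow> 'h) set \<Rightarrow> ('b \<Rightarrow> 'h) set \<Rightarrow> ('a \<times> 'b \<Rightarrow> 'h) set" where
  "glue_views V W = (\<lambda>v. v \<circ> fst) ` V \<union> (\<lambda>w. w \<circ> snd) ` W"

text \<open>An arbitrary linear order on a finite set. A different choice changes the normal forms
  of a glued system but not their number.\<close>

definition rank :: "'a set \<Rightarrow> 'a \<Rightarrow> nat" where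
  "rank A = (SOME r. inj_on r A)"

text \<open>Forbids crossing pairs over the same common label. A crossing is a pair of elements of
  the support, so the new leading monomials are squarefree quadrics, those of the exchange relations
  of a Segre product.\<close>

definition comonotone :: "('a \<Rightarrow> 'g) \<Rightarrow> 'a set \<Rightarrow> 'b set \<Rightarrow> ('a \<times> 'b) set \<Rightarrow> bool" where
  "comonotone f A B F \<longleftrightarrow> (\<forall>(a, b)\<in>F. \<forall>(a', b')\<in>F.
     f a = f a' \<longrightarrow> rank A a < rank A a' \<longrightarrow> rank B b \<le> rank B b')"

definition glue_faces ::
    "('a \<Rightarrow> 'g) \<Rightarrow> ('b \<Rightarrow> 'g) \<Rightarrow> 'a set \<Rightarrow> 'b set \<Rightarrow> 'a set set \<Rightarrow> 'b set set \<Rightarrow> ('a \<times> 'b) set set" where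
  "glue_faces f g A B D E =
     {F. F \<subseteq> glue f g A B \<and> fst ` F \<in> D \<and> snd ` F \<in> E \<and> comonotone f A B F}"

lemma inj_on_rank: "finite A \<Longrightarrow> inj_on (rank A) A"
  unfolding rank_def using finite_imp_inj_to_nat_seg[of A] by (intro someI_ex[of "\<lambda>r. inj_on r A"]) blast

text \<open>The least first component must be matched with the least second component over the same
  common label. This pair depends only on the marginals, so both couplings contain it; remove it and
  induct.\<close>

lemma comonotone_coupling_unique:
  assumes "finite A" "finite B"
    and "set_mset W \<subseteq> glue f g A B" "comonotone f A B (set_mset W)"
    and "set_mset W' \<subseteq> glue f g A B" "comonotone f A B (set_mset W')"
    and "image_mset fst W = image_mset fst W'" "image_mset snd W = image_mset snd W'"
  shows "W = W'"
  using assms(3-)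
proof (induction "size W" arbitrary: W W')
  case 0
  then show ?case by simp
next
  case (Suc n)
  note rA = inj_on_rank[OF assms(1)] and rB = inj_on_rank[OF assms(2)]
  define S where "S = fst ` set_mset W"
  have S': "S = fst ` set_mset W'"
    unfolding S_def using Suc.prems(5) by (metis set_image_mset)
  have "S \<noteq> {}" "finite S"
    using Suc.hyps(2) by (auto simp: S_def)
  then obtain a where a: "a \<in> S" "\<And>s. s \<in> S \<Longrightarrow> rank A a \<le> rank A s"
    by (metis arg_min_least arg_min_if_finite(1))
  define T where "T = {b \<in> snd ` set_mset W. g b = f a}"
  have T': "T = {b \<in> snd ` set_mset W'. g b = f a}"
    unfolding T_def using Suc.prems(6) by (metis set_image_mset)
  have "T \<noteq> {}"
    using a(1) Suc.prems(1) by (force simp: T_def S_def glue_def)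
  moreover have "finite T" by (simp add: T_def)
  ultimately obtain b where b: "b \<in> T" "\<And>s. s \<in> T \<Longrightarrow> rank B b \<le> rank B s"
    by (metis arg_min_least arg_min_if_finite(1))
  \<comment> \<open>\<open>a\<close> has some partner \<open>b'\<close> and \<open>b\<close> some
    partner \<open>a'\<close>. If \<open>a'\<close> is not \<open>a\<close>, non-crossing puts
    \<open>b'\<close> at or below \<open>b\<close>, and minimality of \<open>b\<close> forces
    equality.\<close>
  have mem: "(a, b) \<in># U"
    if U: "set_mset U \<subseteq> glue f g A B" "comonotone f A B (set_mset U)"
      "S = fst ` set_mset U" "T = {b \<in> snd ` set_mset U. g b = f a}" for U
  proof -
    obtain b' where b': "(a, b') \<in># U"
      using a(1) U(3) by auto
    obtain a' where a': "(a', b) \<in># U"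
      using b(1) U(4) by auto
    have "a \<in> A" "a' \<in> A" "b \<in> B" "b' \<in> B" "f a = g b'" "f a' = g b"
      using U(1) a' b' by (auto simp: glue_def)
    have "g b = f a" using b(1) U(4) by auto
    have "b' \<in> T"
      using U(4) b' \<open>f a = g b'\<close> by force
    show ?thesis
    proof (cases "a' = a")
      case True
      then show ?thesis using a' by simp
    next
      case False
      have "rank A a \<le> rank A a'"
        using a(2) U(3) a' by force
      moreover have "rank A a \<noteq> rank A a'"
        using False rA \<open>a \<in> A\<close> \<open>a' \<in> A\<close> by (auto dest: inj_onD)
      moreover have "f a = f a'"
        using \<open>g b = f a\<close> \<open>f a' = g b\<close> by simp
      ultimately have "rank B b' \<le> rank B b"
        using U(2) a' b' unfolding comonotone_def by fastforce
      then have "rank B b' = rank B b"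
        using b(2)[OF \<open>b' \<in> T\<close>] by simp
      then have "b' = b"
        using rB \<open>b \<in> B\<close> \<open>b' \<in> B\<close> by (auto dest: inj_onD)
      then show ?thesis using b' by simp
    qed
  qed
  obtain X where X: "W = add_mset (a, b) X"
    using mem[OF Suc.prems(1,2) S_def T_def] by (metis mset_add)
  obtain X' where X': "W' = add_mset (a, b) X'"
    using mem[OF Suc.prems(3,4) S' T'] by (metis mset_add)
  have "X = X'"
    using Suc.prems Suc.hyps(2) unfolding X X'
    by (intro Suc.hyps(1)) (auto simp: comonotone_def)
  then show ?case by (simp add: X X')
qed

text \<open>The north-west corner rule: match least elements greedily.\<close>

lemma comonotone_coupling_ex:
  assumes "finite A" "finite B" "set_mset mA \<subseteq> A" "set_mset mB \<subseteq> B"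
    and "image_mset f mA = image_mset g mB"
  shows "\<exists>W. set_mset W \<subseteq> glue f g A B \<and> comonotone f A B (set_mset W) \<and>
    image_mset fst W = mA \<and> image_mset snd W = mB"
  using assms(3-)
proof (induction "size mA" arbitrary: mA mB)
  case 0
  have "mA = {#}" using 0(1) by simp
  moreover from this have "mB = {#}"
    using 0(4) by simp
  ultimately show ?case by (intro exI[of _ "{#}"]) (simp add: comonotone_def)
next
  case (Suc n)
  have "mA \<noteq> {#}"
    using Suc.hyps(2) by auto
  then obtain a where a: "a \<in># mA" "\<And>s. s \<in># mA \<Longrightarrow> rank A a \<le> rank A s"
    by (metis arg_min_least arg_min_if_finite(1) finite_set_mset set_mset_eq_empty_iff)
  define T where "T = {b \<in> set_mset mB. g b = f a}"
  have "f a \<in># image_mset g mB"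
    using a(1) Suc.prems(3) by (metis image_eqI set_image_mset)
  then have "T \<noteq> {}" "finite T"
    by (auto simp: T_def)
  then obtain b where b: "b \<in> T" "\<And>s. s \<in> T \<Longrightarrow> rank B b \<le> rank B s"
    by (metis arg_min_least arg_min_if_finite(1))
  obtain nA where nA: "mA = add_mset a nA"
    using a(1) by (metis mset_add)
  obtain nB where nB: "mB = add_mset b nB"
    using b(1) by (metis (mono_tags, lifting) T_def mem_Collect_eq mset_add)
  have "g b = f a" using b(1) by (simp add: T_def)
  have "\<exists>W. set_mset W \<subseteq> glue f g A B \<and> comonotone f A B (set_mset W) \<and>
    image_mset fst W = nA \<and> image_mset snd W = nB"
    using Suc.prems Suc.hyps(2) \<open>g b = f a\<close> unfolding nA nB by (intro Suc.hyps(1)) auto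
  then obtain W where W: "set_mset W \<subseteq> glue f g A B" "comonotone f A B (set_mset W)"
    "image_mset fst W = nA" "image_mset snd W = nB"
    by blast
  \<comment> \<open>The new pair is least in its first component among all pairs, and least in its
    second among those with the same common label, so it crosses none of them.\<close>
  have 1: "rank A a \<le> rank A a'" if "(a', b') \<in># W" for a' b'
    using a(2)[of a'] that W(3) nA by force
  have 2: "rank B b \<le> rank B b'" if "(a', b') \<in># W" "f a = f a'" for a' b'
  proof -
    have "b' \<in># nB" using that W(4) by force
    moreover have "g b' = f a" using that W(1) by (auto simp: glue_def)
    ultimately have "b' \<in> T" by (simp add: T_def nB)
    then show ?thesis by (rule b(2))
  qed
  have "rank B y \<le> rank B y'"
    if "(x, y) \<in># add_mset (a, b) W" "(x', y') \<in># add_mset (a, b) W" "f x = f x'"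
      "rank A x < rank A x'" for x y x' y'
  proof (cases "(x, y) = (a, b)")
    case True
    then show ?thesis using 2 that by auto
  next
    case False
    then have xy: "(x, y) \<in># W" using that(1) by auto
    then have "x' \<noteq> a" using 1 that(4) leD by blast
    then have "(x', y') \<in># W" using that(2) by simp
    then show ?thesis
      using W(2) xy that(3,4) unfolding comonotone_def by blast
  qed
  then have "comonotone f A B (set_mset (add_mset (a, b) W))"
    unfolding comonotone_def by blast
  moreover have "set_mset (add_mset (a, b) W) \<subseteq> glue f g A B"
    using W(1) Suc.prems nA nB \<open>g b = f a\<close> by (auto simp: glue_def)
  ultimately show ?case
    using W(3,4) nA nB by (intro exI[of _ "add_mset (a, b) W"]) auto
qed

lemma same_views_glue:
  "same_views (glue_views V W) m m' \<longleftrightarrow>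
    same_views V (image_mset fst m) (image_mset fst m') \<and>
    same_views W (image_mset snd m) (image_mset snd m')"
  unfolding same_views_def glue_views_def ball_Un ball_simps(9) multiset.map_comp ..

lemma glue_image_mset:
  assumes "set_mset m \<subseteq> glue f g A B"
  shows "image_mset f (image_mset fst m) = image_mset g (image_mset snd m)"
    "set_mset (image_mset fst m) \<subseteq> A" "set_mset (image_mset snd m) \<subseteq> B"
proof -
  show "image_mset f (image_mset fst m) = image_mset g (image_mset snd m)"
    unfolding multiset.map_comp using assms by (intro image_mset_cong) (auto simp: glue_def)
  show "set_mset (image_mset fst m) \<subseteq> A" "set_mset (image_mset snd m) \<subseteq> B"
    unfolding set_image_mset using assms by (force simp: glue_def)+
qed

lemma glue_facesD:
  assumes "set_mset m \<in> glue_faces f g A B D E"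
  shows "set_mset m \<subseteq> glue f g A B" "set_mset (image_mset fst m) \<in> D"
    "set_mset (image_mset snd m) \<in> E" "comonotone f A B (set_mset m)"
  using assms unfolding glue_faces_def set_image_mset by blast+

text \<open>Normalise both projections and couple them monotonically. Conversely the views determine
  the normalised projections, and these determine the coupling.\<close>

lemma nf_system_glue:
  assumes A: "nf_system A V D" and B: "nf_system B W E" and f: "f \<in> V" and g: "g \<in> W"
  shows "nf_system (glue f g A B) (glue_views V W) (glue_faces f g A B D E)"
proof -
  have fin: "finite A" "finite B" and D: "D \<subseteq> Pow A" and E: "E \<subseteq> Pow B"
    using A B by (auto simp: nf_system_def)
  have "finite (glue f g A B)"
    by (rule finite_subset[of _ "A \<times> B"]) (auto simp: glue_def fin)
  moreover have "glue_views V W \<noteq> {}"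
    using f by (auto simp: glue_views_def)
  moreover have "glue_faces f g A B D E \<subseteq> Pow (glue f g A B)"
    by (auto simp: glue_faces_def)
  moreover have "\<exists>!m'. set_mset m' \<in> glue_faces f g A B D E \<and> same_views (glue_views V W) m m'"
    if m: "set_mset m \<subseteq> glue f g A B" for m
  proof (rule ex_ex1I)
    obtain mA where mA: "set_mset mA \<in> D" "same_views V (image_mset fst m) mA"
      using nf_system_ex[OF A glue_image_mset(2)[OF m]] by blast
    obtain mB where mB: "set_mset mB \<in> E" "same_views W (image_mset snd m) mB"
      using nf_system_ex[OF B glue_image_mset(3)[OF m]] by blast
    \<comment> \<open>Normalising a side preserves the view of the common edge, because that edge is
      among the views on either side; so the two normal forms can be coupled.\<close>
    have "image_mset f mA = image_mset g mB"
      using mA(2) mB(2) f g glue_image_mset(1)[OF m] unfolding same_views_def by metis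
    then obtain X where X: "set_mset X \<subseteq> glue f g A B" "comonotone f A B (set_mset X)"
      "image_mset fst X = mA" "image_mset snd X = mB"
      using comonotone_coupling_ex[OF fin, of mA mB f g] mA(1) mB(1) D E by blast
    have "fst ` set_mset X = set_mset mA" "snd ` set_mset X = set_mset mB"
      unfolding X(3,4)[symmetric] by simp_all
    then show "\<exists>m'. set_mset m' \<in> glue_faces f g A B D E \<and> same_views (glue_views V W) m m'"
      using X mA mB by (intro exI[of _ X]) (simp add: glue_faces_def same_views_glue)
  next
    fix X Y
    assume X: "set_mset X \<in> glue_faces f g A B D E \<and> same_views (glue_views V W) m X"
      and Y: "set_mset Y \<in> glue_faces f g A B D E \<and> same_views (glue_views V W) m Y"
    then have "same_views V (image_mset fst X) (image_mset fst Y)"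
      "same_views W (image_mset snd X) (image_mset snd Y)"
      by (auto simp: same_views_glue intro: same_views_trans same_views_sym)
    then have "image_mset fst X = image_mset fst Y" "image_mset snd X = image_mset snd Y"
      using nf_system_unique[OF A, of "image_mset fst X" "image_mset fst Y"]
        nf_system_unique[OF B, of "image_mset snd X" "image_mset snd Y"]
        glue_facesD(2,3)[of X f g A B D E] glue_facesD(2,3)[of Y f g A B D E] X Y
      by simp_all
    then show "X = Y"
      using X Y comonotone_coupling_unique[OF fin, of X f g Y] glue_facesD(1,4) by blast
  qed
  ultimately show ?thesis
    unfolding nf_system_def by blast
qed

text \<open>Reduces counting on the glued tree to counting pairs of normal forms with equal view of
  the common edge.\<close>

lemma bij_betw_normal_msets_glue:
  assumes A: "nf_system A V D" and B: "nf_system B W E" and f: "f \<in> V" and g: "g \<in> W"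
  shows "bij_betw (\<lambda>m. (image_mset fst m, image_mset snd m))
    (normal_msets (glue_faces f g A B D E) d)
    {(mA, mB). mA \<in> normal_msets D d \<and> mB \<in> normal_msets E d \<and>
       image_mset f mA = image_mset g mB}" (is "bij_betw ?h ?N ?M")
proof (rule bij_betw_imageI)
  have fin: "finite A" "finite B" and D: "D \<subseteq> Pow A" and E: "E \<subseteq> Pow B"
    using A B by (auto simp: nf_system_def)
  show "inj_on ?h ?N"
  proof (rule inj_onI)
    fix X Y assume "X \<in> ?N" "Y \<in> ?N" "?h X = ?h Y"
    then show "X = Y"
      using comonotone_coupling_unique[OF fin, of X f g Y] glue_facesD(1,4)
      unfolding normal_msets_def by blast
  qed
  show "?h ` ?N = ?M"
  proof
    show "?h ` ?N \<subseteq> ?M"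
    proof
      fix p assume "p \<in> ?h ` ?N"
      then obtain X where X: "set_mset X \<in> glue_faces f g A B D E" "size X = d" "p = ?h X"
        unfolding normal_msets_def by blast
      show "p \<in> ?M"
        using glue_facesD(2,3)[OF X(1)] glue_image_mset(1)[OF glue_facesD(1)[OF X(1)]] X(2,3)
        by (simp add: normal_msets_def)
    qed
  next
    show "?M \<subseteq> ?h ` ?N"
    proof
      fix p assume "p \<in> ?M"
      then obtain mA mB where p: "p = (mA, mB)" "set_mset mA \<in> D" "size mA = d"
        "set_mset mB \<in> E" "size mB = d" "image_mset f mA = image_mset g mB"
        by (auto simp: normal_msets_def)
      then obtain X where X: "set_mset X \<subseteq> glue f g A B" "comonotone f A B (set_mset X)"
        "image_mset fst X = mA" "image_mset snd X = mB"
        using comonotone_coupling_ex[OF fin, of mA mB f g] D E by blast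
      have "fst ` set_mset X = set_mset mA" "snd ` set_mset X = set_mset mB"
        unfolding X(3,4)[symmetric] by simp_all
      moreover have "size X = d"
        using X(3) p(3) by auto
      ultimately have "X \<in> ?N"
        using X p by (simp add: glue_faces_def normal_msets_def)
      then show "p \<in> ?h ` ?N"
        using X p(1) by force
    qed
  qed
qed

section \<open>The tripod\<close>

definition kl :: "nat \<Rightarrow> klein" where
  "kl n = (of_bool (n \<ge> 2), of_bool (odd n))"

text \<open>Base-4 digits: \<open>i div 4\<close> numbers the label of the first edge (the row of
  the cell) and \<open>i mod 4\<close> that of the second (its column).\<close>

definition cell :: "nat \<Rightarrow> klein \<times> klein" where
  "cell i = (kl (i div 4), kl (i mod 4))"

definition tripod_views :: "(klein \<times> klein \<Rightarrow> klein) set" where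
  "tripod_views = {fst, snd, \<lambda>(a, b). a + b}"

text \<open>The pair \<open>(a, b)\<close> stands for the labelling \<open>a, b, a + b\<close> of the edges of a tripod. The moves are
  a Groebner basis of its toric ideal for the reverse lexicographic order with \<open>cell 0\<close> as
  the smallest variable: an entry \<open>(l, t)\<close> stands for the binomial with leading monomial \<open>l\<close> and
  trailing monomial \<open>t\<close>.\<close>

definition tripod_moves :: "(nat list \<times> nat list) list" where
  "tripod_moves = [
   ([1, 8, 15], [0, 11, 13]),
   ([1, 10, 12], [0, 9, 14]),
   ([2, 4, 9], [1, 6, 8]),
   ([2, 4, 15], [0, 7, 14]),
   ([2, 5, 11], [1, 7, 10]),
   ([2, 5, 12], [0, 6, 13]),
   ([3, 4, 10], [0, 6, 11]),
   ([3, 4, 13], [1, 7, 12]),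
   ([3, 5, 8], [0, 7, 9]),
   ([3, 5, 14], [1, 6, 15]),
   ([3, 8, 14], [2, 11, 12]),
   ([3, 10, 13], [2, 9, 15]),
   ([5, 8, 14], [4, 10, 13]),
   ([5, 11, 12], [4, 9, 15]),
   ([7, 9, 14], [6, 11, 13]),
   ([7, 10, 12], [6, 8, 15]),
   ([1, 2, 12, 15], [0, 3, 13, 14]),
   ([1, 3, 8, 10], [0, 2, 9, 11]),
   ([1, 4, 10, 15], [0, 5, 11, 14]),
   ([1, 5, 8, 12], [0, 4, 9, 13]),
   ([2, 3, 4, 5], [0, 1, 6, 7]),
   ([2, 4, 10, 12], [0, 6, 8, 14]),
   ([2, 4, 11, 13], [1, 7, 8, 14]),
   ([2, 5, 8, 15], [0, 7, 10, 13]),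
   ([2, 5, 9, 14], [1, 6, 10, 13]),
   ([3, 4, 8, 15], [0, 7, 11, 12]),
   ([3, 4, 9, 14], [1, 6, 11, 12]),
   ([3, 5, 10, 12], [0, 6, 9, 15]),
   ([3, 5, 11, 13], [1, 7, 9, 15]),
   ([3, 6, 8, 13], [2, 7, 9, 12]),
   ([3, 7, 10, 14], [2, 6, 11, 15]),
   ([5, 6, 8, 11], [4, 7, 9, 10]),
   ([5, 7, 12, 14], [4, 6, 13, 15]),
   ([10, 11, 12, 13], [8, 9, 14, 15])]"

text \<open>The Stanley-Reisner complex of the squarefree initial ideal, whose generators are
  sixteen cubics and eighteen quartics.\<close>

definition tripod_faces :: "(klein \<times> klein) set set" where
  "tripod_faces = {F. \<forall>(l, t)\<in>set tripod_moves. \<not> cell ` set l \<subseteq> F}"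

definition cell_index :: "klein \<times> klein \<Rightarrow> nat" where
  "cell_index = (\<lambda>((a, b), (c, d)). 8 * of_bool (a = 1) + 4 * of_bool (b = 1) + 2 * of_bool (c = 1) + of_bool (d = 1))"

text \<open>An integer weight that increases along every move, found by a solver.\<close>

definition cell_weight :: "klein \<times> klein \<Rightarrow> nat" where
  "cell_weight x = [3, 2, 0, 0, 0, 0, 3, 3, 0, 3, 0, 2, 0, 2, 0, 2] ! cell_index x"

lemma UNIV_klein: "(UNIV :: klein set) = {(0, 0), (0, 1), (1, 0), (1, 1)}"
proof -
  have "(UNIV :: bit set) = {0, 1}"
    using bit.exhaust by blast
  then show ?thesis
    by (auto simp flip: UNIV_Times_UNIV)
qed

lemma finite_klein [simp]: "finite (A :: klein set)"
  by (rule finite_subset[OF subset_UNIV]) (simp add: UNIV_klein)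

lemma finite_klein_pairs [simp]: "finite (A :: (klein \<times> klein) set)"
  by (rule finite_subset[OF subset_UNIV]) (simp flip: UNIV_Times_UNIV)

lemma kl_simps [simp]:
  "kl 0 = (0, 0)" "kl (Suc 0) = (0, 1)" "kl 2 = (1, 0)" "kl 3 = (1, 1)"
  by (simp_all add: kl_def)

lemma upt_16: "[0..<16] = [0, 1, 2, 3, 4, 5, 6, 7, 8, 9, 10, 11, 12, 13, 14, 15]"
  by (simp add: upt_rec numeral_eq_Suc)

lemma lessThan_16: "{..<16::nat} = {0, 1, 2, 3, 4, 5, 6, 7, 8, 9, 10, 11, 12, 13, 14, 15}"
proof -
  have "{..<16::nat} = set [0..<16]" by auto
  then show ?thesis
    unfolding upt_16 by simp
qed

lemma cell_index_cell: "i < 16 \<Longrightarrow> cell_index (cell i) = i"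
proof -
  assume "i < 16"
  then have "i \<in> {..<16}" by simp
  then show ?thesis
    unfolding lessThan_16 by (auto simp: cell_index_def cell_def)
qed

lemma inj_on_cell: "inj_on cell {..<16}"
  by (rule inj_on_inverseI[of _ cell_index]) (simp add: cell_index_cell)

lemma cell_image: "cell ` {..<16} = UNIV"
proof -
  have "(UNIV :: (klein \<times> klein) set) =
      {(0, 0), (0, 1), (1, 0), (1, 1)} \<times> {(0, 0), (0, 1), (1, 0), (1, 1)}"
    by (simp only: UNIV_klein[symmetric] UNIV_Times_UNIV)
  then show ?thesis
    unfolding lessThan_16 by (auto simp: cell_def)
qed

lemma tripod_moves_views:
  assumes "(l, t) \<in> set tripod_moves" "v \<in> tripod_views"
  shows "image_mset v (mset (map cell l)) = image_mset v (mset (map cell t))"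
proof -
  have "\<forall>(l, t)\<in>set tripod_moves. \<forall>v\<in>tripod_views.
      image_mset v (mset (map cell l)) = image_mset v (mset (map cell t))"
    by (simp add: tripod_moves_def tripod_views_def cell_def add_mset_commute)
  then show ?thesis using assms by blast
qed

text \<open>Growth of the weight bounds chains of moves, since a class of multisets with equal views
  is finite. \<open>distinct l\<close> is squarefreeness: it lets the support alone decide whether a
  move applies.\<close>

lemma tripod_moves_weight:
  assumes "(l, t) \<in> set tripod_moves"
  shows "(\<Sum>x\<in>#mset (map cell l). cell_weight x) < (\<Sum>x\<in>#mset (map cell t). cell_weight x)"
    "distinct l" "set l \<subseteq> {..<16}"
proof -
  have "\<forall>(l, t)\<in>set tripod_moves. set l \<subseteq> {..<16} \<and> distinct l \<and> set t \<subseteq> {..<16} \<and>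
      (\<Sum>i\<leftarrow>l. [3, 2, 0, 0, 0, 0, 3, 3, 0, 3, 0, 2, 0, 2, 0, 2::nat] ! i) <
      (\<Sum>i\<leftarrow>t. [3, 2, 0, 0, 0, 0, 3, 3, 0, 3, 0, 2, 0, 2, 0, 2] ! i)"
    by (simp add: tripod_moves_def)
  then have *: "set l \<subseteq> {..<16}" "distinct l" "set t \<subseteq> {..<16}"
      "(\<Sum>i\<leftarrow>l. [3, 2, 0, 0, 0, 0, 3, 3, 0, 3, 0, 2, 0, 2, 0, 2::nat] ! i) <
      (\<Sum>i\<leftarrow>t. [3, 2, 0, 0, 0, 0, 3, 3, 0, 3, 0, 2, 0, 2, 0, 2] ! i)"
    using assms by blast+
  have "(\<Sum>x\<in>#mset (map cell k). cell_weight x) =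
      (\<Sum>i\<leftarrow>k. [3, 2, 0, 0, 0, 0, 3, 3, 0, 3, 0, 2, 0, 2, 0, 2] ! i)" if "set k \<subseteq> {..<16}" for k
    using that by (induction k) (simp_all add: cell_weight_def cell_index_cell)
  then show "(\<Sum>x\<in>#mset (map cell l). cell_weight x) < (\<Sum>x\<in>#mset (map cell t). cell_weight x)"
    "distinct l" "set l \<subseteq> {..<16}"
    using * by simp_all
qed

text \<open>A member of greatest weight in its class is normal: otherwise some move would apply to
  it and raise the weight.\<close>

lemma tripod_normal_form_ex: "\<exists>m'. set_mset m' \<in> tripod_faces \<and> same_views tripod_views m m'"
proof -
  define w where "w k = (\<Sum>x\<in>#k. cell_weight x)" for k
  let ?S = "{k. same_views tripod_views m k}"
  have "?S \<subseteq> {k. set_mset k \<subseteq> UNIV \<and> size k = size m}"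
    using same_views_size[of tripod_views m] by (auto simp: tripod_views_def)
  then have "finite ?S"
    by (rule finite_subset) (rule finite_msets_of_size, simp)
  moreover have "?S \<noteq> {}"
    using same_views_refl by blast
  ultimately have "Max (w ` ?S) \<in> w ` ?S" "\<And>k'. k' \<in> ?S \<Longrightarrow> w k' \<le> Max (w ` ?S)"
    by (intro Max_in Max_ge; force)+
  then obtain k where k: "k \<in> ?S" "\<And>k'. k' \<in> ?S \<Longrightarrow> w k' \<le> w k"
    by force
  have "set_mset k \<in> tripod_faces"
  proof (rule ccontr)
    assume "set_mset k \<notin> tripod_faces"
    then obtain l t where lt: "(l, t) \<in> set tripod_moves" "cell ` set l \<subseteq> set_mset k"
      unfolding tripod_faces_def by auto
    have "distinct (map cell l)"
      using tripod_moves_weight(2,3)[OF lt(1)] inj_on_cell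
      by (simp add: distinct_map inj_on_subset)
    then have "mset (map cell l) \<subseteq># k"
      using lt(2) by (simp add: subseteq_mset_def distinct_count_atmost_1 Suc_le_eq subset_iff flip: set_map)
    then obtain r where r: "k = mset (map cell l) + r"
      by (metis subset_mset.le_iff_add)
    let ?k = "mset (map cell t) + r"
    have "same_views tripod_views k ?k"
      unfolding same_views_def r using tripod_moves_views[OF lt(1)] by simp
    then have "?k \<in> ?S"
      using k(1) same_views_trans by blast
    moreover have "w k < w ?k"
      using tripod_moves_weight(1)[OF lt(1)] by (simp add: w_def r)
    ultimately show False using k(2) by fastforce
  qed
  then show ?thesis using k(1) by blast
qed

text \<open>For two normal multisets with equal views, \<open>x i\<close> will be the difference of the multiplicities of
  \<open>cell i\<close>. By \<open>moves\<close>, neither the positive nor the negative support of \<open>x\<close> contains a leading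
  monomial.\<close>

lemma tripod_arith:
  fixes x :: "nat \<Rightarrow> int"
  assumes
    "x 0 + x 1 + x 2 + x 3 = 0" "x 4 + x 5 + x 6 + x 7 = 0"
    "x 8 + x 9 + x 10 + x 11 = 0" "x 12 + x 13 + x 14 + x 15 = 0"
    "x 0 + x 4 + x 8 + x 12 = 0" "x 1 + x 5 + x 9 + x 13 = 0"
    "x 2 + x 6 + x 10 + x 14 = 0" "x 3 + x 7 + x 11 + x 15 = 0"
    "x 0 + x 5 + x 10 + x 15 = 0" "x 1 + x 4 + x 11 + x 14 = 0"
    "x 2 + x 7 + x 8 + x 13 = 0" "x 3 + x 6 + x 9 + x 12 = 0"
    and moves: "\<forall>(l, t)\<in>set tripod_moves. (\<exists>i\<in>set l. x i \<le> 0) \<and> (\<exists>i\<in>set l. x i \<ge> 0)"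
  shows "x 0 = 0 \<and> x 1 = 0 \<and> x 2 = 0 \<and> x 3 = 0 \<and> x 4 = 0 \<and> x 5 = 0 \<and> x 6 = 0 \<and> x 7 = 0 \<and>
    x 8 = 0 \<and> x 9 = 0 \<and> x 10 = 0 \<and> x 11 = 0 \<and> x 12 = 0 \<and> x 13 = 0 \<and> x 14 = 0 \<and> x 15 = 0"
proof -
  note moves = moves[unfolded tripod_moves_def, simplified, folded One_nat_def]
  show ?thesis
    using assms(1-12) moves by (smt (z3))
qed

text \<open>The filtered list is the form that evaluates: for a concrete view and label it becomes
  four explicit indices, hence one linear equation.\<close>

lemma count_view:
  "count (image_mset v m) y =
    (\<Sum>i\<in>set (filter (\<lambda>i. v (cell i) = y) [0..<16]). count m (cell i))"
proof -
  have "count (image_mset v m) y = (\<Sum>x\<in>{x. v x = y}. count m x)"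
    unfolding count_image_mset by (rule sum.mono_neutral_left) (auto simp: not_in_iff)
  also have "{x. v x = y} = cell ` {i\<in>{..<16}. v (cell i) = y}"
  proof -
    have "\<exists>i<16. x = cell i" for x
      using cell_image by (metis UNIV_I imageE lessThan_iff)
    then show ?thesis by (auto simp: image_iff) metis
  qed
  also have "(\<Sum>x\<in>cell ` {i\<in>{..<16}. v (cell i) = y}. count m x) =
      (\<Sum>i\<in>{i\<in>{..<16}. v (cell i) = y}. count m (cell i))"
    by (rule sum.reindex_cong[OF inj_on_subset[OF inj_on_cell]]) auto
  also have "{i\<in>{..<16}. v (cell i) = y} = set (filter (\<lambda>i. v (cell i) = y) [0..<16])"
    by auto
  finally show ?thesis .
qed

text \<open>The difference \<open>x\<close> of the two multiplicity vectors satisfies the twelve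
  linear equations of the views, and neither its positive nor its negative part contains a leading
  monomial. Only zero meets these conditions.\<close>

lemma tripod_normal_form_unique:
  assumes "set_mset m \<in> tripod_faces" "set_mset m' \<in> tripod_faces" "same_views tripod_views m m'"
  shows "m = m'"
proof -
  define x where "x i = int (count m (cell i)) - int (count m' (cell i))" for i
  have eq: "(\<Sum>i\<in>set (filter (\<lambda>i. v (cell i) = y) [0..<16]). x i) = 0" if "v \<in> tripod_views" for v y
  proof -
    have "int (count (image_mset v m) y) = int (count (image_mset v m') y)"
      using assms(3) that by (simp add: same_views_def)
    then show ?thesis
      unfolding count_view x_def by (simp add: sum_subtractf)
  qed
  have nonface: "\<exists>i\<in>set l. count k (cell i) = 0"
    if "set_mset k \<in> tripod_faces" "(l, t) \<in> set tripod_moves" for k l t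
  proof -
    have "\<not> cell ` set l \<subseteq> set_mset k"
      using that unfolding tripod_faces_def by auto
    then show ?thesis by (auto simp: not_in_iff)
  qed
  have clause: "\<forall>(l, t)\<in>set tripod_moves. (\<exists>i\<in>set l. x i \<le> 0) \<and> (\<exists>i\<in>set l. x i \<ge> 0)"
  proof clarify
    fix l t assume "(l, t) \<in> set tripod_moves"
    \<comment> \<open>A cell of \<open>l\<close> missing from \<open>m\<close> gives
      \<open>x i \<le> 0\<close>, and one missing from \<open>m'\<close> gives
      \<open>x j \<ge> 0\<close>.\<close>
    then obtain i j where "i \<in> set l" "count m (cell i) = 0" "j \<in> set l" "count m' (cell j) = 0"
      using nonface[OF assms(1)] nonface[OF assms(2)] by metis
    then show "(\<exists>i\<in>set l. x i \<le> 0) \<and> (\<exists>i\<in>set l. x i \<ge> 0)"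
      unfolding x_def by (intro conjI bexI[of _ i] bexI[of _ j]) simp_all
  qed
  have "x 0 = 0 \<and> x 1 = 0 \<and> x 2 = 0 \<and> x 3 = 0 \<and> x 4 = 0 \<and> x 5 = 0 \<and> x 6 = 0 \<and> x 7 = 0 \<and>
    x 8 = 0 \<and> x 9 = 0 \<and> x 10 = 0 \<and> x 11 = 0 \<and> x 12 = 0 \<and> x 13 = 0 \<and> x 14 = 0 \<and> x 15 = 0"
  proof (rule tripod_arith[OF _ _ _ _ _ _ _ _ _ _ _ _ clause])
    show "x 0 + x 1 + x 2 + x 3 = 0" "x 4 + x 5 + x 6 + x 7 = 0"
      "x 8 + x 9 + x 10 + x 11 = 0" "x 12 + x 13 + x 14 + x 15 = 0"
      using eq[of "fst" "(0, 0)"] eq[of "fst" "(0, 1)"]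
        eq[of "fst" "(1, 0)"] eq[of "fst" "(1, 1)"]
      unfolding upt_16 by (simp_all add: tripod_views_def cell_def)
    show "x 0 + x 4 + x 8 + x 12 = 0" "x 1 + x 5 + x 9 + x 13 = 0"
      "x 2 + x 6 + x 10 + x 14 = 0" "x 3 + x 7 + x 11 + x 15 = 0"
      using eq[of "snd" "(0, 0)"] eq[of "snd" "(0, 1)"]
        eq[of "snd" "(1, 0)"] eq[of "snd" "(1, 1)"]
      unfolding upt_16 by (simp_all add: tripod_views_def cell_def)
    show "x 0 + x 5 + x 10 + x 15 = 0" "x 1 + x 4 + x 11 + x 14 = 0"
      "x 2 + x 7 + x 8 + x 13 = 0" "x 3 + x 6 + x 9 + x 12 = 0"
      using eq[of "\<lambda>(a, b). a + b" "(0, 0)"] eq[of "\<lambda>(a, b). a + b" "(0, 1)"]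
        eq[of "\<lambda>(a, b). a + b" "(1, 0)"] eq[of "\<lambda>(a, b). a + b" "(1, 1)"]
      unfolding upt_16 by (simp_all add: tripod_views_def cell_def)
  qed
  then have "\<forall>i\<in>{..<16}. x i = 0"
    unfolding lessThan_16 by simp
  then have "count m (cell i) = count m' (cell i)" if "i < 16" for i
    using that by (simp add: x_def)
  then have "count m p = count m' p" for p
    using cell_image by (metis UNIV_I image_iff lessThan_iff)
  then show ?thesis by (rule multiset_eqI)
qed

lemma nf_system_tripod: "nf_system UNIV tripod_views tripod_faces"
  unfolding nf_system_def
proof (intro conjI allI impI)
  fix m :: "(klein \<times> klein) multiset"
  show "\<exists>!m'. set_mset m' \<in> tripod_faces \<and> same_views tripod_views m m'"
    using tripod_normal_form_ex[of m] tripod_normal_form_unique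
    by (metis same_views_sym same_views_trans)
qed (simp_all add: tripod_views_def)

section \<open>Enumerating the normal forms of size 3 on the tripod as sorted index lists\<close>

lemma bij_betw_sorted_msets:
  assumes "inj_on c {..<n::nat}"
  shows "bij_betw (\<lambda>l. mset (map c l)) {l. sorted l \<and> length l = d \<and> set l \<subseteq> {..<n}}
    {m. set_mset m \<subseteq> c ` {..<n} \<and> size m = d}" (is "bij_betw ?h ?L ?M")
proof (rule bij_betw_imageI)
  show "inj_on ?h ?L"
  proof (rule inj_onI)
    fix k l assume kl: "k \<in> ?L" "l \<in> ?L" "?h k = ?h l"
    have "image_mset (the_inv_into {..<n} c) (?h l) = mset l" if "l \<in> ?L" for l
    proof -
      have "map (the_inv_into {..<n} c \<circ> c) l = l"
        using that by (intro map_idI) (auto simp: the_inv_into_f_f[OF assms])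
      then show ?thesis
        unfolding mset_map[symmetric] map_map by (rule arg_cong)
    qed
    from this[OF kl(1)] this[OF kl(2)] have "mset k = mset l"
      unfolding kl(3) by (rule trans[OF sym])
    then have "sort l = k"
      using kl(1) by (intro properties_for_sort) simp_all
    then show "k = l"
      using kl(2) sorted_sort_id[of l] by simp
  qed
  show "?h ` ?L = ?M"
  proof
    show "?M \<subseteq> ?h ` ?L"
    proof
      fix m assume m: "m \<in> ?M"
      define k where "k = image_mset (the_inv_into {..<n} c) m"
      have inv: "c (the_inv_into {..<n} c x) = x" "the_inv_into {..<n} c x \<in> {..<n}" if "x \<in># m" for x
      proof -
        have "x \<in> c ` {..<n}" using m that by blast
        then show "c (the_inv_into {..<n} c x) = x" "the_inv_into {..<n} c x \<in> {..<n}"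
          using f_the_inv_into_f[OF assms] the_inv_into_into[OF assms _ subset_refl] by blast+
      qed
      have "image_mset c k = image_mset id m"
        unfolding k_def multiset.map_comp by (intro image_mset_cong) (simp add: inv)
      then have "m = ?h (sorted_list_of_multiset k)"
        by simp
      moreover have "sorted_list_of_multiset k \<in> ?L"
      proof -
        have "length (sorted_list_of_multiset k) = size m"
          unfolding k_def by (metis mset_sorted_list_of_multiset size_image_mset size_mset)
        moreover have "set (sorted_list_of_multiset k) \<subseteq> {..<n}"
          unfolding set_sorted_list_of_multiset k_def set_image_mset using inv(2) by blast
        ultimately show ?thesis
          using m sorted_sorted_list_of_multiset[of k] by simp
      qed
      ultimately show "m \<in> ?h ` ?L" by blast
    qed
  qed (auto simp: image_subset_iff)
qed

lemma inj_on_kl: "inj_on kl {..<4}"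
proof -
  have "{..<4} = {0, 1, 2, 3::nat}" by auto
  then show ?thesis by (simp add: inj_on_def)
qed

lemma kl_image: "kl ` {..<4} = UNIV"
proof -
  have "{..<4} = {0, 1, 2, 3::nat}" by auto
  then show ?thesis by (simp add: UNIV_klein)
qed

definition tripod_lead :: "nat list \<Rightarrow> bool" where
  "tripod_lead l \<longleftrightarrow> l \<in> fst ` set tripod_moves"

lemma tripod_lead_triple [simp]:
  "tripod_lead [i, j, k] \<longleftrightarrow>
     i = 1 \<and> (j = 8 \<and> k = 15 \<or> j = 10 \<and> k = 12) \<or>
     i = 2 \<and> (j = 4 \<and> (k = 9 \<or> k = 15) \<or> j = 5 \<and> (k = 11 \<or> k = 12)) \<or>
     i = 3 \<and> (j = 4 \<and> (k = 10 \<or> k = 13) \<or> j = 5 \<and> (k = 8 \<or> k = 14) \<or>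
       j = 8 \<and> k = 14 \<or> j = 10 \<and> k = 13) \<or>
     i = 5 \<and> (j = 8 \<and> k = 14 \<or> j = 11 \<and> k = 12) \<or>
     i = 7 \<and> (j = 9 \<and> k = 14 \<or> j = 10 \<and> k = 12)"
  unfolding tripod_lead_def tripod_moves_def by (simp add: conj_disj_distribL)

text \<open>Every leading monomial has at least three distinct cells, so a multiset of size 3
  contains one only by being equal to it. Comparing lists is enough because the leading lists are
  sorted too.\<close>

lemma normal_tripod_iff:
  assumes "sorted l" "length l = 3" "set l \<subseteq> {..<16}"
  shows "mset (map cell l) \<in> normal_msets tripod_faces 3 \<longleftrightarrow> \<not> tripod_lead l"
proof -
  have moves: "\<forall>(k, t)\<in>set tripod_moves. sorted k \<and> distinct k \<and> length k \<ge> 3 \<and> set k \<subseteq> {..<16}"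
    by (simp add: tripod_moves_def)
  have "cell ` set k \<subseteq> cell ` set l \<longleftrightarrow> k = l" if "(k, t) \<in> set tripod_moves" for k t
  proof
    have k: "sorted k" "distinct k" "length k \<ge> 3" "set k \<subseteq> {..<16}"
      using moves that by auto
    assume "cell ` set k \<subseteq> cell ` set l"
    then have sub: "set k \<subseteq> set l"
      using inj_on_cell k(4) assms(3) unfolding inj_on_def by blast
    have "card (set k) \<ge> 3"
      using k(2,3) by (simp add: distinct_card)
    moreover have "card (set l) \<le> 3"
      using card_length[of l] assms(2) by simp
    ultimately have "set k = set l" "card (set l) = length l"
      using card_mono[OF _ sub] assms(2) card_subset_eq[OF _ sub] by simp_all
    then show "k = l"
      using k(1,2) assms(1) by (meson card_distinct sorted_distinct_set_unique)
  qed simp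
  then show ?thesis
    using assms(2) unfolding normal_msets_def tripod_faces_def tripod_lead_def
    by (auto simp: image_iff split_beta)
qed

text \<open>The 64 choices of columns in the rows \<open>p\<close>, \<open>q\<close>,
  \<open>r\<close>. Demanding a sorted list keeps one representative per multiset when rows
  coincide.\<close>

definition row_triples :: "nat \<Rightarrow> nat \<Rightarrow> nat \<Rightarrow> nat list list" where
  "row_triples p q r = filter (\<lambda>l. sorted l \<and> \<not> tripod_lead l)
     (concat (map (\<lambda>a. concat (map (\<lambda>b. map (\<lambda>c. [4 * p + a, 4 * q + b, 4 * r + c])
        [0..<4]) [0..<4])) [0..<4]))"

lemma set_row_triples:
  "set (row_triples p q r) =
    {l. sorted l \<and> map (\<lambda>i. i div 4) l = [p, q, r] \<and> \<not> tripod_lead l}" (is "_ = ?R")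
proof
  show "set (row_triples p q r) \<subseteq> ?R"
  proof
    fix l assume l: "l \<in> set (row_triples p q r)"
    then obtain a b c where "l = [4 * p + a, 4 * q + b, 4 * r + c]" "a < 4" "b < 4" "c < 4"
      unfolding row_triples_def by auto
    then show "l \<in> ?R"
      using l by (simp add: row_triples_def)
  qed
  show "?R \<subseteq> set (row_triples p q r)"
  proof
    fix l assume l: "l \<in> ?R"
    then obtain i j k where ijk: "l = [i, j, k]" "i div 4 = p" "j div 4 = q" "k div 4 = r"
      by (auto simp: map_eq_Cons_conv)
    have "l = [4 * p + i mod 4, 4 * q + j mod 4, 4 * r + k mod 4]"
      unfolding ijk(1) ijk(2-4)[symmetric] by simp
    then have "\<exists>a<4. \<exists>b<4. \<exists>c<4. l = [4 * p + a, 4 * q + b, 4 * r + c]"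
      by (intro exI[of _ "i mod 4"] exI[of _ "j mod 4"] exI[of _ "k mod 4"] conjI) simp_all
    then obtain a b c where "l = [4 * p + a, 4 * q + b, 4 * r + c]" "a < 4" "b < 4" "c < 4"
      by blast
    then show "l \<in> set (row_triples p q r)"
      using l unfolding row_triples_def by (simp add: image_iff)
  qed
qed

lemma distinct_row_triples: "distinct (row_triples p q r)"
  unfolding row_triples_def by (rule distinct_filter) (simp add: upt_rec)

text \<open>Division by 4 is monotone, so a sorted list of cells has a sorted list of rows, and
  prescribing the first view amounts to prescribing that list.\<close>

lemma bij_betw_row_triples:
  assumes "p \<le> q" "q \<le> r" "r < 4"
  shows "bij_betw (\<lambda>l. mset (map cell l)) (set (row_triples p q r))
    {m \<in> normal_msets tripod_faces 3. image_mset fst m = mset (map kl [p, q, r])}"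
    (is "bij_betw ?h _ ?M")
proof -
  let ?L = "{l. sorted l \<and> length l = 3 \<and> set l \<subseteq> {..<16}}"
  have bij: "bij_betw ?h ?L {m. size m = 3}"
    using bij_betw_sorted_msets[OF inj_on_cell, of 3] by (simp add: cell_image)
  have "bij_betw ?h {l\<in>?L. l \<in> set (row_triples p q r)} {m\<in>{m. size m = 3}. m \<in> ?M}"
  proof (rule bij_betw_Collect[OF bij])
    fix l :: "nat list" assume l: "l \<in> ?L"
    let ?k = "map (\<lambda>i. i div 4) l"
    have "sorted ?k"
      using l by (auto simp: sorted_wrt_map intro: sorted_wrt_mono_rel[of _ "(\<le>)"] div_le_mono)
    moreover have "set ?k \<subseteq> {..<4}" "length ?k = 3"
      using l by auto
    ultimately have "mset (map kl ?k) = mset (map kl [p, q, r]) \<longleftrightarrow> ?k = [p, q, r]"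
      using bij_betw_imp_inj_on[OF bij_betw_sorted_msets[OF inj_on_kl, of 3], THEN inj_on_eq_iff, of ?k "[p, q, r]"]
        assms by simp
    moreover have "image_mset fst (mset (map cell l)) = mset (map kl ?k)"
      by (simp add: cell_def multiset.map_comp o_def)
    ultimately show "?h l \<in> ?M \<longleftrightarrow> l \<in> set (row_triples p q r)"
      using l normal_tripod_iff[of l] by (auto simp: set_row_triples)
  qed
  moreover have "{l\<in>?L. l \<in> set (row_triples p q r)} = set (row_triples p q r)"
  proof -
    have "l \<in> ?L" if "l \<in> set (row_triples p q r)" for l
    proof -
      have l: "sorted l" "map (\<lambda>i. i div 4) l = [p, q, r]"
        using that by (auto simp: set_row_triples)
      have "\<forall>i\<in>set (map (\<lambda>i. i div 4) l). i < 4"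
        unfolding l(2) using assms by simp
      then have "set l \<subseteq> {..<16}" by auto
      moreover have "length l = 3"
        using arg_cong[OF l(2), of length] by simp
      ultimately show ?thesis using l(1) by simp
    qed
    then show ?thesis by blast
  qed
  moreover have "{m\<in>{m. size m = 3}. m \<in> ?M} = ?M"
    by (auto simp: normal_msets_def)
  ultimately show ?thesis by simp
qed

lemma sorted_triples:
  "{l::nat list. sorted l \<and> length l = 3 \<and> set l \<subseteq> {..<4}} = set
    [[0,0,0],[0,0,1],[0,0,2],[0,0,3],[0,1,1],[0,1,2],[0,1,3],[0,2,2],[0,2,3],[0,3,3],
     [1,1,1],[1,1,2],[1,1,3],[1,2,2],[1,2,3],[1,3,3],[2,2,2],[2,2,3],[2,3,3],[3,3,3]]"
  (is "?L = set ?R")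
proof
  show "?L \<subseteq> set ?R"
  proof
    fix l assume "l \<in> ?L"
    then obtain i j k where l: "l = [i, j, k]" "i \<le> j" "j \<le> k" "k < 4"
      by (auto simp: length_Suc_conv numeral_eq_Suc)
    then have "i \<in> {0, 1, 2, 3}" "j \<in> {0, 1, 2, 3}" "k \<in> {0, 1, 2, 3}"
      by auto
    then show "l \<in> set ?R"
      using l by (elim insertE emptyE) simp_all
  qed
qed simp

lemma upt_4: "[0..<4] = [0, 1, 2, 3]"
  by (simp add: upt_rec numeral_eq_Suc)

lemmas row_triples_unfold =
  row_triples_def[unfolded upt_4 list.map concat.simps append.simps append_Nil2]

text \<open>Each of the twenty rows is evaluated once, to be shared by the counts that
  follow.\<close>

lemmas row_000 = row_triples_unfold[of 0 0 0, simplified]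
lemmas row_001 = row_triples_unfold[of 0 0 1, simplified]
lemmas row_002 = row_triples_unfold[of 0 0 2, simplified]
lemmas row_003 = row_triples_unfold[of 0 0 3, simplified]
lemmas row_011 = row_triples_unfold[of 0 1 1, simplified]
lemmas row_012 = row_triples_unfold[of 0 1 2, simplified]
lemmas row_013 = row_triples_unfold[of 0 1 3, simplified]
lemmas row_022 = row_triples_unfold[of 0 2 2, simplified]
lemmas row_023 = row_triples_unfold[of 0 2 3, simplified]
lemmas row_033 = row_triples_unfold[of 0 3 3, simplified]
lemmas row_111 = row_triples_unfold[of 1 1 1, simplified]
lemmas row_112 = row_triples_unfold[of 1 1 2, simplified]
lemmas row_113 = row_triples_unfold[of 1 1 3, simplified]
lemmas row_122 = row_triples_unfold[of 1 2 2, simplified]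
lemmas row_123 = row_triples_unfold[of 1 2 3, simplified]
lemmas row_133 = row_triples_unfold[of 1 3 3, simplified]
lemmas row_222 = row_triples_unfold[of 2 2 2, simplified]
lemmas row_223 = row_triples_unfold[of 2 2 3, simplified]
lemmas row_233 = row_triples_unfold[of 2 3 3, simplified]
lemmas row_333 = row_triples_unfold[of 3 3 3, simplified]

lemmas row_triples_eval = 
row_000 row_001 row_002 row_003 row_011 row_012 row_013 row_022 row_023 row_033 row_111 row_112 row_113 row_122 row_123 row_133 row_222 row_223 row_233 row_333

text \<open>The quantity \<open>t\<close> of the overview in a form that the simplifier can evaluate
  on lists.\<close>

definition ndist :: "'a list \<Rightarrow> nat" where
  "ndist l = length (remdups l)"

lemma ndist_triple: "ndist [a, b, c] =
    (if a = b then if b = c then 1 else 2 else if a = c then 2 else if b = c then 2 else 3)"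
  by (simp add: ndist_def)

text \<open>An affine permutation of the Klein group on the first edge, with its linear part on the
  second, maps consistent labellings to consistent labellings. As all permutations are affine, both
  counts depend only on \<open>ndist l\<close>; the linear formulas record the three values. Three
  distinct rows have 64 candidates, of which four are leading cubics. The subtraction is a true one,
  since \<open>ndist l\<close> is positive here.\<close>

lemma row_counts:
  "\<forall>l\<in>{l. sorted l \<and> length l = 3 \<and> set l \<subseteq> {..<4}}.
     length (row_triples (l ! 0) (l ! 1) (l ! 2)) = 20 * ndist l \<and>
     (\<Sum>k\<leftarrow>row_triples (l ! 0) (l ! 1) (l ! 2). ndist (map (\<lambda>i. i mod 4) k)) = 48 * ndist l - 8"
  unfolding sorted_triples by (simp add: row_triples_eval ndist_triple)

text \<open>The first view is constant along a row, so its factor stands outside. The second may be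
  compared by column numbers, as \<open>kl\<close> is injective on them; the third needs the sum in
  the group.\<close>

lemma snow_count:
  "(\<Sum>l\<in>{l. sorted l \<and> length l = 3 \<and> set l \<subseteq> {..<4}}.
     ndist l * (\<Sum>k\<leftarrow>row_triples (l ! 0) (l ! 1) (l ! 2).
        ndist (map (\<lambda>i. i mod 4) k) * ndist (map (\<lambda>i. kl (i div 4) + kl (i mod 4)) k))) = 8656"
  unfolding sorted_triples
  by (simp add: row_triples_eval ndist_triple kl_simps(3)[unfolded numeral_2_eq_2])

text \<open>There are 4, 12 and 4 multisets with one, two and three distinct elements, with 800,
  1760 and 2720 classes above each.\<close>

lemma cat_count:
  "(\<Sum>l\<in>{l. sorted l \<and> length l = 3 \<and> set l \<subseteq> {..<4::nat}}.
     (20 * (48 * ndist l - 8))\<^sup>2) = 69324800"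
  unfolding sorted_triples by (simp add: ndist_triple power2_eq_square)

abbreviation "tripod_cubes \<equiv> normal_msets tripod_faces 3"
abbreviation "index_triples \<equiv> {l::nat list. sorted l \<and> length l = 3 \<and> set l \<subseteq> {..<4}}"

lemma ndist_eq_card: "ndist l = card (set l)"
  by (simp add: ndist_def length_remdups_card_conv)

lemma card_kl_image: "card (kl ` (\<lambda>i. i mod 4) ` A) = card ((\<lambda>i. i mod 4) ` A)"
  by (rule card_image[OF inj_on_subset[OF inj_on_kl]]) auto

lemma index_triple_nth:
  assumes "l \<in> index_triples"
  shows "[l ! 0, l ! 1, l ! 2] = l" "l ! 0 \<le> l ! 1" "l ! 1 \<le> l ! 2" "l ! 2 < 4"
proof -
  obtain p q r where l: "l = [p, q, r]"
    using assms by (auto simp: length_Suc_conv numeral_eq_Suc)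
  show "[l ! 0, l ! 1, l ! 2] = l" "l ! 0 \<le> l ! 1" "l ! 1 \<le> l ! 2" "l ! 2 < 4"
    using assms unfolding l by auto
qed

lemma bij_betw_index_triples:
  "bij_betw (\<lambda>l. mset (map kl l)) index_triples {y :: klein multiset. size y = 3}"
  using bij_betw_sorted_msets[OF inj_on_kl, of 3] by (simp add: kl_image)

lemma card_set_kl:
  assumes "l \<in> index_triples"
  shows "card (set_mset (mset (map kl l))) = ndist l"
  unfolding ndist_eq_card using assms
  by (simp add: card_image[OF inj_on_subset[OF inj_on_kl]])

lemma sum_row:
  assumes "l \<in> index_triples"
  shows "(\<Sum>m\<in>{m \<in> tripod_cubes. image_mset fst m = mset (map kl l)}. f m) =
    (\<Sum>k\<leftarrow>row_triples (l ! 0) (l ! 1) (l ! 2). f (mset (map cell k)))"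
proof -
  have "bij_betw (\<lambda>l. mset (map cell l)) (set (row_triples (l ! 0) (l ! 1) (l ! 2)))
    {m \<in> tripod_cubes. image_mset fst m = mset (map kl l)}"
    using bij_betw_row_triples[OF index_triple_nth(2-4)[OF assms]]
    unfolding index_triple_nth(1)[OF assms] .
  from sum.reindex_bij_betw[OF this, of f]
  show ?thesis
    by (simp add: sum_list_distinct_conv_sum_set distinct_row_triples)
qed

lemma card_row:
  assumes "size y = 3"
  shows "card {m \<in> tripod_cubes. image_mset fst m = y} = 20 * card (set_mset y)"
proof -
  obtain l where l: "l \<in> index_triples" "y = mset (map kl l)"
    using bij_betw_imp_surj_on[OF bij_betw_index_triples] assms by blast
  have "card {m \<in> tripod_cubes. image_mset fst m = y} = length (row_triples (l ! 0) (l ! 1) (l ! 2))"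
    using sum_row[OF l(1), of "\<lambda>_. 1 :: nat"] unfolding l(2) by (simp add: sum_list_triv)
  also have "\<dots> = 20 * ndist l"
    using row_counts l(1) by blast
  finally show ?thesis
    using card_set_kl[OF l(1)] l(2) by simp
qed

lemma sum_row_snd:
  assumes "size y = 3"
  shows "(\<Sum>m\<in>{m \<in> tripod_cubes. image_mset fst m = y}. card (set_mset (image_mset snd m))) =
    48 * card (set_mset y) - 8"
proof -
  obtain l where l: "l \<in> index_triples" "y = mset (map kl l)"
    using bij_betw_imp_surj_on[OF bij_betw_index_triples] assms by blast
  have "(\<Sum>m\<in>{m \<in> tripod_cubes. image_mset fst m = y}. card (set_mset (image_mset snd m))) =
      (\<Sum>k\<leftarrow>row_triples (l ! 0) (l ! 1) (l ! 2). ndist (map (\<lambda>i. i mod 4) k))"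
    unfolding l(2) sum_row[OF l(1)]
    by (simp add: ndist_eq_card cell_def image_image card_kl_image[unfolded image_image])
  also have "\<dots> = 48 * ndist l - 8"
    using row_counts l(1) by blast
  finally show ?thesis
    using card_set_kl[OF l(1)] l(2) by simp
qed

lemma finite_klein_msets: "finite {y :: klein multiset. size y = d}"
  using finite_msets_of_size[of "UNIV :: klein set" d] by simp

lemma sum_snowflake:
  "(\<Sum>m\<in>tripod_cubes. card (set_mset (image_mset fst m)) * card (set_mset (image_mset snd m)) *
     card (set_mset (image_mset (\<lambda>(a, b). a + b) m))) = 8656"
proof -
  let ?f = "\<lambda>m. card (set_mset (image_mset fst m)) * card (set_mset (image_mset snd m)) *
     card (set_mset (image_mset (\<lambda>(a, b). a + b) m :: klein multiset))"
  have "finite tripod_cubes"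
    by (rule finite_subset[OF _ finite_msets_of_size[of UNIV 3]]) (auto simp: normal_msets_def)
  then have "(\<Sum>m\<in>tripod_cubes. ?f m) =
      (\<Sum>y\<in>{y. size y = 3}. \<Sum>m\<in>{m \<in> tripod_cubes. image_mset fst m = y}. ?f m)"
    by (intro sum.group[symmetric] finite_klein_msets) (auto simp: normal_msets_def)
  also have "\<dots> = (\<Sum>l\<in>index_triples. \<Sum>m\<in>{m \<in> tripod_cubes. image_mset fst m = mset (map kl l)}. ?f m)"
    by (rule sum.reindex_bij_betw[OF bij_betw_index_triples, symmetric])
  also have "\<dots> = (\<Sum>l\<in>index_triples. ndist l * (\<Sum>k\<leftarrow>row_triples (l ! 0) (l ! 1) (l ! 2).
        ndist (map (\<lambda>i. i mod 4) k) * ndist (map (\<lambda>i. kl (i div 4) + kl (i mod 4)) k)))"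
  proof (rule sum.cong[OF refl])
    fix l assume l: "l \<in> index_triples"
    have "(\<Sum>m\<in>{m \<in> tripod_cubes. image_mset fst m = mset (map kl l)}. ?f m) =
        (\<Sum>m\<in>{m \<in> tripod_cubes. image_mset fst m = mset (map kl l)}.
          ndist l * (card (set_mset (image_mset snd m)) *
            card (set_mset (image_mset (\<lambda>(a, b). a + b) m :: klein multiset))))"
      by (rule sum.cong[OF refl]) (metis (mono_tags, lifting) card_set_kl[OF l] mem_Collect_eq mult.assoc)
    also have "\<dots> = (\<Sum>k\<leftarrow>row_triples (l ! 0) (l ! 1) (l ! 2).
        ndist l * (ndist (map (\<lambda>i. i mod 4) k) * ndist (map (\<lambda>i. kl (i div 4) + kl (i mod 4)) k)))"
      unfolding sum_row[OF l]
      by (simp add: ndist_eq_card cell_def image_image card_kl_image[unfolded image_image])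
    finally show "(\<Sum>m\<in>{m \<in> tripod_cubes. image_mset fst m = mset (map kl l)}. ?f m) =
      ndist l * (\<Sum>k\<leftarrow>row_triples (l ! 0) (l ! 1) (l ! 2).
        ndist (map (\<lambda>i. i mod 4) k) * ndist (map (\<lambda>i. kl (i div 4) + kl (i mod 4)) k))"
      by (simp add: sum_list_const_mult)
  qed
  finally show ?thesis
    unfolding snow_count .
qed

lemma sum_caterpillar:
  "(\<Sum>y\<in>{y :: klein multiset. size y = 3}. (20 * (48 * card (set_mset y) - 8))\<^sup>2) = 69324800"
proof -
  have "(\<Sum>y\<in>{y :: klein multiset. size y = 3}. (20 * (48 * card (set_mset y) - 8))\<^sup>2) =
      (\<Sum>l\<in>index_triples. (20 * (48 * card (set_mset (mset (map kl l))) - 8))\<^sup>2)"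
    by (rule sum.reindex_bij_betw[OF bij_betw_index_triples, symmetric])
  also have "\<dots> = (\<Sum>l\<in>index_triples. (20 * (48 * ndist l - 8))\<^sup>2)"
    by (intro sum.cong refl arg_cong[where f = "\<lambda>n. (20 * (48 * n - 8))\<^sup>2"] card_set_kl)
  finally show ?thesis
    unfolding cat_count .
qed

section \<open>The two glued systems\<close>

text \<open>The weight \<open>h\<close> makes the count iterable: after one gluing is removed, its
  contribution becomes a weight on what remains.\<close>

lemma sum_normal_msets_glue:
  assumes A: "nf_system A V D" and B: "nf_system B W E" and f: "f \<in> V" and g: "g \<in> W"
  shows "(\<Sum>m\<in>normal_msets (glue_faces f g A B D E) d. h (image_mset fst m) (image_mset snd m)) =
    (\<Sum>mA\<in>normal_msets D d. \<Sum>mB\<in>{mB \<in> normal_msets E d. image_mset g mB = image_mset f mA}. h mA mB)"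
proof -
  have fin: "finite (normal_msets D d)" "finite (normal_msets E d)"
    using A B finite_msets_of_size[of A d] finite_msets_of_size[of B d]
    by (auto simp: normal_msets_def nf_system_def elim!: finite_subset[rotated])
  have "(\<Sum>m\<in>normal_msets (glue_faces f g A B D E) d. h (image_mset fst m) (image_mset snd m)) =
      (\<Sum>(mA, mB)\<in>{(mA, mB). mA \<in> normal_msets D d \<and> mB \<in> normal_msets E d \<and>
       image_mset f mA = image_mset g mB}. h mA mB)"
    using sum.reindex_bij_betw[OF bij_betw_normal_msets_glue[OF A B f g, of d], of "\<lambda>(mA, mB). h mA mB"]
    by simp
  also have "{(mA, mB). mA \<in> normal_msets D d \<and> mB \<in> normal_msets E d \<and>
       image_mset f mA = image_mset g mB} =
     (SIGMA mA:normal_msets D d. {mB \<in> normal_msets E d. image_mset g mB = image_mset f mA})"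
    by auto
  finally show ?thesis
    using fin by (simp add: sum.Sigma)
qed

text \<open>By \<open>card_row\<close>, the number of tripod normal forms over a given view depends
  only on its number of distinct labels. Attaching a tripod therefore multiplies each summand by
  that number.\<close>

lemma card_normal_msets_glue_tripod:
  assumes "nf_system A V D" "f \<in> V"
  shows "(\<Sum>m\<in>normal_msets (glue_faces f fst A UNIV D tripod_faces) 3. h (image_mset fst m)) =
    (\<Sum>m\<in>normal_msets D 3. 20 * card (set_mset (image_mset f m)) * h m)"
proof -
  have "fst \<in> tripod_views" by (simp add: tripod_views_def)
  from sum_normal_msets_glue[OF assms(1) nf_system_tripod assms(2) this, of "\<lambda>m _. h m" 3]
  have "(\<Sum>m\<in>normal_msets (glue_faces f fst A UNIV D tripod_faces) 3. h (image_mset fst m)) =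
      (\<Sum>m\<in>normal_msets D 3. card {k \<in> tripod_cubes. image_mset fst k = image_mset f m} * h m)"
    by simp
  also have "\<dots> = (\<Sum>m\<in>normal_msets D 3. 20 * card (set_mset (image_mset f m)) * h m)"
    by (intro sum.cong refl arg_cong2[where f = "(*)"] card_row) (simp add: normal_msets_def)
  finally show ?thesis .
qed

text \<open>An element \<open>(m, c)\<close> is a labelling of the tree with four leaves: \<open>m\<close> and \<open>c\<close> label the edges at
  its interior vertices, and the interior edge carries \<open>snd m = fst c\<close>.\<close>

definition quad :: "((klein \<times> klein) \<times> (klein \<times> klein)) set" where
  "quad = glue snd fst UNIV UNIV"

definition quad_views :: "((klein \<times> klein) \<times> (klein \<times> klein) \<Rightarrow> klein) set" where
  "quad_views = glue_views tripod_views tripod_views"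

definition quad_faces :: "((klein \<times> klein) \<times> (klein \<times> klein)) set set" where
  "quad_faces = glue_faces snd fst UNIV UNIV tripod_faces tripod_faces"

lemma nf_system_quad: "nf_system quad quad_views quad_faces"
  unfolding quad_def quad_views_def quad_faces_def
  by (rule nf_system_glue[OF nf_system_tripod nf_system_tripod]) (simp_all add: tripod_views_def)

lemma card_quad_fiber:
  assumes "size y = 3"
  shows "card {m \<in> normal_msets quad_faces 3. image_mset (fst \<circ> fst) m = y} =
    20 * (48 * card (set_mset y) - 8)"
proof -
  have fin: "finite (normal_msets quad_faces 3)"
    using nf_system_quad finite_msets_of_size[of quad 3]
    by (auto simp: normal_msets_def nf_system_def elim!: finite_subset[rotated])
  have fin': "finite tripod_cubes"
    by (rule finite_subset[OF _ finite_msets_of_size[of UNIV 3]]) (auto simp: normal_msets_def)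
  have "card {m \<in> normal_msets quad_faces 3. image_mset (fst \<circ> fst) m = y} =
      (\<Sum>m\<in>normal_msets quad_faces 3. if image_mset fst (image_mset fst m) = y then 1 else 0)"
    using fin by (simp add: multiset.map_comp sum.If_cases Int_def)
  also have "\<dots> = (\<Sum>m\<in>tripod_cubes. 20 * card (set_mset (image_mset snd m)) *
      (if image_mset fst m = y then 1 else 0))"
    unfolding quad_faces_def
    by (rule card_normal_msets_glue_tripod[OF nf_system_tripod]) (simp add: tripod_views_def)
  also have "\<dots> = (\<Sum>m\<in>tripod_cubes. if image_mset fst m = y then 20 * card (set_mset (image_mset snd m)) else 0)"
    by (rule sum.cong) simp_all
  also have "\<dots> = (\<Sum>m\<in>{m \<in> tripod_cubes. image_mset fst m = y}. 20 * card (set_mset (image_mset snd m)))"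
    using fin' by (simp add: sum.If_cases Int_def)
  also have "\<dots> = 20 * (48 * card (set_mset y) - 8)"
    unfolding sum_distrib_left[symmetric] sum_row_snd[OF assms] ..
  finally show ?thesis .
qed

text \<open>Two trees with four leaves, glued along the leaf edge labelled \<open>fst m\<close>, form the caterpillar.\<close>

definition cat_set where
  "cat_set = glue (fst \<circ> fst) (fst \<circ> fst) quad quad"

definition cat_views where
  "cat_views = glue_views quad_views quad_views"

definition cat_faces where
  "cat_faces = glue_faces (fst \<circ> fst) (fst \<circ> fst) quad quad quad_faces quad_faces"

lemma fst_fst_quad_views: "fst \<circ> fst \<in> quad_views"
  by (simp add: quad_views_def glue_views_def tripod_views_def)

lemma nf_system_cat: "nf_system cat_set cat_views cat_faces"
  unfolding cat_set_def cat_views_def cat_faces_def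
  by (rule nf_system_glue[OF nf_system_quad nf_system_quad]) (rule fst_fst_quad_views)+

lemma card_cat: "card (normal_msets cat_faces 3) = 69324800"
proof -
  have fin: "finite (normal_msets quad_faces 3)"
    using nf_system_quad finite_msets_of_size[of quad 3]
    by (auto simp: normal_msets_def nf_system_def elim!: finite_subset[rotated])
  let ?Q = "\<lambda>y. {m \<in> normal_msets quad_faces 3. image_mset (fst \<circ> fst) m = y}"
  have "card (normal_msets cat_faces 3) =
      (\<Sum>m\<in>normal_msets quad_faces 3. card (?Q (image_mset (fst \<circ> fst) m)))"
    using sum_normal_msets_glue[OF nf_system_quad nf_system_quad fst_fst_quad_views
      fst_fst_quad_views, of "\<lambda>_ _. 1 :: nat" 3]
    unfolding cat_faces_def by simp
  also have "\<dots> = (\<Sum>y\<in>{y. size y = 3}. \<Sum>m\<in>?Q y. card (?Q (image_mset (fst \<circ> fst) m)))"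
    by (intro sum.group[symmetric] fin finite_klein_msets) (auto simp: normal_msets_def)
  also have "\<dots> = (\<Sum>y\<in>{y. size y = 3}. (card (?Q y))\<^sup>2)"
    by (rule sum.cong) (simp_all add: power2_eq_square)
  also have "\<dots> = (\<Sum>y\<in>{y :: klein multiset. size y = 3}. (20 * (48 * card (set_mset y) - 8))\<^sup>2)"
    by (rule sum.cong[OF refl]) (simp only: card_quad_fiber mem_Collect_eq)
  finally show ?thesis
    unfolding sum_caterpillar .
qed

text \<open>Three tripods, glued along the three edges of a central one.\<close>

definition snow_set where
  "snow_set = glue ((\<lambda>(a, b). a + b) \<circ> fst \<circ> fst) fst
     (glue (snd \<circ> fst) fst (glue fst fst UNIV UNIV) UNIV) (UNIV :: (klein \<times> klein) set)"

definition snow_views where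
  "snow_views = glue_views (glue_views (glue_views tripod_views tripod_views) tripod_views) tripod_views"

definition snow_faces where
  "snow_faces = glue_faces ((\<lambda>(a, b). a + b) \<circ> fst \<circ> fst) fst
     (glue (snd \<circ> fst) fst (glue fst fst UNIV UNIV) UNIV) UNIV
     (glue_faces (snd \<circ> fst) fst (glue fst fst UNIV UNIV) UNIV
       (glue_faces fst fst UNIV UNIV tripod_faces tripod_faces) tripod_faces) tripod_faces"

lemmas nf_system_snow1 = nf_system_glue[OF nf_system_tripod nf_system_tripod, of fst fst]
lemmas nf_system_snow2 = nf_system_glue[OF nf_system_snow1 nf_system_tripod, of "snd \<circ> fst" fst]
lemmas nf_system_snow3 =
  nf_system_glue[OF nf_system_snow2 nf_system_tripod, of "(\<lambda>(a, b). a + b) \<circ> fst \<circ> fst" fst]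

text \<open>The three edges of the central tripod, seen after zero, one and two gluings;
  \<open>fst\<close> is also the edge by which each outer tripod is attached.\<close>

lemma snow_keys:
  "fst \<in> tripod_views"
  "snd \<circ> fst \<in> glue_views tripod_views tripod_views"
  "(\<lambda>(a, b). a + b) \<circ> fst \<circ> fst \<in> glue_views (glue_views tripod_views tripod_views) tripod_views"
  by (simp_all add: glue_views_def tripod_views_def image_Un)

lemma nf_system_snow: "nf_system snow_set snow_views snow_faces"
  unfolding snow_set_def snow_views_def snow_faces_def
  by (intro nf_system_snow3 snow_keys)

lemma card_snow: "card (normal_msets snow_faces 3) = 69248000"
proof -
  have "card (normal_msets snow_faces 3) = (\<Sum>m\<in>normal_msets snow_faces 3. 1)"
    by simp
  \<comment> \<open>8000 is the cube of 20, one factor for each outer tripod.\<close>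
  also have "\<dots> = (\<Sum>m\<in>tripod_cubes. 8000 * (card (set_mset (image_mset fst m)) * card (set_mset (image_mset snd m)) *
     card (set_mset (image_mset (\<lambda>(a, b). a + b) m))))"
  proof -
    \<comment> \<open>The tripod attached last is removed first.\<close>
    note 3 = card_normal_msets_glue_tripod[OF nf_system_snow2 snow_keys(3), OF snow_keys(1,1,2,1)]
    note 2 = card_normal_msets_glue_tripod[OF nf_system_snow1 snow_keys(2), OF snow_keys(1,1)]
    note 1 = card_normal_msets_glue_tripod[OF nf_system_tripod snow_keys(1)]
    have "(\<Sum>m\<in>normal_msets snow_faces 3. 1) = (\<Sum>m\<in>normal_msets
        (glue_faces (snd \<circ> fst) fst (glue fst fst UNIV UNIV) UNIV
          (glue_faces fst fst UNIV UNIV tripod_faces tripod_faces) tripod_faces) 3.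
        20 * card (set_mset (image_mset ((\<lambda>(a, b). a + b) \<circ> fst) (image_mset fst m))))"
      using 3[of "\<lambda>_. 1"] unfolding snow_faces_def by (simp add: multiset.map_comp o_assoc)
    also have "\<dots> = (\<Sum>m\<in>normal_msets (glue_faces fst fst UNIV UNIV tripod_faces tripod_faces) 3.
        20 * card (set_mset (image_mset (snd \<circ> fst) m)) *
        (20 * card (set_mset (image_mset ((\<lambda>(a, b). a + b) \<circ> fst) m))))"
      by (rule 2)
    also have "\<dots> = (\<Sum>m\<in>normal_msets (glue_faces fst fst UNIV UNIV tripod_faces tripod_faces) 3.
        20 * card (set_mset (image_mset snd (image_mset fst m))) *
        (20 * card (set_mset (image_mset (\<lambda>(a, b). a + b) (image_mset fst m)))))"
      by (simp only: multiset.map_comp)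
    also have "\<dots> = (\<Sum>m\<in>tripod_cubes. 20 * card (set_mset (image_mset fst m)) *
        (20 * card (set_mset (image_mset snd m)) * (20 * card (set_mset (image_mset (\<lambda>(a, b). a + b) m)))))"
      by (rule 1)
    finally show ?thesis by (simp add: mult_ac)
  qed
  also have "\<dots> = 69248000"
    unfolding sum_distrib_left[symmetric] sum_snowflake by simp
  finally show ?thesis .
qed

section \<open>Kernels of monomial homomorphisms\<close>

lemma carrier_mpol_ring:
  "p \<in> carrier (mpol_ring X) \<longleftrightarrow> (\<forall>e\<in>Poly_Mapping.keys p. Poly_Mapping.keys e \<subseteq> X)"
  by (simp add: mpol_ring_def)

lemma mpol_ring_simps [simp]:
  "x \<otimes>\<^bsub>mpol_ring X\<^esub> y = x * y" "x \<oplus>\<^bsub>mpol_ring X\<^esub> y = x + y"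
  "\<one>\<^bsub>mpol_ring X\<^esub> = 1" "\<zero>\<^bsub>mpol_ring X\<^esub> = 0"
  by (simp_all add: mpol_ring_def)

lemma mpol_ring_closed:
  fixes p q :: "('x, 'k::field) mpol"
  assumes "p \<in> carrier (mpol_ring X)" "q \<in> carrier (mpol_ring X)"
  shows "p + q \<in> carrier (mpol_ring X)" "p * q \<in> carrier (mpol_ring X)"
proof -
  show "p + q \<in> carrier (mpol_ring X)"
    unfolding carrier_mpol_ring
  proof
    fix e assume "e \<in> Poly_Mapping.keys (p + q)"
    then have "e \<in> Poly_Mapping.keys p \<or> e \<in> Poly_Mapping.keys q"
      using Poly_Mapping.keys_add[of p q] by blast
    then show "Poly_Mapping.keys e \<subseteq> X"
      using assms unfolding carrier_mpol_ring by blast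
  qed
  show "p * q \<in> carrier (mpol_ring X)"
    unfolding carrier_mpol_ring
  proof
    fix e assume "e \<in> Poly_Mapping.keys (p * q)"
    then obtain a b where "e = a + b" "a \<in> Poly_Mapping.keys p" "b \<in> Poly_Mapping.keys q"
      using keys_mult[of p q] by blast
    then show "Poly_Mapping.keys e \<subseteq> X"
      using assms Poly_Mapping.keys_add[of a b] unfolding carrier_mpol_ring by blast
  qed
qed

lemma mpol_ring_uminus_closed:
  "p \<in> carrier (mpol_ring X) \<Longrightarrow> - p \<in> carrier (mpol_ring X :: ('x, 'k::field) mpol ring)"
  by (simp add: carrier_mpol_ring in_keys_iff)

lemma mpol_ring_one_zero:
  "(1 :: ('x, 'k::field) mpol) \<in> carrier (mpol_ring X)" "(0 :: ('x, 'k::field) mpol) \<in> carrier (mpol_ring X)"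
  by (simp_all add: carrier_mpol_ring)

lemma cring_mpol_ring: "cring (mpol_ring X :: ('x, 'k::field) mpol ring)"
proof (rule cringI)
  show "abelian_group (mpol_ring X :: ('x, 'k) mpol ring)"
  proof (rule abelian_groupI)
    fix p :: "('x, 'k) mpol" assume "p \<in> carrier (mpol_ring X)"
    then show "\<exists>q\<in>carrier (mpol_ring X). q \<oplus>\<^bsub>mpol_ring X\<^esub> p = \<zero>\<^bsub>mpol_ring X\<^esub>"
      by (intro bexI[of _ "- p"]) (simp_all add: mpol_ring_uminus_closed)
  qed (simp_all add: mpol_ring_closed mpol_ring_one_zero add_ac)
  show "comm_monoid (mpol_ring X :: ('x, 'k) mpol ring)"
    by (rule comm_monoidI) (simp_all add: mpol_ring_closed mpol_ring_one_zero mult_ac)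
qed (simp add: distrib_right)

lemma a_minus_mpol_ring:
  fixes p q :: "('x, 'k::field) mpol"
  assumes "p \<in> carrier (mpol_ring X)" "q \<in> carrier (mpol_ring X)"
  shows "p \<ominus>\<^bsub>mpol_ring X\<^esub> q = p - q"
proof -
  interpret cring "mpol_ring X :: ('x, 'k) mpol ring" by (rule cring_mpol_ring)
  have "\<ominus>\<^bsub>mpol_ring X\<^esub> q = - q"
    using assms(2) by (intro minus_equality) (simp_all add: mpol_ring_uminus_closed)
  then show ?thesis by (simp add: a_minus_def)
qed

text \<open>The exponent of the image of the monomial with exponent \<open>e\<close> when \<open>x\<close> is sent to the monomial
  with exponent \<open>g x\<close>.\<close>

definition exponent_map :: "('x \<Rightarrow> ('y \<Rightarrow>\<^sub>0 nat)) \<Rightarrow> ('x \<Rightarrow>\<^sub>0 nat) \<Rightarrow> ('y \<Rightarrow>\<^sub>0 nat)" where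
  "exponent_map g e = (\<Sum>x\<in>Poly_Mapping.keys e. \<Sum>i<Poly_Mapping.lookup e x. g x)"

lemma exponent_map_superset:
  assumes "finite A" "Poly_Mapping.keys e \<subseteq> A"
  shows "exponent_map g e = (\<Sum>x\<in>A. \<Sum>i<Poly_Mapping.lookup e x. g x)"
  unfolding exponent_map_def using assms
  by (intro sum.mono_neutral_left) (auto simp: in_keys_iff)

lemma exponent_map_add:
  fixes g :: "'x \<Rightarrow> ('y \<Rightarrow>\<^sub>0 nat)"
  shows "exponent_map g (d + e) = exponent_map g d + exponent_map g e"
proof -
  let ?A = "Poly_Mapping.keys d \<union> Poly_Mapping.keys e"
  have fin: "finite ?A" by simp
  have "(\<Sum>i<m + n. c) = (\<Sum>i<m. c) + (\<Sum>i<n. c)" for m n :: nat and c :: "'y \<Rightarrow>\<^sub>0 nat"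
    by (induction n) (simp_all add: add_ac)
  then show ?thesis
    unfolding exponent_map_superset[OF fin Un_upper1] exponent_map_superset[OF fin Un_upper2]
      exponent_map_superset[OF fin Poly_Mapping.keys_add] lookup_add
    by (simp only: sum.distrib)
qed

lemma single_power: "Poly_Mapping.single (a :: 'y \<Rightarrow>\<^sub>0 nat) (1 :: 'k::field) ^ n = Poly_Mapping.single (\<Sum>i<n. a) 1"
  by (induction n) (simp_all add: mult_single add_ac)

lemma prod_single:
  "(\<Prod>x\<in>A. Poly_Mapping.single (f x :: 'y \<Rightarrow>\<^sub>0 nat) (1 :: 'k::field)) = Poly_Mapping.single (\<Sum>x\<in>A. f x) 1"
  by (induction A rule: infinite_finite_induct) (simp_all add: mult_single)

abbreviation monomial_hom :: "('x \<Rightarrow> ('y \<Rightarrow>\<^sub>0 nat)) \<Rightarrow> ('x, 'k::field) mpol \<Rightarrow> ('y, 'k) mpol" where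
  "monomial_hom g \<equiv> mpol_subst (\<lambda>x. Poly_Mapping.single (g x) 1)"

text \<open>A larger index set allows two polynomials to be summed over the same exponents, which
  gives additivity despite cancelling terms.\<close>

lemma monomial_hom_superset:
  fixes p :: "('x, 'k::field) mpol"
  assumes "finite A" "Poly_Mapping.keys p \<subseteq> A"
  shows "monomial_hom g p = (\<Sum>e\<in>A. Poly_Mapping.single (exponent_map g e) (Poly_Mapping.lookup p e))"
proof -
  have "monomial_hom g p =
      (\<Sum>e\<in>Poly_Mapping.keys p. Poly_Mapping.single (exponent_map g e) (Poly_Mapping.lookup p e))"
    unfolding mpol_subst_def mconst_def
    by (simp add: single_power prod_single mult_single exponent_map_def)
  also have "\<dots> = (\<Sum>e\<in>A. Poly_Mapping.single (exponent_map g e) (Poly_Mapping.lookup p e))"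
    using assms by (intro sum.mono_neutral_left) (auto simp: in_keys_iff)
  finally show ?thesis .
qed

lemma monomial_hom_single:
  "monomial_hom g (Poly_Mapping.single e (c :: 'k::field)) = Poly_Mapping.single (exponent_map g e) c"
  by (subst monomial_hom_superset[of "{e}"]) auto

lemma monomial_hom_add:
  fixes p q :: "('x, 'k::field) mpol"
  shows "monomial_hom g (p + q) = monomial_hom g p + monomial_hom g q"
proof -
  let ?A = "Poly_Mapping.keys p \<union> Poly_Mapping.keys q"
  show ?thesis
    using Poly_Mapping.keys_add[of p q]
    by (simp add: monomial_hom_superset[of ?A] lookup_add single_add sum.distrib)
qed

lemma monomial_hom_0 [simp]: "monomial_hom g (0 :: ('x, 'k::field) mpol) = 0"
  by (simp add: mpol_subst_def)

lemma monomial_hom_diff: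
  fixes p q :: "('x, 'k::field) mpol"
  shows "monomial_hom g (p - q) = monomial_hom g p - monomial_hom g q"
  using monomial_hom_add[of g "p - q" q] by (simp add: algebra_simps)

lemma monomial_hom_sum:
  fixes p :: "'i \<Rightarrow> ('x, 'k::field) mpol"
  shows "monomial_hom g (\<Sum>i\<in>A. p i) = (\<Sum>i\<in>A. monomial_hom g (p i))"
  by (induction A rule: infinite_finite_induct) (simp_all add: monomial_hom_add)

lemma mpol_sum_monomials:
  fixes p :: "('x, 'k::field) mpol"
  assumes "finite A" "Poly_Mapping.keys p \<subseteq> A"
  shows "p = (\<Sum>e\<in>A. Poly_Mapping.single e (Poly_Mapping.lookup p e))"
proof (rule poly_mapping_eqI)
  fix k
  have "Poly_Mapping.lookup (\<Sum>e\<in>A. Poly_Mapping.single e (Poly_Mapping.lookup p e)) k =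
      (\<Sum>e\<in>A. if e = k then Poly_Mapping.lookup p e else 0)"
    unfolding lookup_sum by (intro sum.cong) (auto simp: lookup_single when_def)
  also have "\<dots> = Poly_Mapping.lookup p k"
    using assms by (auto simp: in_keys_iff)
  finally show "Poly_Mapping.lookup p k = Poly_Mapping.lookup (\<Sum>e\<in>A. Poly_Mapping.single e (Poly_Mapping.lookup p e)) k"
    by simp
qed

lemma monomial_hom_mult:
  fixes p q :: "('x, 'k::field) mpol"
  shows "monomial_hom g (p * q) = monomial_hom g p * monomial_hom g q"
proof -
  have "p * q = (\<Sum>d\<in>Poly_Mapping.keys p. Poly_Mapping.single d (Poly_Mapping.lookup p d)) *
      (\<Sum>e\<in>Poly_Mapping.keys q. Poly_Mapping.single e (Poly_Mapping.lookup q e))"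
    by (rule arg_cong2[where f = "(*)", OF mpol_sum_monomials mpol_sum_monomials]) simp_all
  then have "p * q = (\<Sum>d\<in>Poly_Mapping.keys p. \<Sum>e\<in>Poly_Mapping.keys q.
      Poly_Mapping.single (d + e) (Poly_Mapping.lookup p d * Poly_Mapping.lookup q e))"
    unfolding sum_product mult_single .
  then show ?thesis
    unfolding monomial_hom_superset[OF finite_keys subset_refl, of _ p]
      monomial_hom_superset[OF finite_keys subset_refl, of _ q]
    by (simp only: monomial_hom_sum monomial_hom_single exponent_map_add sum_product mult_single)
qed

section \<open>Toric ideals and the dimension of their graded quotients\<close>

definition monomial_kernel :: "'x set \<Rightarrow> ('x \<Rightarrow> ('y \<Rightarrow>\<^sub>0 nat)) \<Rightarrow> ('x, 'k::field) mpol set" where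
  "monomial_kernel X g = {p \<in> carrier (mpol_ring X). monomial_hom g p = 0}"

lemma ideal_monomial_kernel:
  "ideal (monomial_kernel X g) (mpol_ring X :: ('x, 'k::field) mpol ring)"
proof -
  interpret cring "mpol_ring X :: ('x, 'k) mpol ring" by (rule cring_mpol_ring)
  have neg: "\<ominus>\<^bsub>mpol_ring X\<^esub> p = - p" if "p \<in> carrier (mpol_ring X)" for p :: "('x, 'k) mpol"
    using that by (intro minus_equality) (simp_all add: mpol_ring_uminus_closed)
  show ?thesis
  proof (rule idealI[OF ring_axioms])
    show "subgroup (monomial_kernel X g) (add_monoid (mpol_ring X :: ('x, 'k) mpol ring))"
    proof (rule add.subgroupI)
      fix p :: "('x, 'k) mpol" assume p: "p \<in> monomial_kernel X g"
      then have "\<ominus>\<^bsub>mpol_ring X\<^esub> p = 0 - p"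
        using neg by (simp add: monomial_kernel_def)
      moreover have "0 - p \<in> monomial_kernel X g"
        using p monomial_hom_diff[of g 0 p] mpol_ring_uminus_closed by (auto simp: monomial_kernel_def)
      ultimately show "\<ominus>\<^bsub>mpol_ring X\<^esub> p \<in> monomial_kernel X g" by simp
    qed (auto simp: monomial_kernel_def monomial_hom_add mpol_ring_closed intro!: exI[of _ 0] mpol_ring_one_zero)
  qed (auto simp: monomial_kernel_def monomial_hom_mult mpol_ring_closed)
qed

lemma monomial_kernel_coset_eq:
  fixes p q :: "('x, 'k::field) mpol"
  assumes "p \<in> carrier (mpol_ring X)" "q \<in> carrier (mpol_ring X)"
  shows "monomial_kernel X g +>\<^bsub>mpol_ring X\<^esub> p = monomial_kernel X g +>\<^bsub>mpol_ring X\<^esub> q \<longleftrightarrow>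
    monomial_hom g p = monomial_hom g q"
proof -
  interpret cring "mpol_ring X :: ('x, 'k) mpol ring" by (rule cring_mpol_ring)
  have "p - q \<in> carrier (mpol_ring X)"
    using mpol_ring_closed(1)[OF assms(1) mpol_ring_uminus_closed[OF assms(2)]] by simp
  then show ?thesis
    using quotient_eq_iff_same_a_r_cos[OF ideal_monomial_kernel assms, of g]
    by (simp add: a_minus_mpol_ring[OF assms] monomial_kernel_def monomial_hom_diff)
qed

text \<open>The constants form a subfield of the polynomial ring, and its image is again one because
  1 is not in the kernel. Uniqueness of the dimension rests on this.\<close>

lemma subfield_constants:
  "subfield (range (\<lambda>c. monomial_kernel X g +>\<^bsub>mpol_ring X\<^esub> mconst c))
    (mpol_ring X Quot (monomial_kernel X g) :: ('x, 'k::field) mpol set ring)"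
proof -
  let ?R = "mpol_ring X :: ('x, 'k) mpol ring"
  let ?I = "monomial_kernel X g :: ('x, 'k) mpol set"
  interpret R: cring ?R by (rule cring_mpol_ring)
  interpret ideal ?I ?R by (rule ideal_monomial_kernel)
  interpret h: ring_hom_ring ?R "?R Quot ?I" "(+>\<^bsub>?R\<^esub>) ?I" by (rule rcos_ring_hom_ring)
  let ?C = "range (mconst :: 'k \<Rightarrow> ('x, 'k) mpol)"
  have const: "(mconst c :: ('x, 'k) mpol) \<in> carrier ?R" for c
    by (simp add: carrier_mpol_ring mconst_def)
  have "subfield (?C) ?R"
  proof (rule R.subfield_iff(1))
    show "?C \<subseteq> carrier ?R"
      using const by blast
    show "field (?R\<lparr>carrier := ?C\<rparr>)"
    proof (rule cring.cring_fieldI2)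
      show "cring (?R\<lparr>carrier := ?C\<rparr>)"
      proof (rule R.subcring_iff[THEN iffD1, rotated])
        show "?C \<subseteq> carrier ?R"
          using const by blast
        show "subcring (?C) ?R"
        proof (rule R.subcringI')
          show "subring (?C) ?R"
          proof (rule R.subringI)
            fix a b assume ab: "a \<in> ?C" "b \<in> ?C"
            then obtain c d where cd: "a = mconst c" "b = mconst d" by blast
            have "\<ominus>\<^bsub>?R\<^esub> a = mconst (- c)"
              using ab cd const by (intro R.minus_equality) (simp_all add: mconst_def flip: single_add)
            then show "\<ominus>\<^bsub>?R\<^esub> a \<in> ?C" by simp
            show "a \<oplus>\<^bsub>?R\<^esub> b \<in> ?C"
              using cd by (simp add: mconst_def flip: single_add)
            show "a \<otimes>\<^bsub>?R\<^esub> b \<in> ?C"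
              using cd by (simp add: mconst_def mult_single)
          next
            show "\<one>\<^bsub>?R\<^esub> \<in> ?C"
              by (auto simp: mconst_def intro!: image_eqI[of _ _ 1])
          qed (use const in blast)
        qed
      qed
    next
      fix a assume "a \<in> carrier (?R\<lparr>carrier := ?C\<rparr>)" "a \<noteq> \<zero>\<^bsub>?R\<lparr>carrier := ?C\<rparr>\<^esub>"
      then obtain c where "a = mconst c" "mconst c \<noteq> (0 :: ('x, 'k) mpol)"
        by auto
      then have c: "a = mconst c" "c \<noteq> 0"
        by (auto simp: mconst_def)
      then show "\<exists>b\<in>carrier (?R\<lparr>carrier := ?C\<rparr>).
          a \<otimes>\<^bsub>?R\<lparr>carrier := ?C\<rparr>\<^esub> b = \<one>\<^bsub>?R\<lparr>carrier := ?C\<rparr>\<^esub>"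
        by (auto simp: mconst_def mult_single intro!: exI[of _ "inverse c"])
    qed simp
  qed
  moreover have "\<one>\<^bsub>?R Quot ?I\<^esub> \<noteq> \<zero>\<^bsub>?R Quot ?I\<^esub>"
  proof -
    have "monomial_hom g (1 :: ('x, 'k) mpol) \<noteq> monomial_hom g 0"
      using monomial_hom_single[of g 0 "1 :: 'k"] by (simp add: exponent_map_def)
    then show ?thesis
      using monomial_kernel_coset_eq[OF mpol_ring_one_zero, where g = g and X = X] h.hom_one h.hom_zero by force
  qed
  ultimately have "subfield ((+>\<^bsub>?R\<^esub>) ?I ` ?C) (?R Quot ?I)"
    by (rule h.img_is_subfield(2))
  then show ?thesis
    by (simp add: image_image)
qed

text \<open>Monomials with distinct image exponents are linearly independent modulo the kernel.
  Adding one of them to \<open>N\<close> is a line extension, so the dimension grows by one.\<close>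

lemma dimension_monomial_span:
  fixes N :: "('x \<Rightarrow>\<^sub>0 nat) set"
  assumes "finite N" "\<And>e. e \<in> N \<Longrightarrow> Poly_Mapping.keys e \<subseteq> X" "inj_on (exponent_map g) N"
  shows "ring.dimension (mpol_ring X Quot (monomial_kernel X g)) (card N)
    (range (\<lambda>c. monomial_kernel X g +>\<^bsub>mpol_ring X\<^esub> (mconst c :: ('x, 'k::field) mpol)))
    ((\<lambda>p. monomial_kernel X g +>\<^bsub>mpol_ring X\<^esub> p) ` {p. Poly_Mapping.keys p \<subseteq> N})"
  using assms
proof (induction N rule: finite_induct)
  let ?R = "mpol_ring X :: ('x, 'k) mpol ring"
  let ?I = "monomial_kernel X g :: ('x, 'k) mpol set"
  interpret R: cring ?R by (rule cring_mpol_ring)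
  interpret ideal ?I ?R by (rule ideal_monomial_kernel)
  interpret h: ring_hom_ring ?R "?R Quot ?I" "(+>\<^bsub>?R\<^esub>) ?I" by (rule rcos_ring_hom_ring)
  let ?K = "range (\<lambda>c. ?I +>\<^bsub>?R\<^esub> mconst c)"
  let ?E = "\<lambda>N. (\<lambda>p. ?I +>\<^bsub>?R\<^esub> p) ` {p. Poly_Mapping.keys p \<subseteq> N}"
  {
    case empty
    have "?E {} = {\<zero>\<^bsub>?R Quot ?I\<^esub>}"
      using h.hom_zero by simp
    then show ?case
      using h.S.dimension.zero_dim by simp
  next
    case (insert e N)
    let ?v = "Poly_Mapping.single e 1 :: ('x, 'k) mpol"
    have carr: "p \<in> carrier ?R" if "Poly_Mapping.keys p \<subseteq> insert e N" for p
      using that insert.prems(1) unfolding carrier_mpol_ring by blast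
    have const: "mconst c \<in> carrier ?R" for c
      by (simp add: carrier_mpol_ring mconst_def)
    have v: "?v \<in> carrier ?R"
      by (rule carr) simp
    have "?I +>\<^bsub>?R\<^esub> ?v \<notin> ?E N"
    proof
      assume "?I +>\<^bsub>?R\<^esub> ?v \<in> ?E N"
      then obtain p where p: "?I +>\<^bsub>?R\<^esub> ?v = ?I +>\<^bsub>?R\<^esub> p" "Poly_Mapping.keys p \<subseteq> N"
        by blast
      then have "monomial_hom g ?v = monomial_hom g p"
        using monomial_kernel_coset_eq[OF v carr] by blast
      \<comment> \<open>The coefficient at the image exponent of \<open>e\<close> is 1 on one side,
        while no exponent in \<open>N\<close> can contribute to it on the other.\<close>
      then have "Poly_Mapping.lookup (monomial_hom g p) (exponent_map g e) = 1"
        by (metis monomial_hom_single lookup_single_eq)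
      moreover have "exponent_map g e' \<noteq> exponent_map g e" if "e' \<in> N" for e'
        using insert.prems(2) insert.hyps(2) that by (auto simp: inj_on_def)
      then have "Poly_Mapping.lookup (monomial_hom g p) (exponent_map g e) = 0"
        using p(2) unfolding monomial_hom_superset[OF insert.hyps(1) p(2)] lookup_sum
        by (intro sum.neutral) (simp add: lookup_single_not_eq)
      ultimately show False by simp
    qed
    moreover have "?I +>\<^bsub>?R\<^esub> ?v \<in> carrier (?R Quot ?I)"
      using v by (rule h.hom_closed)
    moreover have "h.S.dimension (card N) ?K (?E N)"
      using insert.prems by (intro insert.IH) (auto simp: inj_on_def)
    ultimately have "h.S.dimension (Suc (card N)) ?K (h.S.line_extension ?K (?I +>\<^bsub>?R\<^esub> ?v) (?E N))"
      by (intro h.S.dimension.Suc_dim)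
    moreover have "h.S.line_extension ?K (?I +>\<^bsub>?R\<^esub> ?v) (?E N) = ?E (insert e N)"
    proof -
      have comb: "(?I +>\<^bsub>?R\<^esub> mconst c) \<otimes>\<^bsub>?R Quot ?I\<^esub> (?I +>\<^bsub>?R\<^esub> ?v) \<oplus>\<^bsub>?R Quot ?I\<^esub> (?I +>\<^bsub>?R\<^esub> p) =
          ?I +>\<^bsub>?R\<^esub> (Poly_Mapping.single e c + p)" if "Poly_Mapping.keys p \<subseteq> N" for c p
      proof -
        have "Poly_Mapping.single e c + p = mconst c * ?v + p"
          by (simp add: mconst_def mult_single)
        moreover have "p \<in> carrier ?R"
          using that by (intro carr) blast
        ultimately show ?thesis
          using h.hom_add[of "mconst c * ?v" p] h.hom_mult[OF const v, of c] mpol_ring_closed(2)[OF const v, of c]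
          by simp
      qed
      show ?thesis
      proof
        show "h.S.line_extension ?K (?I +>\<^bsub>?R\<^esub> ?v) (?E N) \<subseteq> ?E (insert e N)"
        proof
          fix u assume "u \<in> h.S.line_extension ?K (?I +>\<^bsub>?R\<^esub> ?v) (?E N)"
          then obtain c p where "Poly_Mapping.keys p \<subseteq> N" "u = ?I +>\<^bsub>?R\<^esub> (Poly_Mapping.single e c + p)"
            using comb by (auto simp: h.S.line_extension_mem_iff)
          moreover have "Poly_Mapping.keys (Poly_Mapping.single e c + p) \<subseteq> insert e N"
            using Poly_Mapping.keys_add[of "Poly_Mapping.single e c" p] calculation(1)
            by (auto split: if_splits)
          ultimately show "u \<in> ?E (insert e N)" by blast
        qed
        show "?E (insert e N) \<subseteq> h.S.line_extension ?K (?I +>\<^bsub>?R\<^esub> ?v) (?E N)"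
        proof
          fix u assume "u \<in> ?E (insert e N)"
          then obtain p where p: "Poly_Mapping.keys p \<subseteq> insert e N" "u = ?I +>\<^bsub>?R\<^esub> p"
            by blast
          \<comment> \<open>Removing the term at \<open>e\<close> leaves a polynomial supported on
            \<open>N\<close>; the removed coefficient is the scalar of the line extension.\<close>
          let ?p = "p - Poly_Mapping.single e (Poly_Mapping.lookup p e)"
          have "Poly_Mapping.keys ?p \<subseteq> N"
            using p(1) by (auto simp: in_keys_iff lookup_minus lookup_single when_def split: if_splits)
          then show "u \<in> h.S.line_extension ?K (?I +>\<^bsub>?R\<^esub> ?v) (?E N)"
            unfolding h.S.line_extension_mem_iff
            using comb[of ?p "Poly_Mapping.lookup p e"] p(2) by force
        qed
      qed
    qed
    ultimately show ?case
      using insert.hyps by simp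
  }
qed

text \<open>\<open>N\<close> is a transversal of the monomials of degree \<open>d\<close> modulo
  equality of images, hence a basis of the graded piece.\<close>

lemma hilbert_function_monomial_kernel:
  fixes N :: "('x \<Rightarrow>\<^sub>0 nat) set"
  assumes "finite N" "inj_on (exponent_map g) N"
    and N: "\<And>e. e \<in> N \<Longrightarrow> Poly_Mapping.keys e \<subseteq> X"
      "\<And>e. e \<in> N \<Longrightarrow> (\<Sum>x\<in>Poly_Mapping.keys e. Poly_Mapping.lookup e x) = d"
    and repr: "\<And>e. Poly_Mapping.keys e \<subseteq> X \<Longrightarrow>
      (\<Sum>x\<in>Poly_Mapping.keys e. Poly_Mapping.lookup e x) = d \<Longrightarrow>
      \<exists>e'\<in>N. exponent_map g e' = exponent_map g e"
  shows "hilbert_function X (monomial_kernel X g :: ('x, 'k::field) mpol set) d = card N"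
proof -
  let ?R = "mpol_ring X :: ('x, 'k) mpol ring"
  let ?I = "monomial_kernel X g :: ('x, 'k) mpol set"
  let ?K = "range (\<lambda>c. ?I +>\<^bsub>?R\<^esub> mconst c)"
  let ?E = "(\<lambda>p. ?I +>\<^bsub>?R\<^esub> p) ` {p \<in> carrier ?R. mhomogeneous d p}"
  interpret R: cring ?R by (rule cring_mpol_ring)
  interpret ideal ?I ?R by (rule ideal_monomial_kernel)
  interpret Q: ring "?R Quot ?I" by (rule quotient_is_ring)
  have "(\<lambda>p. ?I +>\<^bsub>?R\<^esub> p) ` {p. Poly_Mapping.keys p \<subseteq> N} = ?E"
  proof
    have "{p. Poly_Mapping.keys p \<subseteq> N} \<subseteq> {p \<in> carrier ?R. mhomogeneous d p}"
      using N by (auto simp: carrier_mpol_ring mhomogeneous_def subset_iff)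
    then show "(\<lambda>p. ?I +>\<^bsub>?R\<^esub> p) ` {p. Poly_Mapping.keys p \<subseteq> N} \<subseteq> ?E"
      by (rule image_mono)
    show "?E \<subseteq> (\<lambda>p. ?I +>\<^bsub>?R\<^esub> p) ` {p. Poly_Mapping.keys p \<subseteq> N}"
    proof
      fix u assume "u \<in> ?E"
      then obtain p where p: "p \<in> carrier ?R" "mhomogeneous d p" "u = ?I +>\<^bsub>?R\<^esub> p"
        by blast
      have "\<forall>e\<in>Poly_Mapping.keys p. \<exists>e'\<in>N. exponent_map g e' = exponent_map g e"
        using p(1,2) repr unfolding carrier_mpol_ring mhomogeneous_def by blast
      then obtain r where r: "\<And>e. e \<in> Poly_Mapping.keys p \<Longrightarrow> r e \<in> N \<and> exponent_map g (r e) = exponent_map g e"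
        by metis
      \<comment> \<open>Each monomial of \<open>p\<close> is replaced by its representative; the
        image, and hence the coset, stays the same. Representatives may coincide, in which case
        coefficients add up.\<close>
      let ?q = "\<Sum>e\<in>Poly_Mapping.keys p. Poly_Mapping.single (r e) (Poly_Mapping.lookup p e)"
      have "Poly_Mapping.keys ?q \<subseteq> (\<Union>e\<in>Poly_Mapping.keys p. {r e})"
        by (rule order_trans[OF Poly_Mapping.keys_sum]) (auto split: if_splits)
      then have q: "Poly_Mapping.keys ?q \<subseteq> N"
        using r by blast
      then have "?q \<in> carrier ?R"
        using N(1) by (auto simp: carrier_mpol_ring)
      moreover have "monomial_hom g p = monomial_hom g ?q"
        unfolding monomial_hom_sum monomial_hom_single monomial_hom_superset[OF finite_keys subset_refl, of _ p]
        using r by (intro sum.cong) auto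
      ultimately have "u = ?I +>\<^bsub>?R\<^esub> ?q"
        using monomial_kernel_coset_eq[OF p(1)] p(3) by blast
      then show "u \<in> (\<lambda>p. ?I +>\<^bsub>?R\<^esub> p) ` {p. Poly_Mapping.keys p \<subseteq> N}"
        using q by blast
    qed
  qed
  then have dim: "Q.dimension (card N) ?K ?E"
    using dimension_monomial_span[OF assms(1) N(1) assms(2), where ?'k = 'k] by simp
  have "(THE k. Q.dimension k ?K ?E) = card N"
  proof (rule the_equality)
    show "Q.dimension (card N) ?K ?E" by (rule dim)
    show "k = card N" if "Q.dimension k ?K ?E" for k
      by (rule Q.dimension_is_inj[OF subfield_constants that dim])
  qed
  then show ?thesis
    unfolding hilbert_function_def Let_def .
qed

section \<open>Monomials as multisets of variables\<close>

definition mset_exponent :: "'x multiset \<Rightarrow> 'x \<Rightarrow>\<^sub>0 nat" where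
  "mset_exponent m = (\<Sum>x\<in>#m. Poly_Mapping.single x 1)"

lemma lookup_mset_exponent: "Poly_Mapping.lookup (mset_exponent m) x = count m x"
  by (induction m) (auto simp: mset_exponent_def lookup_add lookup_single when_def)

lemma keys_mset_exponent: "Poly_Mapping.keys (mset_exponent m) = set_mset m"
  by (auto simp: in_keys_iff lookup_mset_exponent)

lemma degree_mset_exponent:
  "(\<Sum>x\<in>Poly_Mapping.keys (mset_exponent m). Poly_Mapping.lookup (mset_exponent m) x) = size m"
  by (simp add: keys_mset_exponent lookup_mset_exponent size_multiset_overloaded_eq)

lemma inj_mset_exponent: "inj mset_exponent"
  by (rule injI) (metis lookup_mset_exponent multiset_eqI)

lemma surj_mset_exponent: "\<exists>m. mset_exponent m = e"
proof
  show "mset_exponent (\<Sum>x\<in>Poly_Mapping.keys e. replicate_mset (Poly_Mapping.lookup e x) x) = e"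
  proof (rule poly_mapping_eqI)
    fix y
    have "Poly_Mapping.lookup (mset_exponent (\<Sum>x\<in>Poly_Mapping.keys e. replicate_mset (Poly_Mapping.lookup e x) x)) y =
        (\<Sum>x\<in>Poly_Mapping.keys e. if y = x then Poly_Mapping.lookup e x else 0)"
      unfolding lookup_mset_exponent count_sum by (intro sum.cong) auto
    also have "\<dots> = Poly_Mapping.lookup e y"
      by (simp add: in_keys_iff)
    finally show "Poly_Mapping.lookup (mset_exponent (\<Sum>x\<in>Poly_Mapping.keys e. replicate_mset (Poly_Mapping.lookup e x) x)) y =
        Poly_Mapping.lookup e y" .
  qed
qed

lemma exponent_map_mset_exponent: "exponent_map g (mset_exponent m) = (\<Sum>x\<in>#m. g x)"
proof (induction m)
  case empty
  then show ?case by (simp add: mset_exponent_def exponent_map_def)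
next
  case (add x m)
  have "mset_exponent (add_mset x m) = Poly_Mapping.single x 1 + mset_exponent m"
    by (simp add: mset_exponent_def)
  moreover have "exponent_map g (Poly_Mapping.single x 1) = g x"
    by (simp add: exponent_map_def)
  ultimately show ?case
    using add by (simp add: exponent_map_add)
qed

lemma hilbert_function_transversal:
  assumes "finite M" "\<And>m. m \<in> M \<Longrightarrow> set_mset m \<subseteq> X \<and> size m = d"
    and "\<And>m m'. m \<in> M \<Longrightarrow> m' \<in> M \<Longrightarrow> (\<Sum>x\<in>#m. g x) = (\<Sum>x\<in>#m'. g x) \<Longrightarrow> m = m'"
    and "\<And>m. set_mset m \<subseteq> X \<Longrightarrow> size m = d \<Longrightarrow> \<exists>m'\<in>M. (\<Sum>x\<in>#m'. g x) = (\<Sum>x\<in>#m. g x)"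
  shows "hilbert_function X (monomial_kernel X g :: ('x, 'k::field) mpol set) d = card M"
proof -
  have "hilbert_function X (monomial_kernel X g :: ('x, 'k::field) mpol set) d = card (mset_exponent ` M)"
  proof (rule hilbert_function_monomial_kernel)
    show "inj_on (exponent_map g) (mset_exponent ` M)"
      using assms(3) by (auto simp: inj_on_def exponent_map_mset_exponent)
  next
    fix e assume e: "Poly_Mapping.keys e \<subseteq> X" "(\<Sum>x\<in>Poly_Mapping.keys e. Poly_Mapping.lookup e x) = d"
    obtain m where m: "e = mset_exponent m"
      using surj_mset_exponent by metis
    have "set_mset m \<subseteq> X" "size m = d"
      using e unfolding m keys_mset_exponent degree_mset_exponent[unfolded keys_mset_exponent] by blast+
    then obtain m' where "m' \<in> M" "(\<Sum>x\<in>#m'. g x) = (\<Sum>x\<in>#m. g x)"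
      using assms(4) by blast
    then show "\<exists>e'\<in>mset_exponent ` M. exponent_map g e' = exponent_map g e"
      by (auto simp: m exponent_map_mset_exponent)
  next
    fix e assume "e \<in> mset_exponent ` M"
    then obtain m where m: "m \<in> M" "e = mset_exponent m" by blast
    show "Poly_Mapping.keys e \<subseteq> X" "(\<Sum>x\<in>Poly_Mapping.keys e. Poly_Mapping.lookup e x) = d"
      using assms(2)[OF m(1)] degree_mset_exponent[of m] unfolding m(2) by (simp_all add: keys_mset_exponent)
  qed (use assms(1) in simp)
  also have "\<dots> = card M"
    by (rule card_image) (rule inj_on_subset[OF inj_mset_exponent], simp)
  finally show ?thesis .
qed

section \<open>The Hilbert polynomial of the Kimura model\<close>

definition kimura_exponent :: "'v ltree \<Rightarrow> klein list \<Rightarrow> (('v \<times> 'v) \<times> klein) \<Rightarrow>\<^sub>0 nat" where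
  "kimura_exponent T gs = (\<Sum>e\<in>dedges T. Poly_Mapping.single (e, edge_sum T gs e) 1)"

lemma kimura_ideal_eq:
  "kimura_ideal T = (monomial_kernel (q_vars (nlab T)) (kimura_exponent T) :: (klein list, 'k::field) mpol set)"
  by (simp add: kimura_ideal_def a_kernel_def' monomial_kernel_def kimura_hom_def mvar_def prod_single
      kimura_exponent_def)

lemma lookup_kimura_exponent:
  assumes "finite (dedges T)"
  shows "Poly_Mapping.lookup (\<Sum>gs\<in>#m. kimura_exponent T gs) (e, h) =
    (if e \<in> dedges T then count (image_mset (\<lambda>gs. edge_sum T gs e) m) h else 0)"
proof (induction m)
  case (add gs m)
  have "Poly_Mapping.lookup (kimura_exponent T gs) (e, h) =
      (\<Sum>e'\<in>dedges T. if e' = e then (if edge_sum T gs e = h then 1 else 0) else 0)"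
    unfolding kimura_exponent_def lookup_sum by (intro sum.cong) (auto simp: lookup_single when_def)
  also have "\<dots> = (if e \<in> dedges T \<and> edge_sum T gs e = h then 1 else 0)"
    using assms by simp
  finally show ?case
    using add by (simp add: lookup_add)
qed simp

text \<open>The exponent of the variable \<open>(e, h)\<close> in the image counts the members whose
  edge sum at \<open>e\<close> is \<open>h\<close>; so equality of image monomials is equality of
  views.\<close>

lemma kimura_exponent_eq_iff:
  assumes "finite (dedges T)"
  shows "(\<Sum>gs\<in>#m. kimura_exponent T gs) = (\<Sum>gs\<in>#m'. kimura_exponent T gs) \<longleftrightarrow>
    same_views ((\<lambda>e gs. edge_sum T gs e) ` dedges T) m m'"
proof -
  have "(\<Sum>gs\<in>#m. kimura_exponent T gs) = (\<Sum>gs\<in>#m'. kimura_exponent T gs) \<longleftrightarrow>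
      (\<forall>e h. Poly_Mapping.lookup (\<Sum>gs\<in>#m. kimura_exponent T gs) (e, h) =
        Poly_Mapping.lookup (\<Sum>gs\<in>#m'. kimura_exponent T gs) (e, h))"
    by (auto intro: poly_mapping_eqI)
  also have "\<dots> \<longleftrightarrow> (\<forall>e\<in>dedges T. \<forall>h. count (image_mset (\<lambda>gs. edge_sum T gs e) m) h =
      count (image_mset (\<lambda>gs. edge_sum T gs e) m') h)"
    unfolding lookup_kimura_exponent[OF assms] by auto
  also have "\<dots> \<longleftrightarrow> same_views ((\<lambda>e gs. edge_sum T gs e) ` dedges T) m m'"
    by (auto simp: same_views_def multiset_eq_iff)
  finally show ?thesis .
qed

text \<open>Two polynomials that agree with the Hilbert function eventually have a difference with
  infinitely many roots, so the defining description has a unique solution.\<close>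

lemma hilbert_polynomial_eq:
  assumes "\<And>d. poly P (of_nat (Suc d)) = of_nat (hilbert_function X I (Suc d))"
  shows "hilbert_polynomial X I = P"
  unfolding hilbert_polynomial_def
proof (rule the_equality)
  show "\<forall>\<^sub>F d in sequentially. poly P (of_nat d) = of_nat (hilbert_function X I d)"
    using assms by (intro eventually_sequentiallyI[of 1]) (metis Suc_le_D One_nat_def)
next
  fix Q :: "rat poly"
  assume "\<forall>\<^sub>F d in sequentially. poly Q (of_nat d) = of_nat (hilbert_function X I d)"
  then obtain n where n: "\<And>d. d \<ge> n \<Longrightarrow> poly Q (of_nat d) = of_nat (hilbert_function X I d)"
    by (auto simp: eventually_sequentially)
  \<comment> \<open>Starting at \<open>Suc n\<close> keeps \<open>d\<close> positive, so that
    \<open>d - 1\<close> is a true predecessor.\<close>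
  have "of_nat ` {Suc n..} \<subseteq> {x :: rat. poly (Q - P) x = 0}"
  proof clarify
    fix d assume "Suc n \<le> d"
    then show "poly (Q - P) (of_nat d) = 0"
      using n[of d] assms[of "d - 1"] by simp
  qed
  moreover have "infinite (of_nat ` {Suc n..} :: rat set)"
    by (simp add: finite_image_iff inj_on_def infinite_Ici)
  ultimately have "infinite {x. poly (Q - P) x = 0}"
    using finite_subset by blast
  then have "Q - P = 0"
    using poly_roots_finite by blast
  then show "Q = P" by simp
qed

text \<open>Edges and views are matched by covering conditions in both directions, not by a
  bijection, because a glued edge is represented by two views.\<close>

lemma kimura_hilbert_polynomial_nf:
  assumes fin: "finite (dedges T)" and nf: "nf_system A V D"
    and bij: "bij_betw \<psi> A (q_vars (nlab T))"
    and edge: "\<And>e. e \<in> dedges T \<Longrightarrow> \<exists>v\<in>V. \<forall>a\<in>A. edge_sum T (\<psi> a) e = v a"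
    and view: "\<And>v. v \<in> V \<Longrightarrow> \<exists>e\<in>dedges T. \<forall>a\<in>A. edge_sum T (\<psi> a) e = v a"
  shows "poly (kimura_hilbert_polynomial TYPE('k::field) T) (of_nat (Suc d)) =
    of_nat (card (normal_msets D (Suc d)))"
proof -
  let ?E = "(\<lambda>e gs. edge_sum T gs e) ` dedges T"
  have A: "finite A" "D \<subseteq> Pow A" "V \<noteq> {}"
    using nf by (auto simp: nf_system_def)
  have same: "same_views ?E (image_mset \<psi> m) (image_mset \<psi> m') \<longleftrightarrow> same_views V m m'"
    if m: "set_mset m \<subseteq> A" "set_mset m' \<subseteq> A" for m m'
  proof -
    have img: "image_mset (\<lambda>gs. edge_sum T gs e) (image_mset \<psi> k) = image_mset v k"
      if "\<forall>a\<in>A. edge_sum T (\<psi> a) e = v a" "set_mset k \<subseteq> A" for e v k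
      unfolding multiset.map_comp o_def using that by (intro image_mset_cong) blast
    show ?thesis
    proof
      assume same: "same_views ?E (image_mset \<psi> m) (image_mset \<psi> m')"
      show "same_views V m m'"
        unfolding same_views_def
      proof
        fix v assume "v \<in> V"
        then obtain e where e: "e \<in> dedges T" "\<forall>a\<in>A. edge_sum T (\<psi> a) e = v a"
          using view by blast
        then show "image_mset v m = image_mset v m'"
          using same img[OF e(2) m(1)] img[OF e(2) m(2)] unfolding same_views_def by auto
      qed
    next
      assume same: "same_views V m m'"
      show "same_views ?E (image_mset \<psi> m) (image_mset \<psi> m')"
        unfolding same_views_def ball_simps(9)
      proof
        fix e assume "e \<in> dedges T"
        then obtain v where v: "v \<in> V" "\<forall>a\<in>A. edge_sum T (\<psi> a) e = v a"
          using edge by blast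
        then show "image_mset (\<lambda>gs. edge_sum T gs e) (image_mset \<psi> m) =
            image_mset (\<lambda>gs. edge_sum T gs e) (image_mset \<psi> m')"
          using same img[OF v(2) m(1)] img[OF v(2) m(2)] unfolding same_views_def by auto
      qed
    qed
  qed
  have hf: "hilbert_function (q_vars (nlab T)) (kimura_ideal T :: (klein list, 'k) mpol set) d =
      card (normal_msets D d)" for d
  proof -
    have normal: "set_mset m \<subseteq> A" "set_mset m \<in> D" "size m = d" if "m \<in> normal_msets D d" for m
      using that A(2) by (auto simp: normal_msets_def)
    have finN: "finite (normal_msets D d)"
      using normal by (intro finite_subset[OF _ finite_msets_of_size[OF A(1), of d]]) blast
    have inj: "inj_on (image_mset \<psi>) (normal_msets D d)"
    proof (rule inj_onI)
      fix m m' assume m: "m \<in> normal_msets D d" "m' \<in> normal_msets D d" "image_mset \<psi> m = image_mset \<psi> m'"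
      then have "same_views V m m'"
        using same[of m m'] normal(1) by simp
      then show "m = m'"
        using nf_system_unique[OF nf] normal(2) m(1,2) by blast
    qed
    have "hilbert_function (q_vars (nlab T)) (kimura_ideal T :: (klein list, 'k) mpol set) d =
        card (image_mset \<psi> ` normal_msets D d)"
      unfolding kimura_ideal_eq
    proof (rule hilbert_function_transversal)
      show "finite (image_mset \<psi> ` normal_msets D d)"
        using finN by simp
    next
      fix m assume "m \<in> image_mset \<psi> ` normal_msets D d"
      then show "set_mset m \<subseteq> q_vars (nlab T) \<and> size m = d"
        using normal bij_betw_imp_surj_on[OF bij] by fastforce
    next
      fix m m' assume m: "m \<in> image_mset \<psi> ` normal_msets D d" "m' \<in> image_mset \<psi> ` normal_msets D d"
        and eq: "(\<Sum>gs\<in>#m. kimura_exponent T gs) = (\<Sum>gs\<in>#m'. kimura_exponent T gs)"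
      then obtain k k' where k: "m = image_mset \<psi> k" "m' = image_mset \<psi> k'"
        "k \<in> normal_msets D d" "k' \<in> normal_msets D d"
        by blast
      have "same_views V k k'"
        using eq same[OF normal(1)[OF k(3)] normal(1)[OF k(4)]]
        unfolding kimura_exponent_eq_iff[OF fin] k(1,2) by blast
      then show "m = m'"
        using nf_system_unique[OF nf normal(2)[OF k(3)] normal(2)[OF k(4)]] k(1,2) by simp
    next
      fix m assume m: "set_mset m \<subseteq> q_vars (nlab T)" "size m = d"
      define k where "k = image_mset (the_inv_into A \<psi>) m"
      have inv: "the_inv_into A \<psi> x \<in> A" "\<psi> (the_inv_into A \<psi> x) = x" if "x \<in># m" for x
        using that m(1) bij the_inv_into_into[of \<psi> A x A] f_the_inv_into_f[of \<psi> A x]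
        by (auto simp: bij_betw_def)
      have k: "set_mset k \<subseteq> A"
        unfolding k_def using inv(1) by auto
      have "image_mset \<psi> k = image_mset id m"
        unfolding k_def multiset.map_comp using inv(2) by (intro image_mset_cong) simp
      then have km: "image_mset \<psi> k = m" by simp
      obtain k' where k': "set_mset k' \<in> D" "same_views V k k'"
        using nf_system_ex[OF nf k] by blast
      have "size k' = size m"
        using same_views_size[OF k'(2) A(3)] by (simp add: k_def)
      then have "k' \<in> normal_msets D d"
        using k'(1) m(2) by (simp add: normal_msets_def)
      moreover have "set_mset k' \<subseteq> A"
        using k'(1) A(2) by blast
      then have "same_views ?E (image_mset \<psi> k') m"
        using same[OF _ k] same_views_sym[OF k'(2)] unfolding km by blast
      ultimately show "\<exists>m'\<in>image_mset \<psi> ` normal_msets D d.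
          (\<Sum>gs\<in>#m'. kimura_exponent T gs) = (\<Sum>gs\<in>#m. kimura_exponent T gs)"
        unfolding kimura_exponent_eq_iff[OF fin] by blast
    qed
    also have "\<dots> = card (normal_msets D d)"
      by (rule card_image[OF inj])
    finally show ?thesis .
  qed
  \<comment> \<open>The polynomial equals the Hilbert function at every positive integer, so its
    value at 3 is an actual count.\<close>
  obtain P :: "rat poly" where P: "\<And>d. poly P (of_nat (Suc d)) = of_nat (card (normal_msets D (Suc d)))"
    using card_normal_msets_poly[OF A(1,2)] by blast
  have "kimura_hilbert_polynomial TYPE('k) T = P"
    unfolding kimura_hilbert_polynomial_def by (rule hilbert_polynomial_eq) (simp only: P hf)
  then show ?thesis
    by (simp only: P)
qed

section \<open>Rooted trees given by parent maps\<close>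

text \<open>Parents have smaller numbers than their children, so acyclicity, connectedness and
  ancestry become inductions on numbers. That vertex 0 is the root of the model is a separate
  assumption of the lemmas about directed edges.\<close>

locale parent_tree =
  fixes T :: "'v ltree" and n :: "nat \<Rightarrow> 'v" and N :: nat and par :: "nat \<Rightarrow> nat"
  assumes inj: "inj_on n {..<N}" and N: "0 < N"
    and verts: "verts T = n ` {..<N}"
    and par: "\<And>i. 0 < i \<Longrightarrow> i < N \<Longrightarrow> par i < i"
    and edges: "edges T = (\<lambda>i. {n (par i), n i}) ` {1..<N}"
begin

lemma n_eq_iff [simp]: "i < N \<Longrightarrow> j < N \<Longrightarrow> n i = n j \<longleftrightarrow> i = j"
  using inj by (auto simp: inj_on_def)

lemma edge_iff:
  assumes "i < N" "j < N"
  shows "{n i, n j} \<in> edges T \<longleftrightarrow> (0 < j \<and> i = par j) \<or> (0 < i \<and> j = par i)"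
proof
  assume "{n i, n j} \<in> edges T"
  then obtain k where k: "k \<in> {1..<N}" "{n i, n j} = {n (par k), n k}"
    unfolding edges by blast
  moreover have "par k < N"
    using k(1) par[of k] by auto
  ultimately show "(0 < j \<and> i = par j) \<or> (0 < i \<and> j = par i)"
    using assms by (auto simp: doubleton_eq_iff)
next
  assume "(0 < j \<and> i = par j) \<or> (0 < i \<and> j = par i)"
  then show "{n i, n j} \<in> edges T"
    unfolding edges using assms by (auto simp: insert_commute)
qed

lemma is_path_iff:
  "is_path T p \<longleftrightarrow> (\<exists>q. p = map n q \<and> q \<noteq> [] \<and> distinct q \<and> set q \<subseteq> {..<N} \<and>
     successively (\<lambda>i j. (0 < j \<and> i = par j) \<or> (0 < i \<and> j = par i)) q)"
proof -
  have succ: "successively (\<lambda>x y. {x, y} \<in> edges T) (map n q) \<longleftrightarrow>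
      successively (\<lambda>i j. (0 < j \<and> i = par j) \<or> (0 < i \<and> j = par i)) q" if "set q \<subseteq> {..<N}" for q
    unfolding successively_map using that by (intro successively_cong) (auto simp: edge_iff subset_iff)
  show ?thesis
  proof
    assume p: "is_path T p"
    then have "set p \<subseteq> n ` {..<N}"
      unfolding is_path_def verts by blast
    define q where "q = map (the_inv_into {..<N} n) p"
    have pn: "x \<in> n ` {..<N}" if "x \<in> set p" for x
      using that \<open>set p \<subseteq> n ` {..<N}\<close> by blast
    have "map (n \<circ> the_inv_into {..<N} n) p = p"
      using pn by (intro map_idI) (simp add: f_the_inv_into_f[OF inj])
    then have "p = map n q"
      by (simp add: q_def)
    moreover have "set q \<subseteq> {..<N}"
      unfolding q_def set_map using the_inv_into_into[OF inj pn subset_refl] by blast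
    ultimately show "\<exists>q. p = map n q \<and> q \<noteq> [] \<and> distinct q \<and> set q \<subseteq> {..<N} \<and>
     successively (\<lambda>i j. (0 < j \<and> i = par j) \<or> (0 < i \<and> j = par i)) q"
      using p succ[of q] unfolding is_path_def by (intro exI[of _ q]) (auto simp: distinct_map)
  next
    assume "\<exists>q. p = map n q \<and> q \<noteq> [] \<and> distinct q \<and> set q \<subseteq> {..<N} \<and>
     successively (\<lambda>i j. (0 < j \<and> i = par j) \<or> (0 < i \<and> j = par i)) q"
    then obtain q where q: "p = map n q" "q \<noteq> []" "distinct q" "set q \<subseteq> {..<N}"
      "successively (\<lambda>i j. (0 < j \<and> i = par j) \<or> (0 < i \<and> j = par i)) q"
      by blast
    then show "is_path T p"
      unfolding is_path_def verts using succ[of q] inj_on_subset[OF inj q(4)]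
      by (auto simp: distinct_map)
  qed
qed

text \<open>The path is increasing, so its last vertex bounds all the others; this is why it avoids
  every child of that vertex.\<close>

lemma root_path:
  assumes "i < N"
  shows "\<exists>q. q \<noteq> [] \<and> hd q = 0 \<and> last q = i \<and> sorted_wrt (<) q \<and>
    successively (\<lambda>i j. 0 < j \<and> i = par j) q"
  using assms
proof (induction i rule: less_induct)
  case (less i)
  show ?case
  proof (cases "i = 0")
    case True
    then show ?thesis by (intro exI[of _ "[0]"]) simp
  next
    case False
    then have "par i < i" using par less.prems by simp
    then obtain q where q: "q \<noteq> []" "hd q = 0" "last q = par i" "sorted_wrt (<) q"
      "successively (\<lambda>i j. 0 < j \<and> i = par j) q"
      using less.IH[of "par i"] less.prems by auto
    have "x \<le> par i" if "x \<in> set q" for x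
      using q(1,3,4) that by (induction q rule: rev_induct) (auto simp: sorted_wrt_append)
    then have "sorted_wrt (<) (q @ [i])"
      using q(4) \<open>par i < i\<close> by (fastforce simp: sorted_wrt_append)
    moreover have "successively (\<lambda>i j. 0 < j \<and> i = par j) (q @ [i])"
      using q False by (simp add: successively_append_iff)
    ultimately show ?thesis
      using q by (intro exI[of _ "q @ [i]"]) simp
  qed
qed

text \<open>A path that starts at the root never turns back, so it enters every vertex from its parent.\<close>

lemma path_from_root:
  assumes "q \<noteq> []" "hd q = 0" "distinct q" "set q \<subseteq> {..<N}"
    and "successively (\<lambda>i j. (0 < j \<and> i = par j) \<or> (0 < i \<and> j = par i)) q"
  shows "last q = 0 \<or> par (last q) \<in> set q"
  using assms
proof (induction q rule: rev_induct)
  case (snoc j q)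
  show ?case
  proof (cases "q = []")
    case True
    then show ?thesis using snoc.prems by simp
  next
    case False
    let ?i = "last q"
    have step: "(0 < j \<and> ?i = par j) \<or> (0 < ?i \<and> j = par ?i)"
      using snoc.prems(5) False by (simp add: successively_append_iff)
    have "?i = 0 \<or> par ?i \<in> set q"
      using snoc False by (intro snoc.IH) (auto simp: successively_append_iff)
    moreover have "j \<notin> set q"
      using snoc.prems(3) by simp
    ultimately have "?i = par j"
      using step by auto
    then show ?thesis
      using False by (metis UnI1 last_in_set last_snoc set_append)
  qed
qed simp

text \<open>The increasing path to a parent avoids the child, whereas every path from the root to
  the child has passed through the parent.\<close>

lemma dedges_eq:
  assumes "root T = n 0"
  shows "dedges T = (\<lambda>i. (n (par i), n i)) ` {1..<N}"
proof
  show "(\<lambda>i. (n (par i), n i)) ` {1..<N} \<subseteq> dedges T"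
  proof clarify
    fix i assume i: "i \<in> {1..<N}"
    then have par_i: "par i < i" "par i < N"
      using par[of i] by auto
    then obtain q where q: "q \<noteq> []" "hd q = 0" "last q = par i" "sorted_wrt (<) q"
      "successively (\<lambda>i j. 0 < j \<and> i = par j) q"
      using root_path by blast
    have le: "x \<le> par i" if "x \<in> set q" for x
      using q(1,3,4) that by (induction q rule: rev_induct) (auto simp: sorted_wrt_append)
    have "is_path T (map n q)"
      unfolding is_path_iff
    proof (intro exI conjI)
      show "distinct q"
        using q(4) strict_sorted_iff by blast
      show "set q \<subseteq> {..<N}"
        using le par_i(2) by fastforce
      show "successively (\<lambda>i j. (0 < j \<and> i = par j) \<or> (0 < i \<and> j = par i)) q"
        using q(5) by (rule successively_mono) blast
    qed (use q in auto)
    moreover have "n i \<notin> set (map n q)"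
    proof
      assume "n i \<in> set (map n q)"
      then obtain x where "x \<in> set q" "n i = n x" by auto
      then show False
        using le[of x] i par_i by simp
    qed
    ultimately show "(n (par i), n i) \<in> dedges T"
      unfolding dedges_def using q assms i par_i
      by (auto simp: edge_iff hd_map last_map intro!: exI[of _ "map n q"])
  qed
  show "dedges T \<subseteq> (\<lambda>i. (n (par i), n i)) ` {1..<N}"
  proof
    fix e assume "e \<in> dedges T"
    then obtain u v p where e: "e = (u, v)" "{u, v} \<in> edges T" "is_path T p" "hd p = n 0" "last p = u" "v \<notin> set p"
      unfolding dedges_def assms by blast
    then obtain q where q: "p = map n q" "q \<noteq> []" "distinct q" "set q \<subseteq> {..<N}"
      "successively (\<lambda>i j. (0 < j \<and> i = par j) \<or> (0 < i \<and> j = par i)) q"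
      unfolding is_path_iff by blast
    have "hd q < N"
      using q(2,4) hd_in_set by blast
    then have hd: "hd q = 0"
      using e(4) q(1,2) N by (simp add: hd_map)
    have u: "u = n (last q)" "last q < N"
      using e(5) q(1,2) q(4) last_in_set[OF q(2)] by (auto simp: last_map simp del: last_in_set)
    obtain k where k: "k \<in> {1..<N}" "{u, v} = {n (par k), n k}"
      using e(2) unfolding edges by blast
    have kN: "k < N" "par k < N" using k(1) par[of k] by auto
    have "u = n (par k) \<and> v = n k \<or> u = n k \<and> v = n (par k)"
      using k(2) by (auto simp: doubleton_eq_iff)
    then show "e \<in> (\<lambda>i. (n (par i), n i)) ` {1..<N}"
    proof
      assume uv: "u = n k \<and> v = n (par k)"
      then have "last q = k" using u kN by simp
      then have "par k \<in> set q"
        using path_from_root[OF q(2) hd q(3,4,5)] k(1) by auto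
      then show ?thesis
        using uv e(6) q(1) by simp
    qed (use k e(1) in blast)
  qed
qed

text \<open>On a cycle, both neighbours of the vertex with the greatest number would have to be its
  parent. Paths between two vertices arise by replacing the larger endpoint by its parent.\<close>

lemma is_tree: "is_tree T"
proof -
  have card: "e \<subseteq> verts T \<and> card e = 2" if e: "e \<in> edges T" for e
  proof -
    obtain i where "i \<in> {1..<N}" "e = {n (par i), n i}"
      using e unfolding edges by blast
    moreover from this have "par i < i" "i < N" using par[of i] by auto
    ultimately show ?thesis
      by (simp add: verts card_insert_if)
  qed
  have cycle: "\<not> (is_path T p \<and> length p \<ge> 3 \<and> {last p, hd p} \<in> edges T)" for p
  proof
    assume p: "is_path T p \<and> length p \<ge> 3 \<and> {last p, hd p} \<in> edges T"
    let ?R = "\<lambda>i j. (0 < j \<and> i = par j) \<or> (0 < i \<and> j = par i)"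
    obtain q where q: "p = map n q" "q \<noteq> []" "distinct q" "set q \<subseteq> {..<N}" "successively ?R q"
      using p unfolding is_path_iff by blast
    have len: "length q \<ge> 3" using p q(1) by simp
    have lt: "q ! i < N" if "i < length q" for i
      using q(4) that nth_mem by blast
    have closed: "?R (last q) (hd q)"
      using p q(1,2,4) hd_in_set[OF q(2)] last_in_set[OF q(2)]
      by (auto simp: hd_map last_map edge_iff subset_iff)
    obtain m where m: "m < length q" "q ! m = Max (set q)"
      using Max_in[of "set q"] q(2) by (metis List.finite_set in_set_conv_nth set_empty)
    have max: "x \<le> q ! m" if "x \<in> set q" for x
      unfolding m(2) using that by simp
    have up: "x = par (q ! m)" if "?R x (q ! m) \<or> ?R (q ! m) x" "x \<in> set q" for x
    proof (rule ccontr)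
      assume "x \<noteq> par (q ! m)"
      then have "0 < x" "q ! m = par x" using that(1) by auto
      then have "q ! m < x" using par[of x] that(2) q(4) by auto
      then show False using max[OF that(2)] by simp
    qed
    \<comment> \<open>\<open>a\<close> and \<open>b\<close> are the cyclic neighbours of position
      \<open>m\<close>; length at least 3 makes them different.\<close>
    define a where "a = (if m = 0 then length q - 1 else m - 1)"
    define b where "b = (if m = length q - 1 then 0 else m + 1)"
    have ab: "a < length q" "b < length q" "a \<noteq> b"
      using m(1) len by (auto simp: a_def b_def split: if_splits)
    have "?R (q ! a) (q ! m)"
    proof (cases "m = 0")
      case True
      then show ?thesis using closed q(2) by (simp add: a_def last_conv_nth hd_conv_nth)
    next
      case False
      then obtain k where "m = Suc k" using not0_implies_Suc by blast
      then show ?thesis using q(5) m(1) unfolding successively_conv_nth a_def by simp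
    qed
    moreover have "?R (q ! m) (q ! b)"
    proof (cases "m = length q - 1")
      case True
      then show ?thesis using closed q(2) by (simp add: b_def last_conv_nth hd_conv_nth)
    next
      case False
      then have "Suc m < length q" using m(1) by simp
      then show ?thesis using q(5) False unfolding successively_conv_nth b_def by simp
    qed
    ultimately have "q ! a = q ! b"
      using up ab(1,2) nth_mem by metis
    then show False
      using q(3) ab by (simp add: nth_eq_iff_index_eq)
  qed
  \<comment> \<open>The bound by the larger endpoint keeps the path simple: the endpoint being added
    exceeds every vertex of the shorter path.\<close>
  have conn: "\<exists>q. q \<noteq> [] \<and> hd q = i \<and> last q = j \<and> distinct q \<and> (\<forall>x\<in>set q. x \<le> max i j) \<and>
      successively (\<lambda>i j. (0 < j \<and> i = par j) \<or> (0 < i \<and> j = par i)) q"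
    if "i < N" "j < N" for i j
    using that
  proof (induction "i + j" arbitrary: i j rule: less_induct)
    case less
    let ?R = "\<lambda>i j. (0 < j \<and> i = par j) \<or> (0 < i \<and> j = par i)"
    consider "i = j" | "i < j" | "j < i" by linarith
    then show ?case
    proof cases
      case 1
      then show ?thesis by (intro exI[of _ "[i]"]) simp
    next
      case 2
      then have "par j < j" using par less.prems by simp
      then obtain q where q: "q \<noteq> []" "hd q = i" "last q = par j" "distinct q"
        "\<forall>x\<in>set q. x \<le> max i (par j)" "successively ?R q"
        using less.hyps[of i "par j"] less.prems by auto
      then show ?thesis
      proof (intro exI[of _ "q @ [j]"] conjI)
        have less: "x < j" if "x \<in> set q" for x
          using q(5) that 2 \<open>par j < j\<close> by fastforce
        then show "distinct (q @ [j])"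
          using q(4) by fastforce
        show "\<forall>x\<in>set (q @ [j]). x \<le> max i j"
          using less by fastforce
        show "successively ?R (q @ [j])"
          using q(3,6) 2 by (simp add: successively_append_iff)
      qed (use q in simp_all)
    next
      case 3
      then have "par i < i" using par less.prems by simp
      then obtain q where q: "q \<noteq> []" "hd q = par i" "last q = j" "distinct q"
        "\<forall>x\<in>set q. x \<le> max (par i) j" "successively ?R q"
        using less.hyps[of "par i" j] less.prems by auto
      then show ?thesis
      proof (intro exI[of _ "i # q"] conjI)
        have less: "x < i" if "x \<in> set q" for x
          using q(5) that 3 \<open>par i < i\<close> by fastforce
        then show "distinct (i # q)"
          using q(4) by fastforce
        show "\<forall>x\<in>set (i # q). x \<le> max i j"
          using less by fastforce
        show "successively ?R (i # q)"
          using q(2,6) 3 by (simp add: successively_Cons)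
      qed (use q in simp_all)
    qed
  qed
  have "\<exists>p. is_path T p \<and> hd p = n i \<and> last p = n j" if ij: "i < N" "j < N" for i j
  proof -
    obtain q where q: "q \<noteq> []" "hd q = i" "last q = j" "distinct q" "\<forall>x\<in>set q. x \<le> max i j"
      "successively (\<lambda>i j. (0 < j \<and> i = par j) \<or> (0 < i \<and> j = par i)) q"
      using conn[OF ij] by blast
    have "set q \<subseteq> {..<N}"
      using q(5) ij by fastforce
    then have "is_path T (map n q)"
      using q unfolding is_path_iff by blast
    then show ?thesis
      using q(1-3) by (intro exI[of _ "map n q"]) (simp add: hd_map last_map)
  qed
  then have "\<forall>u\<in>verts T. \<forall>v\<in>verts T. \<exists>p. is_path T p \<and> hd p = u \<and> last p = v"
    unfolding verts by blast
  moreover have "finite (verts T) \<and> verts T \<noteq> {}"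
    using N by (auto simp: verts)
  ultimately show ?thesis
    unfolding is_tree_def using card cycle by blast
qed

text \<open>Used as a rewrite rule that climbs from \<open>j\<close> to its parent until the root is
  reached, it decides ancestry by evaluation.\<close>

lemma rtrancl_dedges_iff:
  assumes "root T = n 0" "0 < j" "j < N" "i < N"
  shows "(n i, n j) \<in> (dedges T)\<^sup>* \<longleftrightarrow> i = j \<or> (n i, n (par j)) \<in> (dedges T)\<^sup>*"
proof
  assume "(n i, n j) \<in> (dedges T)\<^sup>*"
  then show "i = j \<or> (n i, n (par j)) \<in> (dedges T)\<^sup>*"
  proof (cases rule: rtranclE)
    case base
    then show ?thesis using assms by simp
  next
    case (step y)
    then obtain k where "k \<in> {1..<N}" "y = n (par k)" "n j = n k"
      unfolding dedges_eq[OF assms(1)] by blast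
    then show ?thesis using step(1) assms by auto
  qed
next
  have "(n (par j), n j) \<in> dedges T"
    unfolding dedges_eq[OF assms(1)] using assms by auto
  then show "(n i, n j) \<in> (dedges T)\<^sup>*" if "i = j \<or> (n i, n (par j)) \<in> (dedges T)\<^sup>*"
    using that by (auto intro: rtrancl_into_rtrancl)
qed

lemma rtrancl_dedges_root_iff:
  assumes "root T = n 0" "i < N"
  shows "(n i, n 0) \<in> (dedges T)\<^sup>* \<longleftrightarrow> i = 0"
proof
  assume "(n i, n 0) \<in> (dedges T)\<^sup>*"
  then show "i = 0"
  proof (cases rule: rtranclE)
    case (step y)
    then obtain k where "k \<in> {1..<N}" "n 0 = n k"
      unfolding dedges_eq[OF assms(1)] by blast
    then show ?thesis using N by simp
  qed (use assms N in simp)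
qed simp

end

context parent_tree
begin

text \<open>The root carries the last label, so deleting both leaves a bijection from the labels 1,
  ..., n to the other leaves.\<close>

lemma nonroot_leaves:
  assumes root: "root T = n 0" and L: "L \<subseteq> {1..<N}" and leaves: "leaves T = n ` insert 0 L"
    and leaf: "bij_betw (leaf T) {1..card (leaves T)} (leaves T)"
  shows "nlab T = card L" "bij_betw (leaf T) {1..nlab T} (n ` L)"
proof -
  have "insert 0 L \<subseteq> {..<N}" "0 \<notin> L" "finite L"
    using L N finite_subset[OF L] by auto
  then have card: "card (leaves T) = Suc (card L)"
    unfolding leaves using card_image[OF inj_on_subset[OF inj, of "insert 0 L"]] by simp
  then show nlab: "nlab T = card L"
    by (simp add: nlab_def)
  have "leaf T (Suc (nlab T)) = n 0"
    using root by (simp add: root_def)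
  moreover have "{1..card (leaves T)} - {Suc (nlab T)} = {1..nlab T}"
    using card nlab by auto
  moreover have "leaves T - {n 0} = n ` L"
    using L N unfolding leaves by (auto simp: subset_iff)
  ultimately show "bij_betw (leaf T) {1..nlab T} (n ` L)"
    using bij_betw_DiffI[OF leaf, of "{Suc (nlab T)}" "{n 0}"] card nlab
    by (auto simp: leaves)
qed

text \<open>Reindexing from leaf labels to vertex numbers removes the arbitrary labelling of the
  leaves from all later computations.\<close>

lemma edge_sum_eq:
  assumes root: "root T = n 0" and L: "L \<subseteq> {1..<N}" and leaves: "leaves T = n ` insert 0 L"
    and leaf: "bij_betw (leaf T) {1..card (leaves T)} (leaves T)"
    and gs: "\<And>k j. k \<in> {1..nlab T} \<Longrightarrow> j \<in> L \<Longrightarrow> leaf T k = n j \<Longrightarrow> gs ! (k - 1) = w j"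
  shows "edge_sum T gs (x, n i) = (\<Sum>j\<in>{j \<in> L. (n i, n j) \<in> (dedges T)\<^sup>*}. w j)"
proof -
  have bij: "bij_betw (leaf T) {1..nlab T} (n ` L)"
    by (rule nonroot_leaves(2)[OF assms(1-4)])
  have injL: "inj_on n L"
    using L by (intro inj_on_subset[OF inj]) auto
  define idx where "idx k = the_inv_into L n (leaf T k)" for k
  have idx: "bij_betw idx {1..nlab T} L"
    unfolding idx_def using bij_betw_trans[OF bij bij_betw_the_inv_into[OF inj_on_imp_bij_betw[OF injL]]]
    by (simp add: o_def)
  have n_idx: "n (idx k) = leaf T k" "idx k \<in> L" if "k \<in> {1..nlab T}" for k
    using that bij_betwE[OF bij] bij_betwE[OF idx] unfolding idx_def
    by (auto intro: f_the_inv_into_f[OF injL])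
  have "edge_sum T gs (x, n i) = (\<Sum>k\<in>{k \<in> {1..nlab T}. (n i, n (idx k)) \<in> (dedges T)\<^sup>*}. w (idx k))"
    unfolding edge_sum_def descendants_def
  proof (rule sum.cong)
    show "{k \<in> {1..nlab T}. (snd (x, n i), leaf T k) \<in> (dedges T)\<^sup>*} =
        {k \<in> {1..nlab T}. (n i, n (idx k)) \<in> (dedges T)\<^sup>*}"
      using n_idx(1) by auto
    show "gs ! (k - 1) = w (idx k)" if "k \<in> {k \<in> {1..nlab T}. (n i, n (idx k)) \<in> (dedges T)\<^sup>*}" for k
      using that n_idx[of k] by (intro gs) simp_all
  qed
  also have "\<dots> = (\<Sum>j\<in>{j \<in> L. (n i, n j) \<in> (dedges T)\<^sup>*}. w j)"
    by (rule sum.reindex_bij_betw[OF bij_betw_Collect[OF idx]]) simp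
  finally show ?thesis .
qed

text \<open>\<open>val a j\<close> is the label that the labelling \<open>a\<close> gives to the edge at the leaf with number \<open>j\<close>.\<close>

lemma kimura_hilbert_polynomial_leaf_values:
  fixes val :: "'a \<Rightarrow> nat \<Rightarrow> klein"
  assumes root: "root T = n 0" and L: "L \<subseteq> {1..<N}" and leaves: "leaves T = n ` insert 0 L"
    and leaf: "bij_betw (leaf T) {1..card (leaves T)} (leaves T)"
    and nf: "nf_system A V D"
    and inj_val: "\<And>a a'. a \<in> A \<Longrightarrow> a' \<in> A \<Longrightarrow> (\<And>j. j \<in> L \<Longrightarrow> val a j = val a' j) \<Longrightarrow> a = a'"
    and surj_val: "\<And>w. \<exists>a\<in>A. \<forall>j\<in>L. val a j = w j"
    and E: "fst ` E = {1..<N}" "snd ` E = V"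
    and edge_views: "\<And>i v a. (i, v) \<in> E \<Longrightarrow> a \<in> A \<Longrightarrow>
      (\<Sum>j\<in>L. if (n i, n j) \<in> (dedges T)\<^sup>* then val a j else 0) = v a"
  shows "poly (kimura_hilbert_polynomial TYPE('k::field) T) (of_nat (Suc d)) =
    of_nat (card (normal_msets D (Suc d)))"
proof -
  have bij: "bij_betw (leaf T) {1..nlab T} (n ` L)"
    by (rule nonroot_leaves(2)[OF assms(1-4)])
  have injL: "inj_on n L"
    using L by (intro inj_on_subset[OF inj]) auto
  define idx where "idx k = the_inv_into L n (leaf T k)" for k
  have idx: "idx k \<in> L" if "k \<in> {1..nlab T}" for k
    using that bij_betwE[OF bij] the_inv_into_into[OF injL _ subset_refl] unfolding idx_def by blast
  have idx_eq: "idx k = j" if "j \<in> L" "leaf T k = n j" for k j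
    unfolding idx_def using that by (simp add: the_inv_into_f_f[OF injL])
  \<comment> \<open>Leaf labels start at 1 and list positions at 0, hence
    \<open>Suc k\<close>.\<close>
  define \<psi> where "\<psi> a = map (\<lambda>k. val a (idx (Suc k))) [0..<nlab T]" for a
  have \<psi>: "\<psi> a ! (k - 1) = val a (idx k)" if "k \<in> {1..nlab T}" for a k
    using that by (auto simp: \<psi>_def)
  have finL: "finite L"
    using L finite_subset by blast
  have sum: "edge_sum T (\<psi> a) (x, n i) =
      (\<Sum>j\<in>L. if (n i, n j) \<in> (dedges T)\<^sup>* then val a j else 0)" for a x i
    unfolding sum.inter_filter[OF finL, symmetric]
    using \<psi> idx_eq by (intro edge_sum_eq[OF assms(1-4)]) simp
  have lab: "\<exists>k\<in>{1..nlab T}. idx k = j" if "j \<in> L" for j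
  proof -
    have "n j \<in> leaf T ` {1..nlab T}"
      using bij_betw_imp_surj_on[OF bij] that by blast
    then obtain k where "k \<in> {1..nlab T}" "leaf T k = n j"
      by (metis imageE)
    then show ?thesis using idx_eq[OF that] by blast
  qed
  show ?thesis
  proof (rule kimura_hilbert_polynomial_nf[OF _ nf])
    show "finite (dedges T)"
      by (simp add: dedges_eq[OF root])
    show "bij_betw \<psi> A (q_vars (nlab T))"
    proof (rule bij_betw_imageI)
      show "inj_on \<psi> A"
      proof (rule inj_onI)
        fix a a' assume a: "a \<in> A" "a' \<in> A" "\<psi> a = \<psi> a'"
        show "a = a'"
        proof (rule inj_val[OF a(1,2)])
          fix j assume "j \<in> L"
          then obtain k where "k \<in> {1..nlab T}" "idx k = j"
            using lab by blast
          then show "val a j = val a' j"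
            using \<psi>[of k a] \<psi>[of k a'] a(3) by simp
        qed
      qed
      show "\<psi> ` A = q_vars (nlab T)"
      proof
        show "\<psi> ` A \<subseteq> q_vars (nlab T)"
          by (auto simp: \<psi>_def q_vars_def)
        show "q_vars (nlab T) \<subseteq> \<psi> ` A"
        proof
          fix gs :: "klein list" assume gs: "gs \<in> q_vars (nlab T)"
          obtain a where a: "a \<in> A" "\<And>j. j \<in> L \<Longrightarrow> val a j = gs ! (the_inv_into {1..nlab T} (leaf T) (n j) - 1)"
            using surj_val[of "\<lambda>j. gs ! (the_inv_into {1..nlab T} (leaf T) (n j) - 1)"] by blast
          have "\<psi> a = gs"
          proof (rule nth_equalityI)
            show "length (\<psi> a) = length gs"
              using gs by (simp add: \<psi>_def q_vars_def)
            fix k assume "k < length (\<psi> a)"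
            then have k: "Suc k \<in> {1..nlab T}" by (simp add: \<psi>_def)
            have "n (idx (Suc k)) = leaf T (Suc k)"
              unfolding idx_def using bij_betwE[OF bij] k by (intro f_the_inv_into_f[OF injL]) blast
            then have "the_inv_into {1..nlab T} (leaf T) (n (idx (Suc k))) = Suc k"
              using the_inv_into_f_f[OF bij_betw_imp_inj_on[OF bij] k] by simp
            then show "\<psi> a ! k = gs ! k"
              using \<psi>[OF k, of a] a(2)[OF idx[OF k]] by simp
          qed
          then show "gs \<in> \<psi> ` A"
            using a(1) by blast
        qed
      qed
    qed
  next
    fix e assume "e \<in> dedges T"
    then obtain i where i: "i \<in> {1..<N}" "e = (n (par i), n i)"
      unfolding dedges_eq[OF root] by blast
    have "i \<in> fst ` E" unfolding E(1) by (rule i(1))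
    then obtain v where v: "(i, v) \<in> E" by auto
    then have "v \<in> V" unfolding E(2)[symmetric] by (rule image_eqI[rotated]) simp
    then show "\<exists>v\<in>V. \<forall>a\<in>A. edge_sum T (\<psi> a) e = v a"
      unfolding i(2) sum using edge_views[OF v] by blast
  next
    fix v assume "v \<in> V"
    then obtain i where i: "(i, v) \<in> E"
      using E(2) by force
    then have "i \<in> {1..<N}"
      using E(1) by force
    then have "(n (par i), n i) \<in> dedges T"
      unfolding dedges_eq[OF root] by blast
    then show "\<exists>e\<in>dedges T. \<forall>a\<in>A. edge_sum T (\<psi> a) e = v a"
      using sum edge_views[OF i] by (intro bexI[of _ "(n (par i), n i)"]) simp_all
  qed
qed

end

section \<open>Matching the glued systems with rooted trees on ten vertices\<close>

lemma klein_add_self [simp]: "x + x = (0 :: klein)" "x + (x + y) = (y :: klein)"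
proof -
  have "b + b = 0" for b :: bit
    by (cases b) simp_all
  then show "x + x = 0"
    by (cases x) (simp add: zero_prod_def)
  then show "x + (x + y) = y"
    by (simp flip: add.assoc)
qed

lemma atLeastLessThan_1_10: "{1..<10::nat} = {1, 2, 3, 4, 5, 6, 7, 8, 9}"
proof -
  have "{1..<10::nat} = set [1..<10]" by auto
  also have "[1..<10] = [1, 2, 3, 4, 5, 6, 7, 8, 9::nat]"
    by (simp add: upt_rec numeral_eq_Suc)
  finally show ?thesis by simp
qed

text \<open>Parent maps of the caterpillar rooted at a leaf of an end vertex, of the caterpillar rooted at a
  leaf of a middle vertex, and of the snowflake. The root has number 0, and \<open>par 0\<close> is a dummy.\<close>

definition cat_end_parent :: "nat \<Rightarrow> nat" where
  "cat_end_parent i = [0, 0, 1, 1, 3, 3, 5, 5, 7, 7] ! i"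

definition cat_mid_parent :: "nat \<Rightarrow> nat" where
  "cat_mid_parent i = [0, 0, 1, 2, 2, 1, 5, 5, 7, 7] ! i"

definition snow_parent :: "nat \<Rightarrow> nat" where
  "snow_parent i = [0, 0, 1, 1, 3, 4, 4, 3, 7, 7] ! i"

text \<open>After the gluing equations five labels remain free, as many as there are leaves other
  than the root.\<close>

lemma cat_setE:
  assumes "a \<in> cat_set"
  obtains k x y x' y' where "a = (((k, x), (x, y)), ((k, x'), (x', y')))"
proof -
  obtain m1 m2 c1 c2 m1' m2' c1' c2' where "a = (((m1, m2), (c1, c2)), ((m1', m2'), (c1', c2')))"
    by (metis surj_pair)
  then show thesis
    using assms that[of m1 m2 c2 m2' c2'] by (simp add: cat_set_def quad_def glue_def)
qed

lemma snow_setE: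
  assumes "a \<in> snow_set"
  obtains x y x' y' y'' where "a = ((((x, x'), (x, y)), (x', y')), (x + x', y''))"
proof -
  obtain k1 k2 c1 c2 c1' c2' c1'' c2'' where "a = ((((k1, k2), (c1, c2)), (c1', c2')), (c1'', c2''))"
    by (metis surj_pair)
  then show thesis
    using assms that[of c1 c1' c2 c2' c2''] by (auto simp: snow_set_def glue_def)
qed

text \<open>Of the two tripods in each half, the one holding the common edge 5 belongs to a middle
  vertex and the other to an end vertex. The root edge is the sum edge of the end tripod in the
  first half.\<close>

lemma cat_end_poly:
  assumes "parent_tree T n 10 cat_end_parent" and root: "root T = n 0"
    and leaves: "leaves T = n ` {0, 2, 4, 6, 8, 9}"
    and leaf: "bij_betw (leaf T) {1..card (leaves T)} (leaves T)"
  shows "poly (kimura_hilbert_polynomial TYPE('k::field) T) 3 = 69324800"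
proof -
  interpret parent_tree T n 10 cat_end_parent by (rule assms(1))
  define val :: "((klein \<times> klein) \<times> (klein \<times> klein)) \<times> ((klein \<times> klein) \<times> (klein \<times> klein)) \<Rightarrow> nat \<Rightarrow> klein"
    where "val = (\<lambda>(((m1, m2), (c1, c2)), ((m1', m2'), (c1', c2'))) j.
      if j = 2 then c2
      else if j = 4 then m1 + m2
      else if j = 6 then m1' + m2'
      else if j = 8 then c2' else c1' + c2')"
  let ?L = "{2, 4, 6, 8, 9 :: nat}"
  \<comment> \<open>An edge is named by its lower vertex. The interior edges 3, 5 and 7 occur twice,
    since they were glued and are seen from both sides.\<close>
  let ?E = "{(5 :: nat, fst \<circ> fst \<circ> fst),
     (3, snd \<circ> fst \<circ> fst),
     (4, (\<lambda>(a, b). a + b) \<circ> fst \<circ> fst),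
     (3, fst \<circ> snd \<circ> fst),
     (2, snd \<circ> snd \<circ> fst),
     (1, (\<lambda>(a, b). a + b) \<circ> snd \<circ> fst),
     (5, fst \<circ> fst \<circ> snd),
     (7, snd \<circ> fst \<circ> snd),
     (6, (\<lambda>(a, b). a + b) \<circ> fst \<circ> snd),
     (7, fst \<circ> snd \<circ> snd),
     (8, snd \<circ> snd \<circ> snd),
     (9, (\<lambda>(a, b). a + b) \<circ> snd \<circ> snd)}"
  note anc = rtrancl_dedges_iff[OF root] rtrancl_dedges_root_iff[OF root] cat_end_parent_def
  have "poly (kimura_hilbert_polynomial TYPE('k) T) (of_nat (Suc 2)) =
      of_nat (card (normal_msets cat_faces (Suc 2)))"
  proof (rule kimura_hilbert_polynomial_leaf_values[OF root _ _ leaf nf_system_cat,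
        where L = ?L and val = val and E = ?E])
    fix a a' assume a: "a \<in> cat_set" "a' \<in> cat_set" and eq: "\<And>j. j \<in> ?L \<Longrightarrow> val a j = val a' j"
    show "a = a'"
      using a eq[of 2] eq[of 4] eq[of 6] eq[of 8] eq[of 9]
      by (elim cat_setE) (simp add: val_def)
  next
    fix w :: "nat \<Rightarrow> klein"
    \<comment> \<open>Every interior edge receives the sum of the leaf labels below it.\<close>
    let ?a = "(((w 6 + w 8 + w 9, w 4 + w 6 + w 8 + w 9), (w 4 + w 6 + w 8 + w 9, w 2)),
      ((w 6 + w 8 + w 9, w 8 + w 9), (w 8 + w 9, w 8)))"
    show "\<exists>a\<in>cat_set. \<forall>j\<in>?L. val a j = w j"
      by (rule bexI[of _ ?a]) (simp_all add: cat_set_def quad_def glue_def val_def add_ac)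
  next
    show "fst ` ?E = {1..<10}"
      unfolding atLeastLessThan_1_10 by (simp add: insert_commute)
    show "snd ` ?E = cat_views"
      by (simp add: cat_views_def quad_views_def tripod_views_def glue_views_def image_Un insert_commute)
  next
    have "\<forall>(i, v)\<in>?E. (\<Sum>j\<in>?L. if (n i, n j) \<in> (dedges T)\<^sup>* then val a j else 0) = v a"
      if "a \<in> cat_set" for a
      using that by (elim cat_setE) (simp add: anc val_def add_ac)
    then show "(\<Sum>j\<in>?L. if (n i, n j) \<in> (dedges T)\<^sup>* then val a j else 0) = v a"
      if "(i, v) \<in> ?E" "a \<in> cat_set" for i v a
      using that by blast
  qed (use leaves in simp_all)
  then show ?thesis
    by (simp add: card_cat flip: numeral_3_eq_3)
qed

text \<open>The same normal forms serve here; the root edge is now the sum edge of a middle tripod,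
  so a different set of five leaf labels determines the labelling.\<close>

lemma cat_mid_poly:
  assumes "parent_tree T n 10 cat_mid_parent" and root: "root T = n 0"
    and leaves: "leaves T = n ` {0, 3, 4, 6, 8, 9}"
    and leaf: "bij_betw (leaf T) {1..card (leaves T)} (leaves T)"
  shows "poly (kimura_hilbert_polynomial TYPE('k::field) T) 3 = 69324800"
proof -
  interpret parent_tree T n 10 cat_mid_parent by (rule assms(1))
  define val :: "((klein \<times> klein) \<times> (klein \<times> klein)) \<times> ((klein \<times> klein) \<times> (klein \<times> klein)) \<Rightarrow> nat \<Rightarrow> klein"
    where "val = (\<lambda>(((m1, m2), (c1, c2)), ((m1', m2'), (c1', c2'))) j.
      if j = 3 then c1 + c2
      else if j = 4 then c2
      else if j = 6 then m1' + m2'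
      else if j = 8 then c2' else c1' + c2')"
  let ?L = "{3, 4, 6, 8, 9 :: nat}"
  let ?E = "{(5 :: nat, fst \<circ> fst \<circ> fst),
     (2, snd \<circ> fst \<circ> fst),
     (1, (\<lambda>(a, b). a + b) \<circ> fst \<circ> fst),
     (2, fst \<circ> snd \<circ> fst),
     (4, snd \<circ> snd \<circ> fst),
     (3, (\<lambda>(a, b). a + b) \<circ> snd \<circ> fst),
     (5, fst \<circ> fst \<circ> snd),
     (7, snd \<circ> fst \<circ> snd),
     (6, (\<lambda>(a, b). a + b) \<circ> fst \<circ> snd),
     (7, fst \<circ> snd \<circ> snd),
     (8, snd \<circ> snd \<circ> snd),
     (9, (\<lambda>(a, b). a + b) \<circ> snd \<circ> snd)}"
  note anc = rtrancl_dedges_iff[OF root] rtrancl_dedges_root_iff[OF root] cat_mid_parent_def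
  have "poly (kimura_hilbert_polynomial TYPE('k) T) (of_nat (Suc 2)) =
      of_nat (card (normal_msets cat_faces (Suc 2)))"
  proof (rule kimura_hilbert_polynomial_leaf_values[OF root _ _ leaf nf_system_cat,
        where L = ?L and val = val and E = ?E])
    fix a a' assume a: "a \<in> cat_set" "a' \<in> cat_set" and eq: "\<And>j. j \<in> ?L \<Longrightarrow> val a j = val a' j"
    show "a = a'"
      using a eq[of 3] eq[of 4] eq[of 6] eq[of 8] eq[of 9]
      by (elim cat_setE) (simp add: val_def)
  next
    fix w :: "nat \<Rightarrow> klein"
    let ?a = "(((w 6 + w 8 + w 9, w 3 + w 4), (w 3 + w 4, w 4)),
      ((w 6 + w 8 + w 9, w 8 + w 9), (w 8 + w 9, w 8)))"
    show "\<exists>a\<in>cat_set. \<forall>j\<in>?L. val a j = w j"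
      by (rule bexI[of _ ?a]) (simp_all add: cat_set_def quad_def glue_def val_def add_ac)
  next
    show "fst ` ?E = {1..<10}"
      unfolding atLeastLessThan_1_10 by (simp add: insert_commute)
    show "snd ` ?E = cat_views"
      by (simp add: cat_views_def quad_views_def tripod_views_def glue_views_def image_Un insert_commute)
  next
    have "\<forall>(i, v)\<in>?E. (\<Sum>j\<in>?L. if (n i, n j) \<in> (dedges T)\<^sup>* then val a j else 0) = v a"
      if "a \<in> cat_set" for a
      using that by (elim cat_setE) (simp add: anc val_def add_ac)
    then show "(\<Sum>j\<in>?L. if (n i, n j) \<in> (dedges T)\<^sup>* then val a j else 0) = v a"
      if "(i, v) \<in> ?E" "a \<in> cat_set" for i v a
      using that by blast
  qed (use leaves in simp_all)
  then show ?thesis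
    by (simp add: card_cat flip: numeral_3_eq_3)
qed

text \<open>The edges 3, 4 and 7 at the central vertex 3 are the glued ones. One root position
  suffices, since the symmetries of the snowflake act transitively on its leaves.\<close>

lemma snow_poly:
  assumes "parent_tree T n 10 snow_parent" and root: "root T = n 0"
    and leaves: "leaves T = n ` {0, 2, 5, 6, 8, 9}"
    and leaf: "bij_betw (leaf T) {1..card (leaves T)} (leaves T)"
  shows "poly (kimura_hilbert_polynomial TYPE('k::field) T) 3 = 69248000"
proof -
  interpret parent_tree T n 10 snow_parent by (rule assms(1))
  define val :: "(((klein \<times> klein) \<times> (klein \<times> klein)) \<times> (klein \<times> klein)) \<times> (klein \<times> klein) \<Rightarrow> nat \<Rightarrow> klein"
    where "val = (\<lambda>((((k1, k2), (c1, c2)), (c1', c2')), (c1'', c2'')) j.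
      if j = 2 then c2
      else if j = 5 then c2'
      else if j = 6 then c1' + c2'
      else if j = 8 then c2'' else c1'' + c2'')"
  let ?L = "{2, 5, 6, 8, 9 :: nat}"
  let ?E = "{(3 :: nat, fst \<circ> fst \<circ> fst \<circ> fst),
     (4, snd \<circ> fst \<circ> fst \<circ> fst),
     (7, (\<lambda>(a, b). a + b) \<circ> fst \<circ> fst \<circ> fst),
     (3, fst \<circ> snd \<circ> fst \<circ> fst),
     (2, snd \<circ> snd \<circ> fst \<circ> fst),
     (1, (\<lambda>(a, b). a + b) \<circ> snd \<circ> fst \<circ> fst),
     (4, fst \<circ> snd \<circ> fst),
     (5, snd \<circ> snd \<circ> fst),
     (6, (\<lambda>(a, b). a + b) \<circ> snd \<circ> fst),
     (7, fst \<circ> snd),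
     (8, snd \<circ> snd),
     (9, (\<lambda>(a, b). a + b) \<circ> snd)}"
  note anc = rtrancl_dedges_iff[OF root] rtrancl_dedges_root_iff[OF root] snow_parent_def
  have "poly (kimura_hilbert_polynomial TYPE('k) T) (of_nat (Suc 2)) =
      of_nat (card (normal_msets snow_faces (Suc 2)))"
  proof (rule kimura_hilbert_polynomial_leaf_values[OF root _ _ leaf nf_system_snow,
        where L = ?L and val = val and E = ?E])
    fix a a' assume a: "a \<in> snow_set" "a' \<in> snow_set" and eq: "\<And>j. j \<in> ?L \<Longrightarrow> val a j = val a' j"
    show "a = a'"
      using a eq[of 2] eq[of 5] eq[of 6] eq[of 8] eq[of 9]
      by (elim snow_setE) (simp add: val_def)
  next
    fix w :: "nat \<Rightarrow> klein"
    let ?a = "((((w 5 + w 6 + w 8 + w 9, w 5 + w 6), (w 5 + w 6 + w 8 + w 9, w 2)), (w 5 + w 6, w 5)), (w 8 + w 9, w 8))"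
    show "\<exists>a\<in>snow_set. \<forall>j\<in>?L. val a j = w j"
      by (rule bexI[of _ ?a]) (simp_all add: snow_set_def glue_def val_def add_ac)
  next
    show "fst ` ?E = {1..<10}"
      unfolding atLeastLessThan_1_10 by (simp add: insert_commute)
    show "snd ` ?E = snow_views"
      by (simp add: snow_views_def tripod_views_def glue_views_def image_Un insert_commute)
  next
    have "\<forall>(i, v)\<in>?E. (\<Sum>j\<in>?L. if (n i, n j) \<in> (dedges T)\<^sup>* then val a j else 0) = v a"
      if "a \<in> snow_set" for a
      using that by (elim snow_setE) (simp add: anc val_def add_ac)
    then show "(\<Sum>j\<in>?L. if (n i, n j) \<in> (dedges T)\<^sup>* then val a j else 0) = v a"
      if "(i, v) \<in> ?E" "a \<in> snow_set" for i v a
      using that by blast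
  qed (use leaves in simp_all)
  then show ?thesis
    by (simp add: card_snow flip: numeral_3_eq_3)
qed

lemma parent_tree_nth:
  assumes "distinct vs" "vs \<noteq> []" "verts T = set vs"
    and "\<And>i. 0 < i \<Longrightarrow> i < length vs \<Longrightarrow> par i < i"
    and "edges T = (\<lambda>i. {vs ! par i, vs ! i}) ` {1..<length vs}"
  shows "parent_tree T ((!) vs) (length vs) par"
proof
  show "inj_on ((!) vs) {..<length vs}"
    using assms(1) by (simp add: inj_on_nth)
  show "verts T = (!) vs ` {..<length vs}"
    using assms(3) by (auto simp: set_conv_nth)
qed (use assms in simp_all)

lemma less_10_cases: "0 < i \<Longrightarrow> i < 10 \<Longrightarrow> i \<in> {1, 2, 3, 4, 5, 6, 7, 8, 9::nat}"
  unfolding atLeastLessThan_1_10[symmetric] by simp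

section \<open>Local structure of 3-valent trees\<close>

lemma leaf_edge_unique:
  assumes "l \<in> leaves T" "e \<in> edges T" "l \<in> e" "e' \<in> edges T" "l \<in> e'"
  shows "e' = e"
proof -
  have "card {e \<in> edges T. l \<in> e} = 1"
    using assms(1) by (simp add: leaves_def degree_of_def)
  then obtain d where d: "{e \<in> edges T. l \<in> e} = {d}"
    by (rule card_1_singletonE)
  have "e \<in> {d}" "e' \<in> {d}"
    unfolding d[symmetric] using assms(2-5) by simp_all
  then show ?thesis by simp
qed

text \<open>On a path to an interior vertex, the second vertex cannot be a leaf: it would need a
  further edge in order to continue.\<close>

lemma leaf_attached:
  assumes T: "trivalent_tree T" and w: "w \<in> interior T" and l: "l \<in> leaves T"
  shows "\<exists>v\<in>interior T. l \<in> attached_leaves T v"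
proof -
  have tree: "is_tree T"
    using T by (simp add: trivalent_tree_def)
  have verts: "l \<in> verts T" "w \<in> verts T" "w \<notin> leaves T"
    using w l by (auto simp: leaves_def interior_def)
  then obtain p where p: "is_path T p" "hd p = l" "last p = w"
    using tree unfolding is_tree_def by blast
  have "l \<noteq> w" using l verts(3) by blast
  then obtain u q where q: "p = l # u # q"
    using p unfolding is_path_def by (metis hd_Cons_tl last_ConsL list.collapse)
  then have e: "{l, u} \<in> edges T" "u \<in> verts T" "u \<noteq> l"
    using p(1) by (auto simp: is_path_def)
  have "u \<notin> leaves T"
  proof
    assume u: "u \<in> leaves T"
    then have "u \<noteq> w" using verts(3) by blast
    then obtain x r where r: "q = x # r"
      using p(3) q by (cases q) auto
    then have "{u, x} \<in> edges T" "x \<noteq> l" "x \<noteq> u"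
      using p(1) q by (auto simp: is_path_def)
    then have "{u, x} = {l, u}"
      using e(1) by (intro leaf_edge_unique[OF u]) simp_all
    then show False
      using \<open>x \<noteq> l\<close> e(3) by (auto simp: doubleton_eq_iff)
  qed
  then have "u \<in> interior T"
    using e(2) by (simp add: interior_def)
  then show ?thesis
    using l e(1) by (auto simp: attached_leaves_def insert_commute)
qed

lemma interior_edges:
  assumes "trivalent_tree T" "v \<in> interior T" "{v, a} \<in> edges T" "{v, b} \<in> edges T" "{v, c} \<in> edges T"
    and "distinct [a, b, c]"
  shows "{e \<in> edges T. v \<in> e} = {{v, a}, {v, b}, {v, c}}"
proof -
  have 3: "card {e \<in> edges T. v \<in> e} = 3"
    using assms(1,2) by (simp add: trivalent_tree_def degree_of_def)
  have "card {{v, a}, {v, b}, {v, c}} = 3"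
    using assms(6) by (auto simp: card_insert_if doubleton_eq_iff)
  moreover have "{{v, a}, {v, b}, {v, c}} \<subseteq> {e \<in> edges T. v \<in> e}"
    using assms(3-5) by blast
  moreover have "finite {e \<in> edges T. v \<in> e}"
    by (rule card_ge_0_finite) (simp add: 3)
  ultimately show ?thesis
    using card_subset_eq[of "{e \<in> edges T. v \<in> e}" "{{v, a}, {v, b}, {v, c}}"] 3 by simp
qed

text \<open>If an end of an edge is a leaf, its only edge leads to an interior vertex. Hence the
  stars of the interior vertices exhaust the edges.\<close>

lemma edges_interior:
  assumes T: "trivalent_tree T" and w: "w \<in> interior T"
  shows "edges T = (\<Union>v\<in>interior T. {e \<in> edges T. v \<in> e})"
proof
  show "edges T \<subseteq> (\<Union>v\<in>interior T. {e \<in> edges T. v \<in> e})"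
  proof
    fix e assume e: "e \<in> edges T"
    then have "e \<subseteq> verts T" "card e = 2"
      using T by (auto simp: trivalent_tree_def is_tree_def)
    then obtain x where x: "x \<in> e" "x \<in> verts T"
      by (metis card.empty ex_in_conv subsetD zero_neq_numeral)
    show "e \<in> (\<Union>v\<in>interior T. {e \<in> edges T. v \<in> e})"
    proof (cases "x \<in> interior T")
      case False
      then have xl: "x \<in> leaves T"
        using x(2) by (simp add: interior_def)
      then obtain v where v: "v \<in> interior T" "x \<in> attached_leaves T v"
        using leaf_attached[OF T w] by blast
      then have "e = {v, x}"
        using e x(1) by (intro leaf_edge_unique[OF xl]) (simp_all add: attached_leaves_def)
      then show ?thesis
        using v(1) e by blast
    qed (use e x in blast)
  qed
qed blast

lemma attached_disjoint:
  assumes "l \<in> attached_leaves T v" "l \<in> attached_leaves T w" "v \<in> interior T"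
  shows "v = w"
proof -
  have "l \<in> leaves T" "{v, l} \<in> edges T" "{w, l} \<in> edges T"
    using assms(1,2) by (auto simp: attached_leaves_def)
  then have "{w, l} = {v, l}"
    by (intro leaf_edge_unique[of l T]) simp_all
  then show ?thesis by (auto simp: doubleton_eq_iff)
qed

lemma verts_interior:
  assumes T: "trivalent_tree T" and w: "w \<in> interior T"
  shows "leaves T = (\<Union>v\<in>interior T. attached_leaves T v)" "verts T = interior T \<union> leaves T"
  using leaf_attached[OF T w] by (auto simp: attached_leaves_def interior_def leaves_def)

lemma finite_leaves: "trivalent_tree T \<Longrightarrow> finite (leaves T)"
  by (auto simp: trivalent_tree_def is_tree_def leaves_def)

lemma attachedD:
  assumes "attached_leaves T v = A" "l \<in> A"
  shows "l \<in> leaves T" "{v, l} \<in> edges T" "l \<notin> interior T"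
  using assms by (auto simp: attached_leaves_def interior_def)

section \<open>Enumerating caterpillars and snowflakes\<close>

text \<open>With vertices and leaves as lists, a symmetry of the tree is a permutation of the
  arguments.\<close>

definition caterpillar_with :: "'v ltree \<Rightarrow> 'v list \<Rightarrow> 'v list \<Rightarrow> bool" where
  "caterpillar_with T vs ls \<longleftrightarrow> (case (vs, ls) of ([v1, v2, v3, v4], [l1, l2, l3, l4, l5, l6]) \<Rightarrow>
     distinct (vs @ ls) \<and> verts T = set (vs @ ls) \<and> leaves T = set ls \<and>
     edges T = {{v1, v2}, {v2, v3}, {v3, v4}, {v1, l1}, {v1, l2}, {v2, l3}, {v3, l4}, {v4, l5}, {v4, l6}}
     | _ \<Rightarrow> False)"

definition snowflake_with :: "'v ltree \<Rightarrow> 'v list \<Rightarrow> 'v list \<Rightarrow> bool" where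
  "snowflake_with T vs ls \<longleftrightarrow> (case (vs, ls) of ([c, w1, w2, w3], [l1, l2, l3, l4, l5, l6]) \<Rightarrow>
     distinct (vs @ ls) \<and> verts T = set (vs @ ls) \<and> leaves T = set ls \<and>
     edges T = {{c, w1}, {c, w2}, {c, w3}, {w1, l1}, {w1, l2}, {w2, l3}, {w2, l4}, {w3, l5}, {w3, l6}}
     | _ \<Rightarrow> False)"

text \<open>At each interior vertex the known neighbours already number three, so the degree
  condition determines its star, and the stars give all edges.\<close>

lemma caterpillar3_obtain:
  assumes "caterpillar3 T"
  obtains v1 v2 v3 v4 l1 l2 l3 l4 l5 l6
  where "caterpillar_with T [v1, v2, v3, v4] [l1, l2, l3, l4, l5, l6]"
proof -
  obtain v1 v2 v3 v4 where T: "trivalent_tree T" and d: "distinct [v1, v2, v3, v4]"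
    and int: "interior T = {v1, v2, v3, v4}"
    and e: "{v1, v2} \<in> edges T" "{v2, v3} \<in> edges T" "{v3, v4} \<in> edges T"
    and c: "card (attached_leaves T v1) = 2" "card (attached_leaves T v2) = 1"
      "card (attached_leaves T v3) = 1" "card (attached_leaves T v4) = 2"
    using assms unfolding caterpillar3_def by blast
  obtain l1 l2 where l12: "attached_leaves T v1 = {l1, l2}" "l1 \<noteq> l2"
    using c(1) by (auto simp: card_2_iff)
  obtain l3 where l3: "attached_leaves T v2 = {l3}"
    using c(2) by (rule card_1_singletonE)
  obtain l4 where l4: "attached_leaves T v3 = {l4}"
    using c(3) by (rule card_1_singletonE)
  obtain l5 l6 where l56: "attached_leaves T v4 = {l5, l6}" "l5 \<noteq> l6"
    using c(4) by (auto simp: card_2_iff)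
  have v1: "v1 \<in> interior T" by (simp add: int)
  have leaves: "leaves T = {l1, l2, l3, l4, l5, l6}"
    unfolding verts_interior(1)[OF T v1] int by (auto simp: l12 l3 l4 l56)
  have verts: "verts T = {v1, v2, v3, v4} \<union> {l1, l2, l3, l4, l5, l6}"
    unfolding verts_interior(2)[OF T v1] int leaves ..
  have disj: "interior T \<inter> leaves T = {}"
    by (auto simp: interior_def)
  have dl: "distinct [l1, l2, l3, l4, l5, l6]"
  proof -
    have *: "attached_leaves T v \<inter> attached_leaves T w = {}" if "v \<in> interior T" "v \<noteq> w" for v w
      using attached_disjoint[OF _ _ that(1)] that(2) by blast
    show ?thesis
      using *[of v1 v2] *[of v1 v3] *[of v1 v4] *[of v2 v3] *[of v2 v4] *[of v3 v4] d l12(2) l56(2)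
      unfolding int l12(1) l3 l4 l56(1) by auto
  qed
  have d10: "distinct ([v1, v2, v3, v4] @ [l1, l2, l3, l4, l5, l6])"
    using d dl disj unfolding int leaves by auto
  have la: "{v1, l1} \<in> edges T" "{v1, l2} \<in> edges T" "{v2, l3} \<in> edges T" "{v3, l4} \<in> edges T"
    "{v4, l5} \<in> edges T" "{v4, l6} \<in> edges T"
    using attachedD(2)[OF l12(1)] attachedD(2)[OF l3] attachedD(2)[OF l4] attachedD(2)[OF l56(1)] by auto
  have e': "{v2, v1} \<in> edges T" "{v3, v2} \<in> edges T" "{v4, v3} \<in> edges T"
    using e by (simp_all add: insert_commute)
  have i1: "{e \<in> edges T. v1 \<in> e} = {{v1, v2}, {v1, l1}, {v1, l2}}"
    using d10 by (intro interior_edges[OF T _ e(1) la(1,2)]) (auto simp: int)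
  have i2: "{e \<in> edges T. v2 \<in> e} = {{v2, v1}, {v2, v3}, {v2, l3}}"
    using d10 by (intro interior_edges[OF T _ e'(1) e(2) la(3)]) (auto simp: int)
  have i3: "{e \<in> edges T. v3 \<in> e} = {{v3, v2}, {v3, v4}, {v3, l4}}"
    using d10 by (intro interior_edges[OF T _ e'(2) e(3) la(4)]) (auto simp: int)
  have i4: "{e \<in> edges T. v4 \<in> e} = {{v4, v3}, {v4, l5}, {v4, l6}}"
    using d10 by (intro interior_edges[OF T _ e'(3) la(5,6)]) (auto simp: int)
  have "edges T = {e \<in> edges T. v1 \<in> e} \<union> {e \<in> edges T. v2 \<in> e} \<union> {e \<in> edges T. v3 \<in> e} \<union> {e \<in> edges T. v4 \<in> e}"
    using edges_interior[OF T v1] unfolding int by blast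
  then have "edges T = {{v1, v2}, {v2, v3}, {v3, v4}, {v1, l1}, {v1, l2}, {v2, l3}, {v3, l4}, {v4, l5}, {v4, l6}}"
    unfolding i1 i2 i3 i4 by (simp add: insert_commute Un_insert_left)
  then show thesis
    using d10 verts leaves by (intro that[of v1 v2 v3 v4 l1 l2 l3 l4 l5 l6]) (simp add: caterpillar_with_def insert_commute)
qed

lemma snowflake_obtain:
  assumes "snowflake T"
  obtains c w1 w2 w3 l1 l2 l3 l4 l5 l6
  where "snowflake_with T [c, w1, w2, w3] [l1, l2, l3, l4, l5, l6]"
proof -
  obtain c w1 w2 w3 where T: "trivalent_tree T" and d: "distinct [c, w1, w2, w3]"
    and int: "interior T = {c, w1, w2, w3}"
    and e: "{c, w1} \<in> edges T" "{c, w2} \<in> edges T" "{c, w3} \<in> edges T"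
    and cd: "card (attached_leaves T w1) = 2" "card (attached_leaves T w2) = 2"
      "card (attached_leaves T w3) = 2"
    using assms unfolding snowflake_def by blast
  obtain l1 l2 where l12: "attached_leaves T w1 = {l1, l2}" "l1 \<noteq> l2"
    using cd(1) by (auto simp: card_2_iff)
  obtain l3 l4 where l34: "attached_leaves T w2 = {l3, l4}" "l3 \<noteq> l4"
    using cd(2) by (auto simp: card_2_iff)
  obtain l5 l6 where l56: "attached_leaves T w3 = {l5, l6}" "l5 \<noteq> l6"
    using cd(3) by (auto simp: card_2_iff)
  have c: "c \<in> interior T" by (simp add: int)
  have disj: "interior T \<inter> leaves T = {}"
    by (auto simp: interior_def)
  have ic: "{e \<in> edges T. c \<in> e} = {{c, w1}, {c, w2}, {c, w3}}"
    using d by (intro interior_edges[OF T c e]) auto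
  \<comment> \<open>The centre already has three interior neighbours, which leaves no edge for a
    leaf.\<close>
  have "attached_leaves T c = {}"
  proof -
    have False if "l \<in> leaves T" "{c, l} \<in> edges T" for l
    proof -
      have "{c, l} \<in> {{c, w1}, {c, w2}, {c, w3}}"
        unfolding ic[symmetric] using that(2) by simp
      then have "l \<in> interior T"
        unfolding int by (auto simp: doubleton_eq_iff)
      then show False using disj that(1) by blast
    qed
    then show ?thesis by (auto simp: attached_leaves_def)
  qed
  then have leaves: "leaves T = {l1, l2, l3, l4, l5, l6}"
    unfolding verts_interior(1)[OF T c] int by (auto simp: l12 l34 l56)
  have verts: "verts T = {c, w1, w2, w3} \<union> {l1, l2, l3, l4, l5, l6}"
    unfolding verts_interior(2)[OF T c] int leaves ..
  have dl: "distinct [l1, l2, l3, l4, l5, l6]"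
  proof -
    have *: "attached_leaves T v \<inter> attached_leaves T w = {}" if "v \<in> interior T" "v \<noteq> w" for v w
      using attached_disjoint[OF _ _ that(1)] that(2) by blast
    show ?thesis
      using *[of w1 w2] *[of w1 w3] *[of w2 w3] d l12(2) l34(2) l56(2)
      unfolding int l12(1) l34(1) l56(1) by auto
  qed
  have d10: "distinct ([c, w1, w2, w3] @ [l1, l2, l3, l4, l5, l6])"
    using d dl disj unfolding int leaves by auto
  have la: "{w1, l1} \<in> edges T" "{w1, l2} \<in> edges T" "{w2, l3} \<in> edges T" "{w2, l4} \<in> edges T"
    "{w3, l5} \<in> edges T" "{w3, l6} \<in> edges T"
    using attachedD(2)[OF l12(1)] attachedD(2)[OF l34(1)] attachedD(2)[OF l56(1)] by auto
  have e': "{w1, c} \<in> edges T" "{w2, c} \<in> edges T" "{w3, c} \<in> edges T"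
    using e by (simp_all add: insert_commute)
  have i1: "{e \<in> edges T. w1 \<in> e} = {{w1, c}, {w1, l1}, {w1, l2}}"
    using d10 by (intro interior_edges[OF T _ e'(1) la(1,2)]) (auto simp: int)
  have i2: "{e \<in> edges T. w2 \<in> e} = {{w2, c}, {w2, l3}, {w2, l4}}"
    using d10 by (intro interior_edges[OF T _ e'(2) la(3,4)]) (auto simp: int)
  have i3: "{e \<in> edges T. w3 \<in> e} = {{w3, c}, {w3, l5}, {w3, l6}}"
    using d10 by (intro interior_edges[OF T _ e'(3) la(5,6)]) (auto simp: int)
  have "edges T = {e \<in> edges T. c \<in> e} \<union> {e \<in> edges T. w1 \<in> e} \<union> {e \<in> edges T. w2 \<in> e} \<union> {e \<in> edges T. w3 \<in> e}"
    using edges_interior[OF T c] unfolding int by blast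
  then have "edges T = {{c, w1}, {c, w2}, {c, w3}, {w1, l1}, {w1, l2}, {w2, l3}, {w2, l4}, {w3, l5}, {w3, l6}}"
    unfolding ic i1 i2 i3 by (simp add: insert_commute Un_insert_left)
  then show thesis
    using d10 verts leaves by (intro that[of c w1 w2 w3 l1 l2 l3 l4 l5 l6]) (simp add: snowflake_with_def insert_commute)
qed

lemma root_leaf:
  assumes "trivalent_tree T" "leaves T \<noteq> {}"
  shows "root T \<in> leaves T" "bij_betw (leaf T) {1..card (leaves T)} (leaves T)"
proof -
  show leaf: "bij_betw (leaf T) {1..card (leaves T)} (leaves T)"
    using assms(1) by (simp add: trivalent_tree_def)
  have "card (leaves T) > 0"
    using assms finite_leaves by (simp add: card_gt_0_iff)
  then show "root T \<in> leaves T"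
    using bij_betwE[OF leaf] by (simp add: root_def nlab_def)
qed

text \<open>Swapping two leaves at an end and reversing the path move any leaf to the place of
  \<open>l1\<close> or \<open>l3\<close>, the two root positions treated.\<close>

lemma caterpillar_swap:
  assumes "caterpillar_with T [v1, v2, v3, v4] [l1, l2, l3, l4, l5, l6]"
  shows "caterpillar_with T [v1, v2, v3, v4] [l2, l1, l3, l4, l5, l6]"
    "caterpillar_with T [v4, v3, v2, v1] [l5, l6, l4, l3, l1, l2]"
  using assms by (auto simp: caterpillar_with_def insert_commute)

lemma caterpillar_end_root:
  assumes "caterpillar_with T [v1, v2, v3, v4] [l1, l2, l3, l4, l5, l6]" "root T = l1" "trivalent_tree T"
  shows "poly (kimura_hilbert_polynomial TYPE('k::field) T) 3 = 69324800"
proof -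
  \<comment> \<open>The order is the numbering behind \<open>cat_end_parent\<close>: the root first,
    then each interior vertex followed by its leaf along the path.\<close>
  let ?vs = "[l1, v1, l2, v2, l3, v3, l4, v4, l5, l6]"
  have c: "distinct ?vs" "verts T = set ?vs" "leaves T = {l1, l2, l3, l4, l5, l6}"
    "edges T = {{v1, v2}, {v2, v3}, {v3, v4}, {v1, l1}, {v1, l2}, {v2, l3}, {v3, l4}, {v4, l5}, {v4, l6}}"
    using assms(1) by (auto simp: caterpillar_with_def)
  have "parent_tree T ((!) ?vs) (length ?vs) cat_end_parent"
  proof (rule parent_tree_nth[OF c(1) _ c(2)])
    fix i assume "0 < i" "i < length ?vs"
    then have "i \<in> {1, 2, 3, 4, 5, 6, 7, 8, 9}" by (intro less_10_cases) simp_all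
    then show "cat_end_parent i < i"
      by (elim insertE emptyE; simp add: cat_end_parent_def)
  next
    have len: "length ?vs = 10" by simp
    show "edges T = (\<lambda>i. {?vs ! cat_end_parent i, ?vs ! i}) ` {1..<length ?vs}"
      unfolding c(4) len atLeastLessThan_1_10 by (simp add: cat_end_parent_def insert_commute)
  qed simp
  moreover have "length ?vs = 10" by simp
  ultimately have "parent_tree T ((!) ?vs) 10 cat_end_parent" by (simp only:)
  then show ?thesis
    using root_leaf(2)[OF assms(3)] c(3) assms(2)
    by (intro cat_end_poly[of T "(!) ?vs"]) simp_all
qed

lemma caterpillar_mid_root:
  assumes "caterpillar_with T [v1, v2, v3, v4] [l1, l2, l3, l4, l5, l6]" "root T = l3" "trivalent_tree T"
  shows "poly (kimura_hilbert_polynomial TYPE('k::field) T) 3 = 69324800"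
proof -
  let ?vs = "[l3, v2, v1, l1, l2, v3, l4, v4, l5, l6]"
  have c: "distinct ?vs" "verts T = set ?vs" "leaves T = {l3, l1, l2, l4, l5, l6}"
    "edges T = {{v1, v2}, {v2, v3}, {v3, v4}, {v1, l1}, {v1, l2}, {v2, l3}, {v3, l4}, {v4, l5}, {v4, l6}}"
    using assms(1) by (auto simp: caterpillar_with_def)
  have "parent_tree T ((!) ?vs) (length ?vs) cat_mid_parent"
  proof (rule parent_tree_nth[OF c(1) _ c(2)])
    fix i assume "0 < i" "i < length ?vs"
    then have "i \<in> {1, 2, 3, 4, 5, 6, 7, 8, 9}" by (intro less_10_cases) simp_all
    then show "cat_mid_parent i < i"
      by (elim insertE emptyE; simp add: cat_mid_parent_def)
  next
    have len: "length ?vs = 10" by simp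
    show "edges T = (\<lambda>i. {?vs ! cat_mid_parent i, ?vs ! i}) ` {1..<length ?vs}"
      unfolding c(4) len atLeastLessThan_1_10 by (simp add: cat_mid_parent_def insert_commute)
  qed simp
  moreover have "length ?vs = 10" by simp
  ultimately have "parent_tree T ((!) ?vs) 10 cat_mid_parent" by (simp only:)
  then show ?thesis
    using root_leaf(2)[OF assms(3)] c(3) assms(2)
    by (intro cat_mid_poly[of T "(!) ?vs"]) simp_all
qed

lemma caterpillar3_poly:
  assumes "caterpillar3 T"
  shows "poly (kimura_hilbert_polynomial TYPE('k::field) T) 3 = 69324800"
proof -
  have T: "trivalent_tree T"
    using assms by (simp add: caterpillar3_def)
  obtain v1 v2 v3 v4 l1 l2 l3 l4 l5 l6
    where c: "caterpillar_with T [v1, v2, v3, v4] [l1, l2, l3, l4, l5, l6]"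
    using caterpillar3_obtain[OF assms] .
  then have leaves: "leaves T = {l1, l2, l3, l4, l5, l6}"
    by (simp add: caterpillar_with_def)
  note c' = caterpillar_swap(2)[OF c]
  have "root T \<in> {l1, l2, l3, l4, l5, l6}"
    using root_leaf(1)[OF T] leaves by simp
  then show ?thesis
    using caterpillar_end_root[OF c _ T] caterpillar_end_root[OF caterpillar_swap(1)[OF c] _ T]
      caterpillar_mid_root[OF c _ T] caterpillar_mid_root[OF c' _ T]
      caterpillar_end_root[OF c' _ T] caterpillar_end_root[OF caterpillar_swap(1)[OF c'] _ T]
    by blast
qed

text \<open>Swapping the first two leaves and rotating the three arms suffice to bring any leaf to
  the place of \<open>l1\<close>.\<close>

lemma snowflake_perm:
  assumes "snowflake_with T [c, w1, w2, w3] [l1, l2, l3, l4, l5, l6]"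
  shows "snowflake_with T [c, w1, w2, w3] [l2, l1, l3, l4, l5, l6]"
    "snowflake_with T [c, w2, w3, w1] [l3, l4, l5, l6, l1, l2]"
  using assms by (auto simp: snowflake_with_def insert_commute)

lemma snowflake_root:
  assumes "snowflake_with T [c, w1, w2, w3] [l1, l2, l3, l4, l5, l6]" "root T = l1" "trivalent_tree T"
  shows "poly (kimura_hilbert_polynomial TYPE('k::field) T) 3 = 69248000"
proof -
  let ?vs = "[l1, w1, l2, c, w2, l3, l4, w3, l5, l6]"
  have c: "distinct ?vs" "verts T = set ?vs" "leaves T = {l1, l2, l3, l4, l5, l6}"
    "edges T = {{c, w1}, {c, w2}, {c, w3}, {w1, l1}, {w1, l2}, {w2, l3}, {w2, l4}, {w3, l5}, {w3, l6}}"
    using assms(1) by (auto simp: snowflake_with_def)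
  have "parent_tree T ((!) ?vs) (length ?vs) snow_parent"
  proof (rule parent_tree_nth[OF c(1) _ c(2)])
    fix i assume "0 < i" "i < length ?vs"
    then have "i \<in> {1, 2, 3, 4, 5, 6, 7, 8, 9}" by (intro less_10_cases) simp_all
    then show "snow_parent i < i"
      by (elim insertE emptyE; simp add: snow_parent_def)
  next
    have len: "length ?vs = 10" by simp
    show "edges T = (\<lambda>i. {?vs ! snow_parent i, ?vs ! i}) ` {1..<length ?vs}"
      unfolding c(4) len atLeastLessThan_1_10 by (simp add: snow_parent_def insert_commute)
  qed simp
  moreover have "length ?vs = 10" by simp
  ultimately have "parent_tree T ((!) ?vs) 10 snow_parent" by (simp only:)
  then show ?thesis
    using root_leaf(2)[OF assms(3)] c(3) assms(2)
    by (intro snow_poly[of T "(!) ?vs"]) simp_all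
qed

lemma snowflake_poly:
  assumes "snowflake T"
  shows "poly (kimura_hilbert_polynomial TYPE('k::field) T) 3 = 69248000"
proof -
  have T: "trivalent_tree T"
    using assms by (simp add: snowflake_def)
  obtain c w1 w2 w3 l1 l2 l3 l4 l5 l6
    where c: "snowflake_with T [c, w1, w2, w3] [l1, l2, l3, l4, l5, l6]"
    using snowflake_obtain[OF assms] .
  then have leaves: "leaves T = {l1, l2, l3, l4, l5, l6}"
    by (simp add: snowflake_with_def)
  note c' = snowflake_perm(2)[OF c] and c'' = snowflake_perm(2)[OF snowflake_perm(2)[OF c]]
  have "root T \<in> {l1, l2, l3, l4, l5, l6}"
    using root_leaf(1)[OF T] leaves by simp
  then show ?thesis
    using snowflake_root[OF c _ T] snowflake_root[OF snowflake_perm(1)[OF c] _ T]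
      snowflake_root[OF c' _ T] snowflake_root[OF snowflake_perm(1)[OF c'] _ T]
      snowflake_root[OF c'' _ T] snowflake_root[OF snowflake_perm(1)[OF c''] _ T]
    by blast
qed

section \<open>Concrete trees and the main theorem\<close>

text \<open>Here the parent map only lists the edges: label 6 sits at vertex 9, so the root of the
  model is 9 and not 0.\<close>

definition cat_tree :: "nat ltree" where
  "cat_tree = \<lparr>verts = {..<10}, edges = (\<lambda>i. {cat_end_parent i, i}) ` {1..<10},
     leaf = (\<lambda>k. [0, 2, 4, 6, 8, 9] ! (k - 1))\<rparr>"

definition snow_tree :: "nat ltree" where
  "snow_tree = \<lparr>verts = {..<10}, edges = (\<lambda>i. {snow_parent i, i}) ` {1..<10},
     leaf = (\<lambda>k. [0, 2, 5, 6, 8, 9] ! (k - 1))\<rparr>"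

lemma lessThan_10: "{..<10::nat} = {0, 1, 2, 3, 4, 5, 6, 7, 8, 9}"
proof -
  have "{..<10::nat} = insert 0 {1..<10}" by auto
  then show ?thesis unfolding atLeastLessThan_1_10 .
qed

lemma cat_tree_simps:
  "verts cat_tree = {0, 1, 2, 3, 4, 5, 6, 7, 8, 9}"
  "edges cat_tree = {{0, 1}, {1, 2}, {1, 3}, {3, 4}, {3, 5}, {5, 6}, {5, 7}, {7, 8}, {7, 9}}"
  unfolding cat_tree_def lessThan_10 atLeastLessThan_1_10 by (simp_all add: cat_end_parent_def)

lemma snow_tree_simps:
  "verts snow_tree = {0, 1, 2, 3, 4, 5, 6, 7, 8, 9}"
  "edges snow_tree = {{0, 1}, {1, 2}, {1, 3}, {3, 4}, {4, 5}, {4, 6}, {3, 7}, {7, 8}, {7, 9}}"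
  unfolding snow_tree_def lessThan_10 atLeastLessThan_1_10 by (simp_all add: snow_parent_def)

lemma is_tree_cat_tree: "is_tree cat_tree"
proof -
  interpret parent_tree cat_tree id 10 cat_end_parent
  proof
    fix i :: nat assume "0 < i" "i < 10"
    then have "i \<in> {1, 2, 3, 4, 5, 6, 7, 8, 9}" by (rule less_10_cases)
    then show "cat_end_parent i < i"
      by (elim insertE emptyE; simp add: cat_end_parent_def)
  qed (simp_all add: cat_tree_def)
  show ?thesis by (rule is_tree)
qed

lemma is_tree_snow_tree: "is_tree snow_tree"
proof -
  interpret parent_tree snow_tree id 10 snow_parent
  proof
    fix i :: nat assume "0 < i" "i < 10"
    then have "i \<in> {1, 2, 3, 4, 5, 6, 7, 8, 9}" by (rule less_10_cases)
    then show "snow_parent i < i"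
      by (elim insertE emptyE; simp add: snow_parent_def)
  qed (simp_all add: snow_tree_def)
  show ?thesis by (rule is_tree)
qed

lemma Collect_insert_conv:
  "{x \<in> insert a B. P x} = (if P a then insert a {x \<in> B. P x} else {x \<in> B. P x})"
  by auto

lemma degree_cat_tree:
  "degree_of cat_tree 0 = 1" "degree_of cat_tree 1 = 3" "degree_of cat_tree 2 = 1" "degree_of cat_tree 3 = 3"
  "degree_of cat_tree 4 = 1" "degree_of cat_tree 5 = 3" "degree_of cat_tree 6 = 1" "degree_of cat_tree 7 = 3"
  "degree_of cat_tree 8 = 1" "degree_of cat_tree 9 = 1"
  unfolding degree_of_def cat_tree_simps Collect_insert_conv
  by (simp_all add: doubleton_eq_iff)

lemma degree_snow_tree:
  "degree_of snow_tree 0 = 1" "degree_of snow_tree 1 = 3" "degree_of snow_tree 2 = 1" "degree_of snow_tree 3 = 3"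
  "degree_of snow_tree 4 = 3" "degree_of snow_tree 5 = 1" "degree_of snow_tree 6 = 1" "degree_of snow_tree 7 = 3"
  "degree_of snow_tree 8 = 1" "degree_of snow_tree 9 = 1"
  unfolding degree_of_def snow_tree_simps Collect_insert_conv
  by (simp_all add: doubleton_eq_iff)

lemma leaves_cat_tree: "leaves cat_tree = {0, 2, 4, 6, 8, 9}"
  unfolding leaves_def cat_tree_simps Collect_insert_conv degree_cat_tree by simp

lemma leaves_snow_tree: "leaves snow_tree = {0, 2, 5, 6, 8, 9}"
  unfolding leaves_def snow_tree_simps Collect_insert_conv degree_snow_tree by simp

lemma interior_cat_tree: "interior cat_tree = {1, 3, 5, 7}"
  unfolding interior_def leaves_cat_tree cat_tree_simps by auto

lemma interior_snow_tree: "interior snow_tree = {1, 3, 4, 7}"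
  unfolding interior_def leaves_snow_tree snow_tree_simps by auto

lemma atLeastAtMost_1_6: "{1..6::nat} = {1, 2, 3, 4, 5, 6}"
  by auto

lemma trivalent_cat_tree: "trivalent_tree cat_tree"
  unfolding trivalent_tree_def interior_cat_tree
proof (intro conjI)
  show "is_tree cat_tree" by (rule is_tree_cat_tree)
  show "\<forall>v\<in>{1, 3, 5, 7}. degree_of cat_tree v = 3"
    using degree_cat_tree by simp
  have 6: "card (leaves cat_tree) = 6"
    unfolding leaves_cat_tree by simp
  show "bij_betw (leaf cat_tree) {1..card (leaves cat_tree)} (leaves cat_tree)"
    unfolding 6 unfolding leaves_cat_tree atLeastAtMost_1_6 by (simp add: bij_betw_def inj_on_def cat_tree_def)
qed

lemma trivalent_snow_tree: "trivalent_tree snow_tree"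
  unfolding trivalent_tree_def interior_snow_tree
proof (intro conjI)
  show "is_tree snow_tree" by (rule is_tree_snow_tree)
  show "\<forall>v\<in>{1, 3, 4, 7}. degree_of snow_tree v = 3"
    using degree_snow_tree by simp
  have 6: "card (leaves snow_tree) = 6"
    unfolding leaves_snow_tree by simp
  show "bij_betw (leaf snow_tree) {1..card (leaves snow_tree)} (leaves snow_tree)"
    unfolding 6 unfolding leaves_snow_tree atLeastAtMost_1_6 by (simp add: bij_betw_def inj_on_def snow_tree_def)
qed

lemma caterpillar3_cat_tree: "caterpillar3 cat_tree"
  unfolding caterpillar3_def
proof (intro conjI exI)
  show "trivalent_tree cat_tree" by (rule trivalent_cat_tree)
  show "interior cat_tree = {1, 3, 5, 7}" by (rule interior_cat_tree)
  have att: "attached_leaves cat_tree 1 = {0, 2}" "attached_leaves cat_tree 3 = {4}"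
    "attached_leaves cat_tree 5 = {6}" "attached_leaves cat_tree 7 = {8, 9}"
    unfolding attached_leaves_def leaves_cat_tree cat_tree_simps Collect_insert_conv
    by (simp_all add: doubleton_eq_iff)
  show "card (attached_leaves cat_tree 1) = 2" "card (attached_leaves cat_tree 3) = 1"
    "card (attached_leaves cat_tree 5) = 1" "card (attached_leaves cat_tree 7) = 2"
    unfolding att by simp_all
qed (simp_all add: cat_tree_simps)

lemma snowflake_snow_tree: "snowflake snow_tree"
  unfolding snowflake_def
proof (intro conjI exI)
  show "trivalent_tree snow_tree" by (rule trivalent_snow_tree)
  show "interior snow_tree = {3, 1, 4, 7}" unfolding interior_snow_tree by auto
  have att: "attached_leaves snow_tree 1 = {0, 2}" "attached_leaves snow_tree 4 = {5, 6}"
    "attached_leaves snow_tree 7 = {8, 9}"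
    unfolding attached_leaves_def leaves_snow_tree snow_tree_simps Collect_insert_conv
    by (simp_all add: doubleton_eq_iff)
  show "card (attached_leaves snow_tree 1) = 2" "card (attached_leaves snow_tree 4) = 2"
    "card (attached_leaves snow_tree 7) = 2"
    unfolding att by simp_all
qed (simp_all add: snow_tree_simps insert_commute)

theorem mainTheorem1:
  shows "(\<forall>(T3c :: 'v ltree) (Tsn :: 'w ltree). caterpillar3 T3c \<longrightarrow> snowflake Tsn \<longrightarrow>
      poly (kimura_hilbert_polynomial TYPE('k::field) T3c) 3
        \<noteq> poly (kimura_hilbert_polynomial TYPE('k) Tsn) 3
      \<and> kimura_hilbert_polynomial TYPE('k) T3c \<noteq> kimura_hilbert_polynomial TYPE('k) Tsn)
    \<and> \<not> (\<exists>H. \<forall>T :: nat ltree. trivalent_tree T \<longrightarrow>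
        kimura_hilbert_polynomial TYPE('k) T = H (card (leaves T)))"
proof (intro conjI allI impI)
  fix T3c :: "'v ltree" and Tsn :: "'w ltree"
  assume "caterpillar3 T3c" "snowflake Tsn"
  then show "poly (kimura_hilbert_polynomial TYPE('k) T3c) 3
      \<noteq> poly (kimura_hilbert_polynomial TYPE('k) Tsn) 3"
    by (simp add: caterpillar3_poly snowflake_poly)
  then show "kimura_hilbert_polynomial TYPE('k) T3c \<noteq> kimura_hilbert_polynomial TYPE('k) Tsn"
    by auto
next
  show "\<not> (\<exists>H. \<forall>T :: nat ltree. trivalent_tree T \<longrightarrow>
      kimura_hilbert_polynomial TYPE('k) T = H (card (leaves T)))"
  proof
    assume "\<exists>H. \<forall>T :: nat ltree. trivalent_tree T \<longrightarrow>
      kimura_hilbert_polynomial TYPE('k) T = H (card (leaves T))"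
    then obtain H where H: "\<And>T :: nat ltree. trivalent_tree T \<Longrightarrow>
      kimura_hilbert_polynomial TYPE('k) T = H (card (leaves T))"
      by blast
    have "card (leaves cat_tree) = card (leaves snow_tree)"
      unfolding leaves_cat_tree leaves_snow_tree by simp
    then have "kimura_hilbert_polynomial TYPE('k) cat_tree = kimura_hilbert_polynomial TYPE('k) snow_tree"
      using H[OF trivalent_cat_tree] H[OF trivalent_snow_tree] by simp
    then show False
      using caterpillar3_poly[OF caterpillar3_cat_tree, where ?'k = 'k]
        snowflake_poly[OF snowflake_snow_tree, where ?'k = 'k] by simp
  qed
qed

end
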